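(* Let $n\ge 3$, $\gamma\ge\frac{2n}{n+2}$, and let the total momentum $P=\int_{\mathbb R^n}\rho u\,dx$ satisfy $P\ne0$. Let $(\rho,u,p)$ be a solution to the Navier-Stokes system (NS* ) with properties (i), (ii), (iii) (see context) such that the entropy $S$ does not decrease along the particle trajectories. If in addition the incompressibility requirement $\mathrm{div}_x u=0$ holds, then the solution loses its initial smoothness within a finite time.
   Context: Constants: $\mu>0$, $\lambda+\frac2n\mu>0$ (viscosity coefficients), $k\ge 0$ (heat conduction), $R>0$ (gas constant), $A>0$, $\gamma>1$, $c=\frac{R}{\gamma-1}$. The unknowns are the density $\rho$, velocity $u=(u_1,\dots,u_n)$ and pressure $p$, functions of $t\ge 0$, $x\in\mathbb R^n$. The stress tensor is $T_{ij}=\mu(\partial_i u_j+\partial_j u_i)+\lambda\,(\mathrm{div}\,u)\,\delta_{ij}$. (NS* ) is the system $$\partial_t\rho+\mathrm{div}_x(\rho u)=0,$$ $$\partial_t(\rho u)+\mathrm{div}_x(\rho u\otimes u)+\nabla_x p=\mathrm{Div}\,T,$$ $$\partial_t p+(u,\nabla_x p)+\gamma p\,\mathrm{div}\,u=(\gamma-1)\sum_{i,j=1}^n T_{ij}\partial_j u_i+(\gamma-1)\frac{k}{R}\Delta\frac{p}{\rho},$$ with initial data $(\rho,u,p)|_{t=0}=(\rho_0,u_0,p_0)\in H^m(\mathbb R^n)$, $m>[n/2]+2$. The temperature $\theta$ and specific entropy $S$ are related to $\rho,p$ by the state equations $p=R\rho\theta$ and $p=A\exp(S/c)\rho^\gamma$.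 Entropy not decreasing along particle trajectories means $\frac{dS}{dt}=\partial_tS+(u,\nabla_xS)\ge0$. Properties of a solution: (i) the solution is classical; (ii) at every fixed $t$, as $|x|\to\infty$: $\rho=O(|x|^{-(n+2+\varepsilon)})$ and $p=O(|x|^{-(n+\varepsilon)})$ with $\varepsilon>0$, $|u|=o(|x|^{-(n-1)})$, $|Du|=o(|x|^{-n})$, and, if $k\neq0$, additionally $|D\theta|=o(|x|^{-(n-1)})$ (these guarantee that $P$ is conserved); (iii) $\rho(t,x)\ge 0$. *)

theory Defs
  imports "HOL-Analysis.Analysis" "HOL-Library.Landau_Symbols"
begin

definition pd :: "'n \<Rightarrow> (real^'n \<Rightarrow> real) \<Rightarrow> real^'n \<Rightarrow> real" where
  "pd i f x = deriv (\<lambda>h. f (x + h *\<^sub>R axis i 1)) 0"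

text \<open>The derivative in \<open>t \<ge> 0\<close>: two-sided for \<open>t > 0\<close>, one-sided at \<open>t = 0\<close>.\<close>

definition dt :: "(real \<Rightarrow> real^'n \<Rightarrow> real) \<Rightarrow> real \<Rightarrow> real^'n \<Rightarrow> real" where
  "dt f t x = vector_derivative (\<lambda>s. f s x) (at t within {0..})"

definition divg :: "(real^'n \<Rightarrow> real^'n) \<Rightarrow> real^'n \<Rightarrow> real" where
  "divg v x = (\<Sum>i\<in>UNIV. pd i (\<lambda>y. v y $ i) x)"

definition laplacian :: "(real^'n \<Rightarrow> real) \<Rightarrow> real^'n \<Rightarrow> real" where
  "laplacian f x = (\<Sum>i\<in>UNIV. pd i (pd i f) x)"

definition advect :: "real^'n \<Rightarrow> (real^'n \<Rightarrow> real) \<Rightarrow> real^'n \<Rightarrow> real" where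
  "advect v f x = (\<Sum>i\<in>UNIV. v $ i * pd i f x)"

definition grad_norm :: "(real^'n \<Rightarrow> real) \<Rightarrow> real^'n \<Rightarrow> real" where
  "grad_norm f x = sqrt (\<Sum>i\<in>UNIV. (pd i f x)\<^sup>2)"

definition jacobian_norm :: "(real^'n \<Rightarrow> real^'n) \<Rightarrow> real^'n \<Rightarrow> real" where
  "jacobian_norm v x = sqrt (\<Sum>i\<in>UNIV. \<Sum>j\<in>UNIV. (pd j (\<lambda>y. v y $ i) x)\<^sup>2)"

primrec C_k :: "nat \<Rightarrow> (real^'n \<Rightarrow> real) \<Rightarrow> bool" where
  "C_k 0 f \<longleftrightarrow> continuous_on UNIV f"
| "C_k (Suc k) f \<longleftrightarrow> (\<forall>x. f differentiable (at x)) \<and> (\<forall>i. C_k k (pd i f))"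

definition test_function :: "(real^'n \<Rightarrow> real) \<Rightarrow> bool" where
  "test_function \<phi> \<longleftrightarrow> (\<forall>k. C_k k \<phi>) \<and> (\<exists>r. \<forall>x. norm x > r \<longrightarrow> \<phi> x = 0)"

definition weak_pd :: "'n \<Rightarrow> (real^'n \<Rightarrow> real) \<Rightarrow> (real^'n \<Rightarrow> real) \<Rightarrow> bool" where
  "weak_pd i f g \<longleftrightarrow>
     (\<forall>\<phi>. test_function \<phi> \<longrightarrow>
        (LINT x|lborel. f x * pd i \<phi> x) = - (LINT x|lborel. g x * \<phi> x))"

definition L2_bounded :: "real \<Rightarrow> (real^'n \<Rightarrow> real) \<Rightarrow> bool" where
  "L2_bounded K f \<longleftrightarrow> f \<in> borel_measurable lborel \<and>
     integrable lborel (\<lambda>x. (f x)\<^sup>2) \<and> (LINT x|lborel. (f x)\<^sup>2) \<le> K\<^sup>2"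

text \<open>All weak derivatives of order at most \<open>m\<close> exist and have \<open>L\<^sup>2\<close> norm at most \<open>\<bar>K\<bar>\<close>; up to
  constants depending on \<open>m\<close> and \<open>n\<close> this says that the \<open>H\<^sup>m\<close> norm is at most \<open>\<bar>K\<bar>\<close>.\<close>

primrec sobolev_bounded :: "nat \<Rightarrow> real \<Rightarrow> (real^'n \<Rightarrow> real) \<Rightarrow> bool" where
  "sobolev_bounded 0 K f \<longleftrightarrow> L2_bounded K f"
| "sobolev_bounded (Suc m) K f \<longleftrightarrow>
     L2_bounded K f \<and> (\<forall>i. \<exists>g. weak_pd i f g \<and> sobolev_bounded m K g)"

definition sobolev :: "nat \<Rightarrow> (real^'n \<Rightarrow> real) \<Rightarrow> bool" where
  "sobolev m f \<longleftrightarrow> (\<exists>K. sobolev_bounded m K f)"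

definition time_dom :: "ereal \<Rightarrow> real set" where
  "time_dom T = {t. 0 \<le> t \<and> ereal t < T}"

definition jointly_continuous :: "ereal \<Rightarrow> (real \<Rightarrow> real^'n \<Rightarrow> real) \<Rightarrow> bool" where
  "jointly_continuous T f \<longleftrightarrow> continuous_on (time_dom T \<times> UNIV) (\<lambda>(t, x). f t x)"

definition C1_x :: "ereal \<Rightarrow> (real \<Rightarrow> real^'n \<Rightarrow> real) \<Rightarrow> bool" where
  "C1_x T f \<longleftrightarrow> jointly_continuous T f \<and>
     (\<forall>t\<in>time_dom T. \<forall>x. f t differentiable (at x)) \<and>
     (\<forall>i. jointly_continuous T (\<lambda>t. pd i (f t)))"

definition C2_x :: "ereal \<Rightarrow> (real \<Rightarrow> real^'n \<Rightarrow> real) \<Rightarrow> bool" where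
  "C2_x T f \<longleftrightarrow> C1_x T f \<and> (\<forall>i. C1_x T (\<lambda>t. pd i (f t)))"

definition C1_t :: "ereal \<Rightarrow> (real \<Rightarrow> real^'n \<Rightarrow> real) \<Rightarrow> bool" where
  "C1_t T f \<longleftrightarrow>
     (\<forall>t\<in>time_dom T. \<forall>x. (\<lambda>s. f s x) differentiable (at t within {0..})) \<and>
     jointly_continuous T (dt f)"

text \<open>Every derivative occurring in the system exists and is continuous. Second derivatives of the
  temperature occur only in the heat conduction term, hence only if \<open>k \<noteq> 0\<close>.\<close>

definition classical ::
  "real \<Rightarrow> ereal \<Rightarrow> (real \<Rightarrow> real^'n \<Rightarrow> real) \<Rightarrow> (real \<Rightarrow> real^'n \<Rightarrow> real^'n) \<Rightarrow>
   (real \<Rightarrow> real^'n \<Rightarrow> real) \<Rightarrow> (real \<Rightarrow> real^'n \<Rightarrow> real) \<Rightarrow> bool" where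
  "classical k T \<rho> u p \<theta> \<longleftrightarrow>
     C1_t T \<rho> \<and> C1_x T \<rho> \<and> C1_t T p \<and> C1_x T p \<and>
     (\<forall>i. C1_t T (\<lambda>t x. u t x $ i) \<and> C2_x T (\<lambda>t x. u t x $ i)) \<and>
     (k \<noteq> 0 \<longrightarrow> C2_x T \<theta>)"

definition stress :: "real \<Rightarrow> real \<Rightarrow> (real^'n \<Rightarrow> real^'n) \<Rightarrow> 'n \<Rightarrow> 'n \<Rightarrow> real^'n \<Rightarrow> real" where
  "stress \<mu> lam v i j x =
     \<mu> * (pd i (\<lambda>y. v y $ j) x + pd j (\<lambda>y. v y $ i) x) + (if i = j then lam * divg v x else 0)"

definition mass_eq ::
  "ereal \<Rightarrow> (real \<Rightarrow> real^'n \<Rightarrow> real) \<Rightarrow> (real \<Rightarrow> real^'n \<Rightarrow> real^'n) \<Rightarrow> bool" where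
  "mass_eq T \<rho> u \<longleftrightarrow>
     (\<forall>t\<in>time_dom T. \<forall>x. dt \<rho> t x + divg (\<lambda>y. \<rho> t y *\<^sub>R u t y) x = 0)"

definition momentum_eq ::
  "real \<Rightarrow> real \<Rightarrow> ereal \<Rightarrow> (real \<Rightarrow> real^'n \<Rightarrow> real) \<Rightarrow> (real \<Rightarrow> real^'n \<Rightarrow> real^'n) \<Rightarrow>
   (real \<Rightarrow> real^'n \<Rightarrow> real) \<Rightarrow> bool" where
  "momentum_eq \<mu> lam T \<rho> u p \<longleftrightarrow>
     (\<forall>t\<in>time_dom T. \<forall>x. \<forall>i.
        dt (\<lambda>s y. \<rho> s y * u s y $ i) t x
        + (\<Sum>j\<in>UNIV. pd j (\<lambda>y. \<rho> t y * u t y $ i * u t y $ j) x)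
        + pd i (p t) x
        = (\<Sum>j\<in>UNIV. pd j (stress \<mu> lam (u t) i j) x))"

text \<open>The quotient \<open>p / \<rho>\<close> is written \<open>R \<theta>\<close>, which equals it where \<open>\<rho> > 0\<close> by the state
  equation and, unlike it, is meaningful across a vacuum.\<close>

definition pressure_eq ::
  "real \<Rightarrow> real \<Rightarrow> real \<Rightarrow> real \<Rightarrow> real \<Rightarrow> ereal \<Rightarrow> (real \<Rightarrow> real^'n \<Rightarrow> real^'n) \<Rightarrow>
   (real \<Rightarrow> real^'n \<Rightarrow> real) \<Rightarrow> (real \<Rightarrow> real^'n \<Rightarrow> real) \<Rightarrow> bool" where
  "pressure_eq \<mu> lam k R \<gamma> T u p \<theta> \<longleftrightarrow>
     (\<forall>t\<in>time_dom T. \<forall>x.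
        dt p t x + advect (u t x) (p t) x + \<gamma> * p t x * divg (u t) x
        = (\<gamma> - 1) * (\<Sum>i\<in>UNIV. \<Sum>j\<in>UNIV. stress \<mu> lam (u t) i j x * pd j (\<lambda>y. u t y $ i) x)
          + (\<gamma> - 1) * (k / R) * laplacian (\<lambda>y. R * \<theta> t y) x)"

definition state_eqs ::
  "real \<Rightarrow> real \<Rightarrow> real \<Rightarrow> real \<Rightarrow> ereal \<Rightarrow> (real \<Rightarrow> real^'n \<Rightarrow> real) \<Rightarrow> (real \<Rightarrow> real^'n \<Rightarrow> real) \<Rightarrow>
   (real \<Rightarrow> real^'n \<Rightarrow> real) \<Rightarrow> (real \<Rightarrow> real^'n \<Rightarrow> real) \<Rightarrow> bool" where
  "state_eqs R A c \<gamma> T \<rho> p \<theta> S \<longleftrightarrow>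
     (\<forall>t\<in>time_dom T. \<forall>x. p t x = R * \<rho> t x * \<theta> t x \<and>
                       p t x = A * exp (S t x / c) * \<rho> t x powr \<gamma>)"

text \<open>Where \<open>\<rho> = 0\<close> the state equation leaves \<open>S\<close> undetermined, so nothing is required there;
  where \<open>\<rho> > 0\<close> it makes \<open>S\<close> as smooth as \<open>\<rho>\<close> and \<open>p\<close>.\<close>

definition entropy_nondecreasing ::
  "ereal \<Rightarrow> (real \<Rightarrow> real^'n \<Rightarrow> real) \<Rightarrow> (real \<Rightarrow> real^'n \<Rightarrow> real^'n) \<Rightarrow>
   (real \<Rightarrow> real^'n \<Rightarrow> real) \<Rightarrow> bool" where
  "entropy_nondecreasing T \<rho> u S \<longleftrightarrow>
     (\<forall>t\<in>time_dom T. \<forall>x. \<rho> t x > 0 \<longrightarrow> dt S t x + advect (u t x) (S t) x \<ge> 0)"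

definition decay ::
  "real \<Rightarrow> ereal \<Rightarrow> (real \<Rightarrow> real^'n \<Rightarrow> real) \<Rightarrow> (real \<Rightarrow> real^'n \<Rightarrow> real^'n) \<Rightarrow>
   (real \<Rightarrow> real^'n \<Rightarrow> real) \<Rightarrow> (real \<Rightarrow> real^'n \<Rightarrow> real) \<Rightarrow> bool" where
  "decay k T \<rho> u p \<theta> \<longleftrightarrow>
     (let n = real CARD('n) in
      \<forall>t\<in>time_dom T.
        (\<exists>\<epsilon>>0. \<rho> t \<in> O[at_infinity](\<lambda>x. norm x powr - (n + 2 + \<epsilon>)) \<and>
                p t \<in> O[at_infinity](\<lambda>x. norm x powr - (n + \<epsilon>))) \<and>
        (\<lambda>x. norm (u t x)) \<in> o[at_infinity](\<lambda>x. norm x powr - (n - 1)) \<and>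
        jacobian_norm (u t) \<in> o[at_infinity](\<lambda>x. norm x powr - n) \<and>
        (k \<noteq> 0 \<longrightarrow> grad_norm (\<theta> t) \<in> o[at_infinity](\<lambda>x. norm x powr - (n - 1))))"

definition total_momentum ::
  "(real \<Rightarrow> real^'n \<Rightarrow> real) \<Rightarrow> (real \<Rightarrow> real^'n \<Rightarrow> real^'n) \<Rightarrow> real \<Rightarrow> real^'n" where
  "total_momentum \<rho> u t = (LINT x|lborel. \<rho> t x *\<^sub>R u t x)"

definition keeps_initial_smoothness ::
  "nat \<Rightarrow> ereal \<Rightarrow> (real \<Rightarrow> real^'n \<Rightarrow> real) \<Rightarrow> (real \<Rightarrow> real^'n \<Rightarrow> real^'n) \<Rightarrow>
   (real \<Rightarrow> real^'n \<Rightarrow> real) \<Rightarrow> bool" where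
  "keeps_initial_smoothness m T \<rho> u p \<longleftrightarrow>
     (\<forall>t\<in>time_dom T. \<exists>K. \<forall>s\<in>{0..t}.
        sobolev_bounded m K (\<rho> s) \<and> (\<forall>i. sobolev_bounded m K (\<lambda>x. u s x $ i)) \<and>
        sobolev_bounded m K (p s))"

text \<open>The initial smoothness is that of the data, \<open>H\<^sup>m\<close>. For a classical solution on \<open>[0,T)\<close>:
  at some finite time \<open>\<tau>\<close> either it has ceased to exist as a classical solution (\<open>T < \<tau>\<close>), or its
  \<open>H\<^sup>m\<close> norm has not stayed finite, locally uniformly in time, on \<open>[0,\<tau>)\<close>.\<close>

definition loses_initial_smoothness ::
  "nat \<Rightarrow> ereal \<Rightarrow> (real \<Rightarrow> real^'n \<Rightarrow> real) \<Rightarrow> (real \<Rightarrow> real^'n \<Rightarrow> real^'n) \<Rightarrow>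
   (real \<Rightarrow> real^'n \<Rightarrow> real) \<Rightarrow> bool" where
  "loses_initial_smoothness m T \<rho> u p \<longleftrightarrow>
     (\<exists>\<tau>>0. \<not> (ereal \<tau> \<le> T \<and> keeps_initial_smoothness m (ereal \<tau>) \<rho> u p))"

end

theory Submission
  imports Defs
begin

text \<open>
Suppose the solution never loses its smoothness. Then it exists for all times, and on every
time interval \<open>[0,t]\<close> the Sobolev bounds control \<open>\<rho>\<close>, \<open>u\<close>, \<open>p\<close> in \<open>L\<^sup>2\<close> and \<open>u\<close> in the sup norm,
uniformly in time (\<open>sobolev_bounded_sup\<close>). A conserved momentum \<open>P \<noteq> 0\<close> then forces the
kinetic energy to become negative.

The decay at infinity is assumed at each fixed time only, with constants that may depend on
time, so the usual integrations by parts over the whole space cannot be integrated in time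
directly. Instead every balance law is tested against a cutoff of radius \<open>N\<close>, and the flux
through the cutoff region is shown to be \<open>O(1/N)\<close> uniformly on \<open>[0,t]\<close>, by means of the uniform
\<open>L\<^sup>2\<close> and sup bounds. Decay enters through three facts about a single time: \<open>\<rho>\<close> is initially
integrable, \<open>p\<close> is integrable at each time, and \<open>u\<close> tends to \<open>0\<close> at infinity.

Incompressibility makes \<open>\<rho>\<close> constant along trajectories, so \<open>\<integral> \<rho>\<close> and \<open>\<integral> \<rho>\<^sup>2\<close> do not grow
(\<open>density_bound\<close>, \<open>density_square_bound\<close>). Since \<open>\<rho>\<close> is transported, growth of the entropy means
growth of the pressure along trajectories, so \<open>\<integral> p\<close> on \<open>[0,t]\<close> is bounded by its value at time
\<open>t\<close> (\<open>pressure_bound\<close>). For the momentum, the test fields are the gradients of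
\<open>x\<^sub>a \<eta>\<^sub>N(x)\<close>: the viscous force is \<open>\<mu> \<Delta> u\<close>, which is divergence free and hence orthogonal to
gradients, so the viscous flux vanishes identically, and what is left is \<open>O(1/N)\<close> because
\<open>\<rho> |u|\<^sup>2\<close> and \<open>p\<close> are integrable uniformly in time (\<open>momentum_conserved\<close>).

In dimension \<open>n \<ge> 3\<close> a function that vanishes at infinity is recovered from its gradient along
rays, and averaging over directions bounds \<open>\<integral> \<rho> |w|\<close> by \<open>\<integral> \<rho>\<close>, \<open>\<integral> \<rho>\<^sup>2\<close> and \<open>\<integral> |\<nabla> w|\<^sup>2\<close>
(\<open>nn_integral_density_mult_le\<close>). Applied to a component of \<open>u\<close> whose momentum is not zero, this
gives \<open>\<integral> |\<nabla> u|\<^sup>2 \<ge> b > 0\<close> at all times (\<open>gradient_lower_bound\<close>). But the pressure does no work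
on an incompressible flow, so the kinetic energy decreases at the rate \<open>\<mu> \<integral> |\<nabla> u|\<^sup>2\<close>
(\<open>energy_flux_le\<close>), which cannot go on for ever (\<open>momentum_zero\<close>).
\<close>

section \<open>Partial derivatives and integration by parts\<close>

definition grad :: "(real^'n \<Rightarrow> real) \<Rightarrow> real^'n \<Rightarrow> real^'n" where
  "grad f x = (\<chi> i. pd i f x)"

lemma pd_eq:
  assumes "(f has_derivative f') (at x)"
  shows "pd i f x = f' (axis i 1)"
proof -
  have l: "((\<lambda>h::real. x + h *\<^sub>R axis i 1) has_derivative (\<lambda>h. h *\<^sub>R axis i 1)) (at 0)"
    by (auto intro!: derivative_eq_intros)
  have "(f \<circ> (\<lambda>h. x + h *\<^sub>R axis i 1) has_derivative f' \<circ> (\<lambda>h. h *\<^sub>R axis i 1)) (at 0)"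
    by (rule diff_chain_at[OF l]) (use assms in simp)
  moreover have "f' \<circ> (\<lambda>h. h *\<^sub>R axis i 1) = (\<lambda>h. h * f' (axis i 1))"
    using linear_cmul[OF has_derivative_linear[OF assms]] by (auto simp: o_def)
  ultimately have "((\<lambda>h. f (x + h *\<^sub>R axis i 1)) has_derivative (\<lambda>h. h * f' (axis i 1))) (at 0)"
    by (simp add: o_def)
  then have "((\<lambda>h. f (x + h *\<^sub>R axis i 1)) has_field_derivative f' (axis i 1)) (at 0)"
    by (rule has_derivative_imp_has_field_derivative) simp
  then show ?thesis unfolding pd_def by (rule DERIV_imp_deriv)
qed

lemma has_derivative_grad:
  assumes "f differentiable (at x)"
  shows "(f has_derivative (\<lambda>h. h \<bullet> grad f x)) (at x)"
proof -
  obtain f' where f': "(f has_derivative f') (at x)" using assms by (auto simp: differentiable_def)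
  have "f' h = h \<bullet> grad f x" for h
  proof -
    have "f' h = f' (\<Sum>i\<in>UNIV. h $ i *\<^sub>R axis i 1)"
      using basis_expansion[of h] by (simp add: scalar_mult_eq_scaleR)
    also have "\<dots> = (\<Sum>i\<in>UNIV. h $ i * f' (axis i 1))"
      using has_derivative_linear[OF f'] by (simp add: linear_sum linear_cmul)
    finally show ?thesis by (simp add: grad_def inner_vec_def pd_eq[OF f'])
  qed
  then have "f' = (\<lambda>h. h \<bullet> grad f x)" by auto
  with f' show ?thesis by simp
qed

lemma pd_has_derivative_line:
  assumes "f differentiable (at (x + r *\<^sub>R v))"
  shows "((\<lambda>h. f (x + h *\<^sub>R v)) has_real_derivative (v \<bullet> grad f (x + r *\<^sub>R v))) (at r)"
proof -
  have l: "((\<lambda>h::real. x + h *\<^sub>R v) has_derivative (\<lambda>h. h *\<^sub>R v)) (at r)"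
    by (auto intro!: derivative_eq_intros)
  have "(f \<circ> (\<lambda>h. x + h *\<^sub>R v) has_derivative (\<lambda>h. h \<bullet> grad f (x + r *\<^sub>R v)) \<circ> (\<lambda>h. h *\<^sub>R v)) (at r)"
    by (rule diff_chain_at[OF l has_derivative_grad[OF assms]])
  then have "((\<lambda>h. f (x + h *\<^sub>R v)) has_derivative (\<lambda>h. h * (v \<bullet> grad f (x + r *\<^sub>R v)))) (at r)"
    by (simp add: o_def)
  then show ?thesis by (rule has_derivative_imp_has_field_derivative) simp
qed

lemma axis_inner_grad: "axis i 1 \<bullet> grad f x = pd i f x"
  by (simp add: inner_axis' grad_def)

lemma pd_add:
  assumes "f differentiable (at x)" "g differentiable (at x)"
  shows "pd i (\<lambda>y. f y + g y) x = pd i f x + pd i g x"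
  using pd_eq[OF has_derivative_add[OF has_derivative_grad[OF assms(1)] has_derivative_grad[OF assms(2)]]]
    pd_eq[OF has_derivative_grad[OF assms(1)]] pd_eq[OF has_derivative_grad[OF assms(2)]] by simp

lemma pd_mult:
  assumes "f differentiable (at x)" "g differentiable (at x)"
  shows "pd i (\<lambda>y. f y * g y) x = f x * pd i g x + pd i f x * g x"
  using pd_eq[OF has_derivative_mult[OF has_derivative_grad[OF assms(1)] has_derivative_grad[OF assms(2)]]]
    pd_eq[OF has_derivative_grad[OF assms(1)]] pd_eq[OF has_derivative_grad[OF assms(2)]] by simp

lemma pd_sum:
  assumes "\<And>j. j \<in> A \<Longrightarrow> f j differentiable (at x)"
  shows "pd i (\<lambda>y. \<Sum>j\<in>A. f j y) x = (\<Sum>j\<in>A. pd i (f j) x)"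
proof -
  have "((\<lambda>y. \<Sum>j\<in>A. f j y) has_derivative (\<lambda>h. \<Sum>j\<in>A. h \<bullet> grad (f j) x)) (at x)"
    by (intro has_derivative_sum has_derivative_grad assms)
  from pd_eq[OF this] show ?thesis
    using pd_eq[OF has_derivative_grad[OF assms]] by (simp cong: sum.cong)
qed

lemma pd_const [simp]:
  fixes x :: "real^'n"
  shows "pd i (\<lambda>y. c) x = 0"
  by (rule pd_eq[OF has_derivative_const])

lemma pd_cmult:
  assumes "f differentiable (at x)"
  shows "pd i (\<lambda>y. c * f y) x = c * pd i f x"
  using pd_mult[of "\<lambda>_. c" x f i] assms by simp

lemma pd_cong_open:
  assumes "open S" "x \<in> S" "\<And>y. y \<in> S \<Longrightarrow> f y = g y"
  shows "pd i f x = pd i g x"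
  unfolding pd_def
proof (rule deriv_cong_ev)
  have "((\<lambda>h. x + h *\<^sub>R axis i 1) \<longlongrightarrow> x + 0 *\<^sub>R axis i 1) (nhds (0::real))"
    by (intro tendsto_intros filterlim_ident)
  then have "eventually (\<lambda>h::real. x + h *\<^sub>R axis i 1 \<in> S) (nhds 0)"
    using assms(1,2) by (auto simp: tendsto_def)
  then show "\<forall>\<^sub>F h in nhds 0. f (x + h *\<^sub>R axis i 1) = g (x + h *\<^sub>R axis i 1)"
    by eventually_elim (use assms(3) in auto)
qed simp

lemma pd_zero_outside:
  assumes "\<And>x. norm x > r \<Longrightarrow> f x = 0" "norm x > r"
  shows "pd i f x = 0"
proof -
  have "open {y::real^'a. norm y > r}" by (intro open_Collect_less continuous_intros)
  then have "pd i f x = pd i (\<lambda>_. 0) x" by (rule pd_cong_open) (use assms in auto)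
  then show ?thesis by simp
qed

lemma integrable_compact_support:
  fixes g :: "real^'n \<Rightarrow> real"
  assumes "continuous_on UNIV g" "\<And>x. norm x > r \<Longrightarrow> g x = 0"
  shows "integrable lborel g"
proof -
  have "integrable lborel (\<lambda>x. indicator (cball 0 r) x *\<^sub>R g x)"
    by (rule borel_integrable_compact) (auto intro: continuous_on_subset assms)
  moreover have "(\<lambda>x. indicator (cball 0 r) x *\<^sub>R g x) = g"
    using assms(2) by (force simp: indicator_def)
  ultimately show ?thesis by simp
qed

lemma cball_subset_cube: "cball (0::real^'n) r \<subseteq> cbox (- (\<chi> i. r)) (\<chi> i. r)"
proof
  fix x :: "real^'n" assume "x \<in> cball 0 r"
  then have "\<bar>x $ i\<bar> \<le> r" for i using component_le_norm_cart[of x i] by auto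
  then show "x \<in> cbox (- (\<chi> i. r)) (\<chi> i. r)" by (auto simp: mem_box_cart abs_le_iff minus_le_iff)
qed

lemma LINT_eq_integral_cube:
  fixes g :: "real^'n \<Rightarrow> real"
  assumes "continuous_on UNIV g" "\<And>x. norm x > r \<Longrightarrow> g x = 0"
  shows "(LINT x|lborel. g x) = integral (cbox (- (\<chi> i. r)) (\<chi> i. r)) g"
proof -
  let ?C = "cbox (- (\<chi> i. r)) (\<chi> i. r) :: (real^'n) set"
  have "(LINT x|lborel. g x) = integral UNIV g"
    using integrable_compact_support[OF assms] by (simp add: integral_lborel)
  moreover have "(if x \<in> ?C then g x else 0) = g x" for x
    using assms(2)[of x] cball_subset_cube[of r] by (cases "x \<in> cball 0 r") auto
  ultimately show ?thesis
    using integral_restrict_UNIV[of ?C g] by simp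
qed

lemma LINT_translate:
  fixes f :: "real^'n \<Rightarrow> real"
  assumes "f \<in> borel_measurable borel"
  shows "(LINT x|lborel. f (x + v)) = (LINT x|lborel. f x)"
proof -
  have "(LINT x|lborel. f x) = (LINT x|distr lborel borel ((+) v). f x)"
    by (simp add: lborel_distr_plus)
  also have "\<dots> = (LINT x|lborel. f (v + x))"
    by (rule integral_distr) (use assms in auto)
  finally show ?thesis by (simp add: add.commute)
qed

text \<open>The integral of \<open>f (x + h e\<^sub>i)\<close> does not depend on \<open>h\<close>; differentiating it under the integral
sign at \<open>h = 0\<close> gives the integral of the partial derivative.\<close>

lemma LINT_pd_compact_support:
  fixes f :: "real^'n \<Rightarrow> real"
  assumes diff: "\<And>x. f differentiable (at x)"
    and cont: "continuous_on UNIV (pd i f)"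
    and supp: "\<And>x. norm x > r \<Longrightarrow> f x = 0"
  shows "(LINT x|lborel. pd i f x) = 0"
proof -
  have contf: "continuous_on UNIV f"
    using diff by (meson continuous_at_imp_continuous_on differentiable_imp_continuous_within)
  let ?e = "axis i 1 :: real^'n"
  let ?C = "cbox (- (\<chi> i. r + 1)) (\<chi> i. r + 1) :: (real^'n) set"
  let ?g = "\<lambda>h. integral ?C (\<lambda>x. f (x + h *\<^sub>R ?e))"
  have const: "?g h = (LINT x|lborel. f x)" if "h \<in> {-1..1}" for h
  proof -
    have "f (x + h *\<^sub>R ?e) = 0" if "norm x > r + 1" for x
    proof (rule supp)
      have "norm x \<le> norm (x + h *\<^sub>R ?e) + norm (h *\<^sub>R ?e)"
        using norm_triangle_ineq4[of "x + h *\<^sub>R ?e" "h *\<^sub>R ?e"] by simp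
      with \<open>h \<in> {-1..1}\<close> that show "r < norm (x + h *\<^sub>R ?e)" by auto
    qed
    then have "(LINT x|lborel. f (x + h *\<^sub>R ?e)) = ?g h"
      by (intro LINT_eq_integral_cube continuous_on_compose2[OF contf] continuous_intros) auto
    moreover have "(LINT x|lborel. f (x + h *\<^sub>R ?e)) = (LINT x|lborel. f x)"
      using contf by (intro LINT_translate borel_measurable_continuous_onI)
    ultimately show ?thesis by simp
  qed
  have "(?g has_vector_derivative integral ?C (\<lambda>x. pd i f (x + 0 *\<^sub>R ?e))) (at 0 within {-1..1})"
  proof (rule leibniz_rule_vector_derivative[where fx = "\<lambda>h x. pd i f (x + h *\<^sub>R ?e)"])
    show "((\<lambda>h. f (t + h *\<^sub>R ?e)) has_vector_derivative pd i f (t + h *\<^sub>R ?e)) (at h within {- 1..1})" for h t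
      using pd_has_derivative_line[of f t h ?e, OF diff]
      by (simp only: has_real_derivative_iff_has_vector_derivative axis_inner_grad
          has_vector_derivative_at_within)
    show "(\<lambda>x. f (x + h *\<^sub>R ?e)) integrable_on ?C" for h
      by (intro integrable_continuous continuous_on_compose2[OF contf] continuous_intros) auto
    show "continuous_on ({- 1..1} \<times> ?C) (\<lambda>(h, x). pd i f (x + h *\<^sub>R ?e))"
      unfolding case_prod_beta by (intro continuous_on_compose2[OF cont] continuous_intros) auto
  qed auto
  moreover have "(?g has_vector_derivative 0) (at 0 within {-1..1})"
  proof (rule has_vector_derivative_transform)
    show "((\<lambda>h. LINT x|lborel. f x) has_vector_derivative 0) (at 0 within {-1..1})"
      by (rule has_vector_derivative_const)
  qed (use const in simp_all)
  ultimately have "integral ?C (\<lambda>x. pd i f (x + 0 *\<^sub>R ?e)) = 0"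
    by (intro vector_derivative_unique_within_closed_interval[of "-1" 1 0 ?g]) auto
  then have "integral ?C (\<lambda>x. pd i f x) = 0" by simp
  then show ?thesis
    using pd_zero_outside[of "r + 1" f _ i] supp by (subst LINT_eq_integral_cube[OF cont, of "r + 1"]) auto
qed

lemma LINT_by_parts:
  fixes f g :: "real^'n \<Rightarrow> real"
  assumes f: "\<And>x. f differentiable (at x)" "continuous_on UNIV (pd i f)"
    and g: "\<And>x. g differentiable (at x)" "continuous_on UNIV (pd i g)"
    and supp: "\<And>x. norm x > r \<Longrightarrow> f x = 0"
  shows "(LINT x|lborel. f x * pd i g x) = - (LINT x|lborel. pd i f x * g x)"
proof -
  have cf: "continuous_on UNIV f" and cg: "continuous_on UNIV g"
    using f g by (meson continuous_at_imp_continuous_on differentiable_imp_continuous_within)+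
  have pd: "pd i (\<lambda>y. f y * g y) = (\<lambda>x. f x * pd i g x + pd i f x * g x)"
    using f g by (auto simp: pd_mult)
  have "(LINT x|lborel. pd i (\<lambda>y. f y * g y) x) = 0"
    by (rule LINT_pd_compact_support[of _ _ r])
      (use f g supp cf cg in \<open>auto simp: pd intro!: continuous_intros derivative_intros\<close>)
  moreover have "integrable lborel (\<lambda>x. f x * pd i g x)" "integrable lborel (\<lambda>x. pd i f x * g x)"
    by (rule integrable_compact_support[of _ r];
        use f g cf cg supp pd_zero_outside[of r f] in \<open>auto intro!: continuous_intros\<close>)+
  ultimately show ?thesis by (simp add: pd)
qed

lemma has_vector_derivative_LINT_cutoff:
  fixes F Ft :: "real \<Rightarrow> real^'n \<Rightarrow> real"
  assumes F: "\<And>s x. s \<ge> 0 \<Longrightarrow> ((\<lambda>s. F s x) has_vector_derivative Ft s x) (at s within {0..})"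
    and cF: "\<And>s. s \<ge> 0 \<Longrightarrow> continuous_on UNIV (F s)"
    and cFt: "continuous_on ({0..} \<times> UNIV) (\<lambda>(s, x). Ft s x)"
    and c\<psi>: "continuous_on UNIV \<psi>" and supp: "\<And>x. norm x > r \<Longrightarrow> \<psi> x = 0"
    and "s \<ge> 0"
  shows "((\<lambda>s. LINT x|lborel. \<psi> x * F s x) has_vector_derivative (LINT x|lborel. \<psi> x * Ft s x)) (at s within {0..})"
proof -
  let ?C = "cbox (- (\<chi> i. r)) (\<chi> i. r) :: (real^'n) set"
  have cFt': "continuous_on UNIV (Ft s)" if "s \<ge> 0" for s
    by (rule continuous_on_compose2[OF cFt, of UNIV "\<lambda>x. (s, x)", simplified]) (use that in \<open>auto intro!: continuous_intros\<close>)
  have "((\<lambda>s. integral ?C (\<lambda>x. \<psi> x * F s x)) has_vector_derivative integral ?C (\<lambda>x. \<psi> x * Ft s x)) (at s within {0..})"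
  proof (rule leibniz_rule_vector_derivative[where fx = "\<lambda>s x. \<psi> x * Ft s x"])
    show "((\<lambda>s. \<psi> t * F s t) has_vector_derivative \<psi> t * Ft s t) (at s within {0..})" if "s \<in> {0..}" for s t
      using F[of s t] that by (auto intro!: derivative_eq_intros)
    show "(\<lambda>x. \<psi> x * F s x) integrable_on ?C" if "s \<in> {0..}" for s
      using cF that c\<psi>
      by (intro integrable_continuous continuous_intros) (auto intro: continuous_on_subset)
    show "continuous_on ({0..} \<times> ?C) (\<lambda>(x, t). \<psi> t * Ft x t)"
      using continuous_on_subset[OF cFt, of "{0..} \<times> ?C"]
      by (auto simp: case_prod_beta intro!: continuous_intros continuous_on_compose2[OF c\<psi>])
  qed (use \<open>s \<ge> 0\<close> in auto)
  moreover have "(LINT x|lborel. \<psi> x * F s x) = integral ?C (\<lambda>x. \<psi> x * F s x)" if "s \<in> {0..}" for s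
    using that supp by (intro LINT_eq_integral_cube continuous_intros c\<psi> cF) auto
  moreover have "(LINT x|lborel. \<psi> x * Ft s x) = integral ?C (\<lambda>x. \<psi> x * Ft s x)"
    using \<open>s \<ge> 0\<close> supp by (intro LINT_eq_integral_cube continuous_intros c\<psi> cFt') auto
  ultimately show ?thesis
    using \<open>s \<ge> 0\<close> by (auto intro: has_vector_derivative_transform)
qed

text \<open>Both mixed derivatives are limits of the same second difference quotient over a small square,
as the mean value theorem applied in either order shows.\<close>

lemma pd_symmetric:
  fixes f :: "real^'n \<Rightarrow> real"
  assumes f: "\<And>x. f differentiable (at x)"
    and fi: "\<And>x. pd i f differentiable (at x)" and fj: "\<And>x. pd j f differentiable (at x)"
    and cij: "continuous_on UNIV (pd i (pd j f))" and cji: "continuous_on UNIV (pd j (pd i f))"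
  shows "pd i (pd j f) x = pd j (pd i f) x"
proof -
  have line: "((\<lambda>h. g (y + h *\<^sub>R axis k 1)) has_real_derivative pd k g (y + h *\<^sub>R axis k 1)) (at h)"
    if "\<And>x. g differentiable (at x)" for g :: "real^'n \<Rightarrow> real" and y k h
    using pd_has_derivative_line[of g y h "axis k 1", OF that] by (simp only: axis_inner_grad)
  have key: "\<exists>s t. 0 < s \<and> s < h \<and> 0 < t \<and> t < h \<and>
      f (x + h *\<^sub>R axis k 1 + h *\<^sub>R axis l 1) - f (x + h *\<^sub>R axis k 1) - f (x + h *\<^sub>R axis l 1) + f x
      = h * (h * pd l (pd k f) (x + s *\<^sub>R axis k 1 + t *\<^sub>R axis l 1))"
    if "h > 0" and fk: "\<And>x. pd k f differentiable (at x)" for h :: real and k l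
  proof -
    let ?a = "\<lambda>s. f (x + h *\<^sub>R axis l 1 + s *\<^sub>R axis k 1) - f (x + s *\<^sub>R axis k 1)"
    let ?a' = "\<lambda>s. pd k f (x + h *\<^sub>R axis l 1 + s *\<^sub>R axis k 1) - pd k f (x + s *\<^sub>R axis k 1)"
    have "\<exists>s. 0 < s \<and> s < h \<and> ?a h - ?a 0 = (h - 0) * ?a' s"
      by (rule MVT2) (use \<open>h > 0\<close> in \<open>auto intro!: DERIV_diff line f\<close>)
    then obtain s where s: "0 < s" "s < h" "?a h - ?a 0 = h * ?a' s" by auto
    let ?b = "\<lambda>t. pd k f (x + s *\<^sub>R axis k 1 + t *\<^sub>R axis l 1)"
    have "\<exists>t. 0 < t \<and> t < h \<and> ?b h - ?b 0 = (h - 0) * pd l (pd k f) (x + s *\<^sub>R axis k 1 + t *\<^sub>R axis l 1)"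
      by (rule MVT2) (use \<open>h > 0\<close> in \<open>auto intro!: line fk\<close>)
    then obtain t where t: "0 < t" "t < h" "?b h - ?b 0 = h * pd l (pd k f) (x + s *\<^sub>R axis k 1 + t *\<^sub>R axis l 1)"
      by auto
    have "?a' s = ?b h - ?b 0" by (simp add: algebra_simps)
    with s t show ?thesis by (intro exI[of _ s] exI[of _ t]) (auto simp: algebra_simps)
  qed
  define h where "h m = inverse (real (Suc m))" for m
  have h: "h m > 0" "h \<longlonglongrightarrow> 0" for m
    using LIMSEQ_inverse_real_of_nat by (auto simp: h_def [abs_def])
  let ?q = "\<lambda>k l m. (f (x + h m *\<^sub>R axis k 1 + h m *\<^sub>R axis l 1) - f (x + h m *\<^sub>R axis k 1)
      - f (x + h m *\<^sub>R axis l 1) + f x) / (h m * h m)"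
  have lim: "?q k l \<longlonglongrightarrow> pd l (pd k f) x"
    if c: "continuous_on UNIV (pd l (pd k f))" and "\<And>x. pd k f differentiable (at x)" for k l
  proof -
    from key[OF h(1), where k = k and l = l] that(2) obtain s t where
      st: "\<And>m. 0 < s m" "\<And>m. s m < h m" "\<And>m. 0 < t m" "\<And>m. t m < h m"
      and eq: "\<And>m. f (x + h m *\<^sub>R axis k 1 + h m *\<^sub>R axis l 1) - f (x + h m *\<^sub>R axis k 1)
        - f (x + h m *\<^sub>R axis l 1) + f x
      = h m * (h m * pd l (pd k f) (x + s m *\<^sub>R axis k 1 + t m *\<^sub>R axis l 1))" by metis
    have s0: "s \<longlonglongrightarrow> 0"
      by (rule tendsto_sandwich[OF _ _ tendsto_const h(2)]) (use st in \<open>auto intro!: always_eventually less_imp_le\<close>)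
    have t0: "t \<longlonglongrightarrow> 0"
      by (rule tendsto_sandwich[OF _ _ tendsto_const h(2)]) (use st in \<open>auto intro!: always_eventually less_imp_le\<close>)
    have "(\<lambda>m. x + s m *\<^sub>R axis k 1 + t m *\<^sub>R axis l 1) \<longlonglongrightarrow> x + 0 *\<^sub>R axis k 1 + 0 *\<^sub>R axis l 1"
      by (intro tendsto_intros s0 t0)
    then have "(\<lambda>m. pd l (pd k f) (x + s m *\<^sub>R axis k 1 + t m *\<^sub>R axis l 1)) \<longlonglongrightarrow> pd l (pd k f) x"
      using c by (intro continuous_on_tendsto_compose[OF c]) auto
    moreover have "?q k l m = pd l (pd k f) (x + s m *\<^sub>R axis k 1 + t m *\<^sub>R axis l 1)" for m
      unfolding eq using h(1)[of m] by simp
    ultimately show ?thesis by simp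
  qed
  have "?q i j = ?q j i" by (simp add: fun_eq_iff algebra_simps)
  with lim[OF cji fi] have "?q j i \<longlonglongrightarrow> pd j (pd i f) x" by simp
  from LIMSEQ_unique[OF lim[OF cij fj] this] show ?thesis .
qed

section \<open>Sup bounds from weak derivatives\<close>

text \<open>Dividing \<open>exp (-1/t)\<close> by powers of \<open>t\<close> yields a family that is closed under differentiation
up to linear combinations, which makes smoothness of the bump functions an induction.\<close>

definition flat :: "nat \<Rightarrow> real \<Rightarrow> real" where
  "flat j t = (if t > 0 then exp (- 1 / t) / t ^ j else 0)"

lemma power_le_fact_exp: "x ^ n \<le> fact n * exp (x::real)" if "x \<ge> 0"
proof -
  have "x ^ n /\<^sub>R fact n = (\<Sum>k\<in>{n}. x ^ k /\<^sub>R fact k)" by simp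
  also have "\<dots> \<le> exp x"
    unfolding exp_def by (rule sum_le_suminf[OF summable_exp_generic]) (use that in auto)
  finally show ?thesis by (simp add: divide_simps mult.commute)
qed

lemma abs_flat_le: "\<bar>flat j t\<bar> \<le> fact (Suc j) * \<bar>t\<bar>"
proof (cases "t > 0")
  case True
  then have "(1 / t) ^ Suc j \<le> fact (Suc j) * exp (1 / t)" by (intro power_le_fact_exp) auto
  with True have "1 \<le> fact (Suc j) * exp (1 / t) * t ^ Suc j"
    by (simp add: power_divide divide_simps mult.commute)
  then have "exp (- 1 / t) \<le> fact (Suc j) * t ^ Suc j"
    by (simp add: exp_minus divide_simps mult_ac)
  with True show ?thesis by (simp add: flat_def divide_simps mult_ac)
qed (simp add: flat_def mult_le_0_iff del: fact_Suc)

lemma DERIV_flat: "(flat j has_real_derivative flat (j + 2) t - real j * flat (j + 1) t) (at t)"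
proof -
  consider "t > 0" | "t < 0" | "t = 0" by linarith
  then show ?thesis
  proof cases
    case 1
    have "((\<lambda>t. exp (- 1 / t) / t ^ j) has_real_derivative flat (j + 2) t - real j * flat (j + 1) t) (at t)"
      using 1 by (auto simp: flat_def field_simps power2_eq_square power_eq_if[of t j] intro!: derivative_eq_intros)
    then show ?thesis
      by (rule has_field_derivative_transform_within_open[where S="{0<..}"]) (use 1 in \<open>auto simp: flat_def\<close>)
  next
    case 2
    have "((\<lambda>t. 0) has_real_derivative flat (j + 2) t - real j * flat (j + 1) t) (at t)"
      using 2 by (auto simp: flat_def)
    then show ?thesis
      by (rule has_field_derivative_transform_within_open[where S="{..<0}"]) (use 2 in \<open>auto simp: flat_def\<close>)
  next
    case 3
    have eq: "flat j h / h = flat (j + 1) h" for h by (simp add: flat_def)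
    have "(\<lambda>h. flat (j + 1) h) \<midarrow>0\<rightarrow> 0"
    proof (rule Lim_null_comparison)
      show "\<forall>\<^sub>F h in at 0. norm (flat (j + 1) h) \<le> fact (Suc (j + 1)) * \<bar>h\<bar>"
        unfolding real_norm_def by (intro always_eventually allI abs_flat_le)
      show "((\<lambda>h. fact (Suc (j + 1)) * \<bar>h\<bar>) \<longlongrightarrow> (0::real)) (at 0)" by (auto intro!: tendsto_eq_intros)
    qed
    moreover have "flat j 0 = 0" "flat (j+1) 0 = 0" "flat (j+2) 0 = 0" by (simp_all add: flat_def)
    ultimately show ?thesis using 3 eq by (simp add: DERIV_def)
  qed
qed

text \<open>A class of smooth functions supported in the unit ball that is closed under partial derivatives
and under multiplication by coordinates. The latter is what the derivative of an average with
respect to its radius requires.\<close>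

inductive_set bumps :: "(real^'n \<Rightarrow> real) set" where
  base: "(\<lambda>z. flat j (1 - z \<bullet> z)) \<in> bumps"
| coord: "b \<in> bumps \<Longrightarrow> (\<lambda>z. z $ i * b z) \<in> bumps"
| scale: "b \<in> bumps \<Longrightarrow> (\<lambda>z. c * b z) \<in> bumps"
| add: "b \<in> bumps \<Longrightarrow> b' \<in> bumps \<Longrightarrow> (\<lambda>z. b z + b' z) \<in> bumps"

lemma has_derivative_flat_bump:
  fixes x :: "real^'n"
  shows "((\<lambda>z. flat j (1 - z \<bullet> z)) has_derivative
    (\<lambda>h. (flat (j + 2) (1 - x \<bullet> x) - real j * flat (j + 1) (1 - x \<bullet> x)) * (- 2 * (x \<bullet> h)))) (at x)"
proof -
  have "((\<lambda>z. 1 - z \<bullet> z) has_derivative (\<lambda>h. - 2 * (x \<bullet> h))) (at x)"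
    by (auto intro!: derivative_eq_intros simp: inner_commute)
  from DERIV_compose_FDERIV[OF DERIV_flat this] show ?thesis by (simp add: mult.commute)
qed

lemma differentiable_coord: "(\<lambda>z::real^'n. z $ i) differentiable (at x)"
  by (rule linear_imp_differentiable[OF bounded_linear.linear[OF bounded_linear_vec_nth]])

lemma pd_coord: "pd i (\<lambda>z::real^'n. z $ k) x = (if i = k then 1 else 0)"
proof -
  have "((\<lambda>z::real^'n. z $ k) has_derivative (\<lambda>h. h $ k)) (at x)"
    by (rule bounded_linear_imp_has_derivative[OF bounded_linear_vec_nth])
  from pd_eq[OF this] show ?thesis by (auto simp: axis_def)
qed

lemma bumps_differentiable:
  assumes "b \<in> bumps" shows "b differentiable (at x)"
  using assms
proof induction
  case (base j)
  show ?case using has_derivative_flat_bump by (auto simp: differentiable_def)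
qed (auto intro!: derivative_intros differentiable_coord)

lemma bumps_pd:
  fixes b :: "real^'n \<Rightarrow> real"
  assumes "b \<in> bumps" shows "pd i b \<in> bumps"
  using assms
proof induction
  case (base j)
  have "pd i (\<lambda>z. flat j (1 - z \<bullet> z)) x
      = - 2 * (x $ i * flat (j + 2) (1 - x \<bullet> x)) + (2 * real j) * (x $ i * flat (j + 1) (1 - x \<bullet> x))" for x :: "real^'n"
    using pd_eq[OF has_derivative_flat_bump[of j x], of i] by (simp add: inner_axis algebra_simps)
  moreover have "(\<lambda>x. - 2 * (x $ i * flat (j + 2) (1 - x \<bullet> x)) + (2 * real j) * (x $ i * flat (j + 1) (1 - x \<bullet> x))) \<in> bumps"
    by (intro bumps.intros)
  ultimately show ?case by presburger
next
  case (coord b k)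
  have "pd i (\<lambda>z. z $ k * b z) = (\<lambda>x. x $ k * pd i b x + (if i = k then 1 else 0) * b x)"
    using coord by (auto simp: pd_mult pd_coord differentiable_coord bumps_differentiable)
  moreover have "(\<lambda>x. x $ k * pd i b x + (if i = k then 1 else 0) * b x) \<in> bumps"
    using coord by (intro bumps.intros)
  ultimately show ?case by simp
next
  case (scale b c)
  have "pd i (\<lambda>z. c * b z) = (\<lambda>x. c * pd i b x)"
    using scale by (auto simp: pd_cmult bumps_differentiable)
  then show ?case using scale by (auto intro: bumps.intros)
next
  case (add b b')
  have "pd i (\<lambda>z. b z + b' z) = (\<lambda>x. pd i b x + pd i b' x)"
    using add by (auto simp: pd_add bumps_differentiable)
  then show ?case using add by (auto intro: bumps.intros)
qed

lemma bumps_zero: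
  assumes "b \<in> bumps" "norm z \<ge> 1" shows "b z = 0"
proof -
  have "z \<bullet> z \<ge> 1" using assms(2) by (simp add: power2_norm_eq_inner[symmetric])
  then have "\<not> 1 - z \<bullet> z > 0" by simp
  with assms(1) show ?thesis by induction (auto simp: flat_def)
qed

lemma bumps_continuous: "b \<in> bumps \<Longrightarrow> continuous_on UNIV b"
  by (meson bumps_differentiable continuous_at_imp_continuous_on differentiable_imp_continuous_within)

lemma bumps_bounded:
  assumes "b \<in> bumps" obtains B where "B \<ge> 0" "\<And>z. \<bar>b z\<bar> \<le> B"
proof -
  have "compact (b ` cball 0 1)"
    by (intro compact_continuous_image continuous_on_subset[OF bumps_continuous[OF assms]]) auto
  then obtain B where B: "\<And>z. norm z \<le> 1 \<Longrightarrow> \<bar>b z\<bar> \<le> B"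
    by (force dest: compact_imp_bounded simp: bounded_iff)
  have "\<bar>b z\<bar> \<le> \<bar>B\<bar>" for z using B[of z] bumps_zero[OF assms, of z] by (cases "norm z \<le> 1") auto
  then show ?thesis by (intro that[of "\<bar>B\<bar>"]) auto
qed

lemma bumps_sum:
  assumes "finite I" "I \<noteq> {}" "\<And>i. i \<in> I \<Longrightarrow> b i \<in> bumps"
  shows "(\<lambda>z. \<Sum>i\<in>I. b i z) \<in> bumps"
  using assms
proof (induction rule: finite_ne_induct)
  case (insert i I)
  then have "(\<lambda>z. b i z + (\<Sum>i\<in>I. b i z)) \<in> bumps" by (intro bumps.add) auto
  with insert show ?case by simp
qed simp

lemma rescaled_has_derivative:
  fixes x y :: "real^'n"
  assumes "b \<in> bumps"
  shows "((\<lambda>y. b ((1 / r) *\<^sub>R (y - x))) has_derivative (\<lambda>h. ((1 / r) *\<^sub>R h) \<bullet> grad b ((1 / r) *\<^sub>R (y - x)))) (at y)"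
proof -
  have "((\<lambda>y. (1 / r) *\<^sub>R (y - x)) has_derivative (\<lambda>h. (1 / r) *\<^sub>R h)) (at y)"
    by (auto intro!: derivative_eq_intros)
  from diff_chain_at[OF this has_derivative_grad[OF bumps_differentiable[OF assms]]]
  show ?thesis by (simp add: o_def)
qed

lemma pd_rescaled:
  assumes "b \<in> bumps"
  shows "pd i (\<lambda>y. b ((1 / r) *\<^sub>R (y - x))) = (\<lambda>y. (1 / r) * pd i b ((1 / r) *\<^sub>R (y - x)))"
proof
  fix y
  show "pd i (\<lambda>y. b ((1 / r) *\<^sub>R (y - x))) y = (1 / r) * pd i b ((1 / r) *\<^sub>R (y - x))"
    using pd_eq[OF rescaled_has_derivative[OF assms, of r x y], of i] by (simp add: axis_inner_grad)
qed

lemma C_k_rescaled: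
  assumes "b \<in> bumps"
  shows "C_k k (\<lambda>y. b ((1 / r) *\<^sub>R (y - x)))"
  using assms
proof (induction k arbitrary: b)
  case 0
  then show ?case
    by (auto intro!: continuous_on_compose2[OF bumps_continuous] continuous_intros)
next
  case (Suc k)
  have "C_k k (pd i (\<lambda>y. b ((1 / r) *\<^sub>R (y - x))))" for i
    unfolding pd_rescaled[OF Suc.prems]
    by (rule Suc.IH[of "\<lambda>z. (1 / r) * pd i b z"]) (intro bumps.scale bumps_pd Suc.prems)
  then show ?case using rescaled_has_derivative[OF Suc.prems, of r x]
    by (force simp only: C_k.simps differentiable_def)
qed

text \<open>The kernel \<open>b\<close> rescaled to the ball of radius \<open>r\<close> about \<open>x\<close>, with constant integral.\<close>

definition dilate :: "(real^'n \<Rightarrow> real) \<Rightarrow> real^'n \<Rightarrow> real \<Rightarrow> real^'n \<Rightarrow> real" where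
  "dilate b x r y = b ((1 / r) *\<^sub>R (y - x)) / r ^ CARD('n)"

lemma dilate_zero:
  assumes "b \<in> bumps" "r > 0" "norm (y - x) \<ge> r"
  shows "dilate b x r y = 0"
proof -
  have "norm ((1 / r) *\<^sub>R (y - x)) \<ge> 1" using assms(2,3) by (simp add: divide_simps)
  then show ?thesis by (simp add: dilate_def bumps_zero[OF assms(1)])
qed

lemma test_function_dilate:
  fixes b :: "real^'n \<Rightarrow> real"
  assumes "b \<in> bumps" "r > 0"
  shows "test_function (dilate b x r)"
proof -
  have eq: "dilate b x r = (\<lambda>y. (\<lambda>z. (1 / r ^ CARD('n)) * b z) ((1 / r) *\<^sub>R (y - x)))"
    by (auto simp: dilate_def)
  have "C_k k (dilate b x r)" for k
    unfolding eq by (rule C_k_rescaled) (intro bumps.scale assms)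
  moreover have "dilate b x r y = 0" if "norm y > norm x + r" for y
  proof -
    have "norm y \<le> norm (y - x) + norm x" using norm_triangle_ineq[of "y - x" x] by simp
    with that show ?thesis by (intro dilate_zero assms) auto
  qed
  ultimately show ?thesis unfolding test_function_def by blast
qed

lemma continuous_dilate:
  fixes b :: "real^'n \<Rightarrow> real"
  assumes "b \<in> bumps"
  shows "continuous_on UNIV (dilate b x r)"
  unfolding dilate_def divide_inverse[of _ "r ^ CARD('n)"]
  by (intro continuous_intros continuous_on_compose2[OF bumps_continuous[OF assms]]) auto

lemma pd_dilate:
  fixes b :: "real^'n \<Rightarrow> real"
  assumes "b \<in> bumps"
  shows "pd i (dilate b x r) y = dilate (pd i b) x r y / r"
proof -
  have "dilate b x r = (\<lambda>y. (\<lambda>z. (1 / r ^ CARD('n)) * b z) ((1 / r) *\<^sub>R (y - x)))"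
    by (auto simp: dilate_def)
  then have "pd i (dilate b x r) y = (1 / r) * pd i (\<lambda>z. (1 / r ^ CARD('n)) * b z) ((1 / r) *\<^sub>R (y - x))"
    using pd_rescaled[OF bumps.scale[OF assms, of "1 / r ^ CARD('n)"], of i r x] by simp
  then show ?thesis
    unfolding pd_cmult[OF bumps_differentiable[OF assms]] by (simp add: dilate_def mult.commute)
qed

text \<open>Changing the radius moves mass along the field \<open>z b(z)\<close>, so the derivative is a divergence.
Tested against a function with weak derivatives, it becomes an average of these derivatives.\<close>

lemma DERIV_dilate:
  fixes b :: "real^'n \<Rightarrow> real"
  assumes "b \<in> bumps" "r > 0"
  shows "((\<lambda>r. dilate b x r y) has_real_derivative
    - (\<Sum>i\<in>UNIV. pd i (dilate (\<lambda>z. z $ i * b z) x r) y)) (at r)"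
proof -
  let ?z = "(1 / r) *\<^sub>R (y - x)"
  let ?n = "CARD('n)"
  have "((\<lambda>r. (1 / r) *\<^sub>R (y - x)) has_derivative (\<lambda>h. h *\<^sub>R ((- 1 / r\<^sup>2) *\<^sub>R (y - x)))) (at r)"
    using assms(2) by (auto intro!: derivative_eq_intros simp: power2_eq_square divide_simps)
  from diff_chain_at[OF this has_derivative_grad[OF bumps_differentiable[OF assms(1)]]]
  have "((\<lambda>r. b ((1 / r) *\<^sub>R (y - x))) has_derivative (\<lambda>h. h * (((- 1 / r\<^sup>2) *\<^sub>R (y - x)) \<bullet> grad b ?z))) (at r)"
    by (simp add: o_def)
  then have "((\<lambda>r. b ((1 / r) *\<^sub>R (y - x))) has_real_derivative ((- 1 / r\<^sup>2) *\<^sub>R (y - x)) \<bullet> grad b ?z) (at r)"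
    by (rule has_derivative_imp_has_field_derivative) simp
  then have d: "((\<lambda>r. b ((1 / r) *\<^sub>R (y - x))) has_real_derivative - (?z \<bullet> grad b ?z) / r) (at r)"
    using assms(2) by (simp add: power2_eq_square)
  have "((\<lambda>r. b ((1 / r) *\<^sub>R (y - x)) / r ^ ?n) has_real_derivative
      ((- (?z \<bullet> grad b ?z) / r) * r ^ ?n - b ?z * (real ?n * r ^ (?n - 1))) / (r ^ ?n * r ^ ?n)) (at r)"
    using DERIV_divide[OF d DERIV_pow[of ?n r UNIV]] assms(2) by simp
  moreover have "((- (?z \<bullet> grad b ?z) / r) * r ^ ?n - b ?z * (real ?n * r ^ (?n - 1))) / (r ^ ?n * r ^ ?n)
     = - (?z \<bullet> grad b ?z + real ?n * b ?z) / r ^ ?n / r"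
  proof -
    have "r ^ ?n = r * r ^ (?n - 1)" by (simp add: power_eq_if)
    then show ?thesis using assms(2) by (simp add: divide_simps) (simp add: algebra_simps)?
  qed
  moreover have "(\<Sum>i\<in>UNIV. pd i (dilate (\<lambda>z. z $ i * b z) x r) y) = (?z \<bullet> grad b ?z + real ?n * b ?z) / r ^ ?n / r"
  proof -
    have "pd i (dilate (\<lambda>z. z $ i * b z) x r) y = (?z $ i * pd i b ?z + b ?z) / r ^ ?n / r" for i
      using assms by (simp add: pd_dilate bumps.coord)
        (simp add: dilate_def pd_mult differentiable_coord bumps_differentiable pd_coord)
    then show ?thesis by (simp add: sum_divide_distrib[symmetric] sum.distrib inner_vec_def grad_def)
  qed
  ultimately show ?thesis by (simp only: dilate_def minus_divide_left)
qed

lemma abs_dilate_le: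
  fixes b :: "real^'n \<Rightarrow> real"
  assumes "\<And>z. \<bar>b z\<bar> \<le> B" "r > 0"
  shows "\<bar>dilate b x r y\<bar> \<le> B / r ^ CARD('n)"
  using assms by (simp add: dilate_def divide_right_mono)

lemma locally_integrable_L2:
  fixes f :: "real^'n \<Rightarrow> real"
  assumes "L2_bounded K f"
  shows "integrable lborel (\<lambda>y. f y * indicator (cball 0 R) y)"
proof (rule Bochner_Integration.integrable_bound)
  show "integrable lborel (\<lambda>y. (f y)\<^sup>2 + indicator (cball 0 R) y :: real)"
    using assms emeasure_lborel_cball_finite[of 0 R] by (auto simp: L2_bounded_def intro!: integrable_real_indicator)
  show "(\<lambda>y. f y * indicator (cball 0 R) y) \<in> borel_measurable lborel"
  proof -
    have "f \<in> borel_measurable borel" using assms by (simp add: L2_bounded_def)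
    moreover have "(indicator (cball 0 R) :: real^'n \<Rightarrow> real) \<in> borel_measurable borel"
      by (intro borel_measurable_indicator borel_closed closed_cball)
    ultimately have "(\<lambda>y. f y * indicator (cball 0 R) y) \<in> borel_measurable borel"
      by (rule borel_measurable_times)
    then show ?thesis by simp
  qed
  have "\<bar>f y\<bar> \<le> (f y)\<^sup>2 + 1" for y
    using zero_le_power2[of "\<bar>f y\<bar> - 1"] by (simp add: power2_eq_square algebra_simps)
  then show "AE y in lborel. norm (f y * indicator (cball 0 R) y) \<le> norm ((f y)\<^sup>2 + indicator (cball 0 R) y :: real)"
    by (auto simp: indicator_def)
qed

lemma integrable_L2_mult_compact_support:
  fixes k :: "real^'n \<Rightarrow> real"
  assumes f: "L2_bounded K f" and k: "continuous_on UNIV k" "\<And>y. norm y > R \<Longrightarrow> k y = 0"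
  shows "integrable lborel (\<lambda>y. f y * k y)"
proof -
  have "compact (k ` cball 0 R)"
    by (intro compact_continuous_image continuous_on_subset[OF k(1)]) auto
  then obtain B where "\<And>z. norm z \<le> R \<Longrightarrow> \<bar>k z\<bar> \<le> B"
    by (force dest: compact_imp_bounded simp: bounded_iff)
  then have B: "\<bar>f y * k y\<bar> \<le> \<bar>B * (f y * indicator (cball 0 R) y)\<bar>" for y
  proof (cases "norm y \<le> R")
    case True
    have "\<bar>k y\<bar> \<le> \<bar>B\<bar>" using True \<open>\<And>z. norm z \<le> R \<Longrightarrow> \<bar>k z\<bar> \<le> B\<close>[of y] by linarith
    from mult_left_mono[OF this, of "\<bar>f y\<bar>"] True show ?thesis by (simp add: abs_mult mult.commute)
  qed (use k(2)[of y] in simp)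
  show ?thesis
  proof (rule Bochner_Integration.integrable_bound)
    show "integrable lborel (\<lambda>y. B * (f y * indicator (cball 0 R) y))"
      using locally_integrable_L2[OF f] by simp
    show "(\<lambda>y. f y * k y) \<in> borel_measurable lborel"
      using f borel_measurable_continuous_onI[OF k(1)] by (auto simp: L2_bounded_def)
  qed (use B in auto)
qed

lemma DERIV_LINT_compact_support:
  fixes f :: "real^'n \<Rightarrow> real" and h h' :: "real \<Rightarrow> real^'n \<Rightarrow> real"
  assumes f: "L2_bounded K f"
    and ab: "a < r" "r < c"
    and h: "\<And>s y. a < s \<Longrightarrow> s < c \<Longrightarrow> ((\<lambda>s. h s y) has_real_derivative h' s y) (at s)"
    and cont: "\<And>s. a < s \<Longrightarrow> s < c \<Longrightarrow> continuous_on UNIV (h s)"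
    and cont': "continuous_on UNIV (h' r)"
    and supp: "\<And>s y. a < s \<Longrightarrow> s < c \<Longrightarrow> norm y > R \<Longrightarrow> h s y = 0"
    and bd: "\<And>s y. a < s \<Longrightarrow> s < c \<Longrightarrow> \<bar>h' s y\<bar> \<le> B"
  shows "((\<lambda>s. LINT y|lborel. f y * h s y) has_real_derivative (LINT y|lborel. f y * h' r y)) (at r)"
proof -
  have int: "integrable lborel (\<lambda>y. f y * h s y)" if "a < s" "s < c" for s
    using that by (intro integrable_L2_mult_compact_support[OF f, of _ R] cont supp)
  have fm: "f \<in> borel_measurable lborel" using f by (simp add: L2_bounded_def)
  have "((\<lambda>s. ((LINT y|lborel. f y * h s y) - (LINT y|lborel. f y * h r y)) / (s - r))
      \<longlongrightarrow> (LINT y|lborel. f y * h' r y)) (at r within {a<..<c})"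
    unfolding tendsto_at_iff_sequentially comp_def
  proof (intro allI impI)
    fix X assume X: "\<forall>i. X i \<in> {a<..<c} - {r}" and "X \<longlonglongrightarrow> r"
    have conv: "(\<lambda>i. LINT y|lborel. f y * ((h (X i) y - h r y) / (X i - r))) \<longlonglongrightarrow> (LINT y|lborel. f y * h' r y)"
    proof (rule integral_dominated_convergence)
      show "(\<lambda>y. f y * h' r y) \<in> borel_measurable lborel"
        using fm borel_measurable_continuous_onI[OF cont'] by auto
      show "(\<lambda>y. f y * ((h (X i) y - h r y) / (X i - r))) \<in> borel_measurable lborel" for i
      proof -
        have Xi: "a < X i" "X i < c" using X by auto
        show ?thesis
          using fm borel_measurable_continuous_onI[OF cont[OF Xi]] borel_measurable_continuous_onI[OF cont[OF ab]]
          by (auto intro!: borel_measurable_times borel_measurable_divide borel_measurable_diff)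
      qed
      show "integrable lborel (\<lambda>y. \<bar>B * (f y * indicator (cball 0 R) y)\<bar>)"
        using locally_integrable_L2[OF f] by auto
      show "AE y in lborel. (\<lambda>i. f y * ((h (X i) y - h r y) / (X i - r))) \<longlonglongrightarrow> f y * h' r y"
      proof (intro AE_I2 tendsto_mult tendsto_const)
        fix y
        have "((\<lambda>s. (h s y - h r y) / (s - r)) \<longlongrightarrow> h' r y) (at r within {a<..<c})"
          using h[OF ab, of y] tendsto_within_subset[OF _ subset_UNIV]
          unfolding has_field_derivative_iff by blast
        then show "(\<lambda>i. (h (X i) y - h r y) / (X i - r)) \<longlonglongrightarrow> h' r y"
          unfolding tendsto_at_iff_sequentially comp_def using X \<open>X \<longlonglongrightarrow> r\<close> by blast
      qed
      show "AE y in lborel. norm (f y * ((h (X i) y - h r y) / (X i - r))) \<le> \<bar>B * (f y * indicator (cball 0 R) y)\<bar>" for i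
      proof (intro AE_I2)
        fix y
        have Xi: "a < X i" "X i < c" "X i \<noteq> r" using X by auto
        show "norm (f y * ((h (X i) y - h r y) / (X i - r))) \<le> \<bar>B * (f y * indicator (cball 0 R) y)\<bar>"
        proof (cases "norm y > R")
          case True
          then show ?thesis using supp[OF Xi(1,2)] supp[OF ab] by simp
        next
          case False
          have "norm (h (X i) y - h r y) \<le> B * norm (X i - r)"
            by (rule field_differentiable_bound[where S = "{a<..<c}" and f' = "\<lambda>s. h' s y"])
              (use Xi ab h bd in \<open>auto intro: has_field_derivative_at_within\<close>)
          then have "\<bar>(h (X i) y - h r y) / (X i - r)\<bar> \<le> \<bar>B\<bar>"
            using Xi by (simp add: divide_simps abs_mult) (smt (verit) mult_right_mono abs_ge_zero)
          from mult_left_mono[OF this, of "\<bar>f y\<bar>"] show ?thesis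
            using False by (simp add: abs_mult mult.commute)
        qed
      qed
    qed
    have quot: "(LINT y|lborel. f y * ((h (X i) y - h r y) / (X i - r)))
        = ((LINT y|lborel. f y * h (X i) y) - (LINT y|lborel. f y * h r y)) / (X i - r)" for i
    proof -
      have "(LINT y|lborel. f y * ((h (X i) y - h r y) / (X i - r)))
          = (LINT y|lborel. (f y * h (X i) y - f y * h r y) / (X i - r))"
        by (simp add: right_diff_distrib)
      also have "\<dots> = ((LINT y|lborel. f y * h (X i) y) - (LINT y|lborel. f y * h r y)) / (X i - r)"
        using X ab int by simp
      finally show ?thesis .
    qed
    show "(\<lambda>i. ((LINT y|lborel. f y * h (X i) y) - (LINT y|lborel. f y * h r y)) / (X i - r))
        \<longlonglongrightarrow> (LINT y|lborel. f y * h' r y)"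
      by (rule Lim_transform_eventually[OF conv]) (intro always_eventually allI quot)
  qed
  then show ?thesis using ab at_within_open[of r "{a<..<c}"] by (simp add: has_field_derivative_iff)
qed

definition average :: "(real^'n \<Rightarrow> real) \<Rightarrow> (real^'n \<Rightarrow> real) \<Rightarrow> real^'n \<Rightarrow> real \<Rightarrow> real" where
  "average f b x r = (LINT y|lborel. f y * dilate b x r y)"

lemma DERIV_average:
  fixes f :: "real^'n \<Rightarrow> real"
  assumes f: "L2_bounded K f" and g: "\<And>i. weak_pd i f (g i)" and b: "b \<in> bumps" and r: "r > 0"
  shows "((\<lambda>r. average f b x r) has_real_derivative (\<Sum>i\<in>UNIV. average (g i) (\<lambda>z. z $ i * b z) x r)) (at r)"
proof -
  let ?zb = "\<lambda>i z. z $ i * b z"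
  have zb: "?zb i \<in> bumps" for i using b by (rule bumps.coord)
  define \<beta> where "\<beta> z = (\<Sum>i\<in>UNIV. pd i (?zb i) z)" for z
  have \<beta>: "\<beta> \<in> bumps" unfolding \<beta>_def[abs_def] by (intro bumps_sum bumps_pd zb) auto
  then obtain B where B: "B \<ge> 0" "\<And>z. \<bar>\<beta> z\<bar> \<le> B" by (metis bumps_bounded)
  have sum_eq: "(\<Sum>i\<in>UNIV. pd i (dilate (?zb i) x s) y) = dilate \<beta> x s y / s" for s y
    by (simp add: pd_dilate zb dilate_def \<beta>_def sum_divide_distrib)
  have supp: "dilate b' x s y = 0" if "b' \<in> bumps" "0 < s" "s < 2 * r" "norm y > norm x + 2 * r" for b' s y
  proof -
    have "norm y \<le> norm (y - x) + norm x" using norm_triangle_ineq[of "y - x" x] by simp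
    with that show ?thesis by (intro dilate_zero) auto
  qed
  have "((\<lambda>r. LINT y|lborel. f y * dilate b x r y) has_real_derivative (LINT y|lborel. f y * - (dilate \<beta> x r y / r))) (at r)"
  proof (rule DERIV_LINT_compact_support[OF f, where a = "r / 2" and c = "2 * r" and R = "norm x + 2 * r"
        and B = "B / (r / 2) ^ CARD('n) / (r / 2)"])
    show "((\<lambda>s. dilate b x s y) has_real_derivative - (dilate \<beta> x s y / s)) (at s)" if "r / 2 < s" for s y
      using DERIV_dilate[OF b, of s x y] that r unfolding sum_eq by simp
    show "continuous_on UNIV (\<lambda>y. - (dilate \<beta> x r y / r))"
      using r by (intro continuous_intros continuous_dilate \<beta>) auto
    show "\<bar>- (dilate \<beta> x s y / s)\<bar> \<le> B / (r / 2) ^ CARD('n) / (r / 2)" if "r / 2 < s" for s y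
    proof -
      have "\<bar>dilate \<beta> x s y\<bar> \<le> B / s ^ CARD('n)" using abs_dilate_le[of \<beta> B s] B that r by auto
      also have "\<dots> \<le> B / (r / 2) ^ CARD('n)"
        using B that r by (intro divide_left_mono power_mono mult_pos_pos zero_less_power) auto
      finally have "\<bar>dilate \<beta> x s y\<bar> / s \<le> B / (r / 2) ^ CARD('n) / (r / 2)"
        using that r B by (intro frac_le) auto
      then show ?thesis using that r by simp
    qed
  qed (use r supp b in \<open>auto intro: continuous_dilate\<close>)
  moreover have "(LINT y|lborel. f y * - (dilate \<beta> x r y / r)) = (\<Sum>i\<in>UNIV. average (g i) (?zb i) x r)"
  proof -
    have "(LINT y|lborel. f y * - (dilate \<beta> x r y / r)) = - (LINT y|lborel. (\<Sum>i\<in>UNIV. f y * pd i (dilate (?zb i) x r) y))"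
      by (simp add: sum_eq[symmetric] sum_distrib_left)
    also have "\<dots> = - (\<Sum>i\<in>UNIV. LINT y|lborel. f y * pd i (dilate (?zb i) x r) y)"
    proof (subst Bochner_Integration.integral_sum)
      show "integrable lborel (\<lambda>y. f y * pd i (dilate (?zb i) x r) y)" for i
        unfolding pd_dilate[OF zb]
        by (rule integrable_L2_mult_compact_support[OF f, of _ "norm x + 2 * r"])
          (use r supp bumps_pd[OF zb] in \<open>auto intro!: continuous_intros continuous_dilate\<close>)
    qed simp
    also have "\<dots> = - (\<Sum>i\<in>UNIV. - average (g i) (?zb i) x r)"
      using g test_function_dilate[OF zb r] by (simp add: weak_pd_def average_def)
    finally show ?thesis by (simp add: sum_negf)
  qed
  ultimately show ?thesis by (simp add: average_def[abs_def])
qed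

lemma abs_mult_le_weighted_squares:
  fixes a b q :: real
  assumes "q > 0"
  shows "\<bar>a * b\<bar> \<le> a\<^sup>2 / (2 * q) + q / 2 * b\<^sup>2"
proof -
  have "2 * q * \<bar>a * b\<bar> \<le> a\<^sup>2 + q\<^sup>2 * b\<^sup>2"
    using zero_le_power2[of "\<bar>a\<bar> - q * \<bar>b\<bar>"]
    by (simp add: power2_diff power_mult_distrib abs_mult algebra_simps)
  then have "\<bar>a * b\<bar> \<le> (a\<^sup>2 + q\<^sup>2 * b\<^sup>2) / (2 * q)"
    using assms by (simp add: pos_le_divide_eq mult.commute)
  also have "\<dots> = a\<^sup>2 / (2 * q) + q / 2 * b\<^sup>2"
    using assms by (simp add: add_divide_distrib power2_eq_square)
  finally show ?thesis .
qed

text \<open>Cauchy--Schwarz: the square of the kernel has integral \<open>O(r\<^sup>-\<^sup>n)\<close>. The inequality is used in its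
weighted additive form with weight \<open>K r\<^sup>n\<^sup>/\<^sup>2\<close>.\<close>

lemma average_L2_bound:
  fixes b :: "real^'n \<Rightarrow> real"
  assumes b: "b \<in> bumps"
  obtains C where "C \<ge> 0"
    "\<And>f K x r. L2_bounded K f \<Longrightarrow> K > 0 \<Longrightarrow> r > 0 \<Longrightarrow> \<bar>average f b x r\<bar> \<le> C * K * r powr (- real CARD('n) / 2)"
proof -
  let ?n = "CARD('n)"
  obtain B where B: "B \<ge> 0" "\<And>z. \<bar>b z\<bar> \<le> B" using b by (metis bumps_bounded)
  define V where "V = unit_ball_vol (real ?n)"
  have V: "V > 0" by (simp add: V_def)
  have "\<bar>average f b x r\<bar> \<le> (1 + B\<^sup>2 * V) / 2 * K * r powr (- real ?n / 2)"
    if f: "L2_bounded K f" and "K > 0" "r > 0" for f K x r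
  proof -
    let ?p = "r powr (real ?n / 2)"
    have p: "?p > 0" "?p\<^sup>2 = r ^ ?n"
      using \<open>r > 0\<close> by (auto simp: power2_eq_square powr_add[symmetric] powr_realpow)
    have intf: "integrable lborel (\<lambda>y. (f y)\<^sup>2)" "(LINT y|lborel. (f y)\<^sup>2) \<le> K\<^sup>2" using f by (auto simp: L2_bounded_def)
    let ?I = "indicator (cball x r) :: real^'n \<Rightarrow> real"
    have intI: "integrable lborel ?I" "(LINT y|lborel. ?I y) = V * r ^ ?n"
      using emeasure_lborel_cball_finite[of x r] content_cball[of r x] \<open>r > 0\<close> by (auto simp: V_def)
    have bnd: "\<bar>f y * dilate b x r y\<bar> \<le> (f y)\<^sup>2 / (2 * K * ?p) + K * ?p / 2 * (B\<^sup>2 / (r ^ ?n)\<^sup>2) * ?I y" for y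
    proof -
      let ?d = "dilate b x r y"
      have d: "?d\<^sup>2 \<le> (B\<^sup>2 / (r ^ ?n)\<^sup>2) * ?I y"
      proof (cases "y \<in> cball x r")
        case True
        have "\<bar>?d\<bar> \<le> B / r ^ ?n" using abs_dilate_le[of b B r x y] B \<open>r > 0\<close> by auto
        then have "?d\<^sup>2 \<le> (B / r ^ ?n)\<^sup>2" by (metis abs_ge_zero power2_abs power_mono)
        with True show ?thesis by (simp add: power_divide)
      next
        case False
        then show ?thesis using dilate_zero[OF b \<open>r > 0\<close>, of y x] by (simp add: dist_norm norm_minus_commute)
      qed
      let ?q = "K * ?p"
      have q: "?q > 0" using \<open>K > 0\<close> p by simp
      have "\<bar>f y * ?d\<bar> \<le> (f y)\<^sup>2 / (2 * ?q) + ?q / 2 * ?d\<^sup>2"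
        by (rule abs_mult_le_weighted_squares[OF q])
      also have "\<dots> \<le> (f y)\<^sup>2 / (2 * ?q) + ?q / 2 * ((B\<^sup>2 / (r ^ ?n)\<^sup>2) * ?I y)"
        using d q by (intro add_left_mono mult_left_mono) auto
      finally show ?thesis by (simp add: mult.assoc)
    qed
    have "\<bar>average f b x r\<bar> \<le> (LINT y|lborel. \<bar>f y * dilate b x r y\<bar>)"
      unfolding average_def by (rule integral_abs_bound)
    also have "\<dots> \<le> (LINT y|lborel. (f y)\<^sup>2 / (2 * K * ?p) + K * ?p / 2 * (B\<^sup>2 / (r ^ ?n)\<^sup>2) * ?I y)"
      using bnd intf intI order_trans[OF abs_ge_zero bnd] by (intro integral_mono') auto
    also have "\<dots> = (LINT y|lborel. (f y)\<^sup>2) / (2 * K * ?p) + K * ?p / 2 * (B\<^sup>2 / (r ^ ?n)\<^sup>2) * (V * r ^ ?n)"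
      using intf intI by (subst Bochner_Integration.integral_add) auto
    also have "\<dots> \<le> K\<^sup>2 / (2 * K * ?p) + K * ?p / 2 * (B\<^sup>2 / (r ^ ?n)\<^sup>2) * (V * r ^ ?n)"
      using intf \<open>K > 0\<close> p by (intro add_right_mono divide_right_mono) auto
    also have "\<dots> = (1 + B\<^sup>2 * V) / 2 * K * (1 / ?p)"
    proof -
      have "K\<^sup>2 / (2 * K * ?p) = K / 2 * (1 / ?p)" using \<open>K > 0\<close> by (simp add: power2_eq_square)
      moreover have "?p * (1 / (r ^ ?n)\<^sup>2) * r ^ ?n = 1 / ?p"
        using p(1) unfolding p(2)[symmetric] by (simp add: power2_eq_square)
      moreover have "K * ?p / 2 * (B\<^sup>2 / (r ^ ?n)\<^sup>2) * (V * r ^ ?n)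
          = K / 2 * B\<^sup>2 * V * (?p * (1 / (r ^ ?n)\<^sup>2) * r ^ ?n)" by simp
      moreover have "K / 2 * (1 / ?p) + K / 2 * B\<^sup>2 * V * (1 / ?p) = (1 + B\<^sup>2 * V) / 2 * K * (1 / ?p)"
        by (simp add: algebra_simps add_divide_distrib)
      ultimately show ?thesis by (simp only:)
    qed
    also have "1 / ?p = r powr (- real ?n / 2)" by (simp add: powr_minus_divide)
    finally show ?thesis .
  qed
  then show ?thesis using V by (intro that[of "(1 + B\<^sup>2 * V) / 2"]) auto
qed

text \<open>Each weak derivative improves the bound by one power of \<open>r\<close>, by integrating the derivative of
the average over \<open>[r,1]\<close>. The harmless loss of \<open>1/4\<close> in the exponent keeps it away from the
integers, so that no logarithm can appear in the integration.\<close>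

lemma average_sobolev_bound:
  fixes b :: "real^'n \<Rightarrow> real"
  assumes "b \<in> bumps"
  shows "\<exists>C\<ge>0. \<forall>f K x r. sobolev_bounded m K f \<longrightarrow> K > 0 \<longrightarrow> 0 < r \<longrightarrow> r \<le> 1 \<longrightarrow>
    \<bar>average f b x r\<bar> \<le> C * K * (1 + r powr (real m - (real CARD('n) / 2 + 1 / 4)))"
  using assms
proof (induction m arbitrary: b)
  case 0
  obtain C where C: "C \<ge> 0"
    "\<And>f K x r. L2_bounded K f \<Longrightarrow> K > 0 \<Longrightarrow> r > 0 \<Longrightarrow> \<bar>average f b x r\<bar> \<le> C * K * r powr (- real CARD('n) / 2)"
    using average_L2_bound[OF 0] by blast
  show ?case
  proof (intro exI[of _ C] conjI C(1) allI impI)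
    fix f :: "real^'n \<Rightarrow> real" and K x and r :: real
    assume f: "sobolev_bounded 0 K f" and "K > 0" and r: "0 < r" "r \<le> 1"
    have "\<bar>average f b x r\<bar> \<le> C * K * r powr (- real CARD('n) / 2)" using C(2) f \<open>K > 0\<close> r by auto
    also have "r powr (- real CARD('n) / 2) \<le> r powr (real 0 - (real CARD('n) / 2 + 1 / 4))"
      using r by (intro powr_mono') auto
    also have "\<dots> \<le> 1 + \<dots>" by simp
    finally show "\<bar>average f b x r\<bar> \<le> C * K * (1 + r powr (real 0 - (real CARD('n) / 2 + 1 / 4)))"
      using C(1) \<open>K > 0\<close> by (simp add: mult_left_mono)
  qed
next
  case (Suc m)
  let ?a = "real CARD('n) / 2 + 1 / 4"
  define q where "q = real m - ?a + 1"
  \<comment> \<open>The two sides of \<open>4 m + 3 = 2 n\<close> have different parity.\<close>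
  have q: "q \<noteq> 0"
  proof
    assume "q = 0"
    then have "real (4 * m + 3) = real (2 * CARD('n))" by (simp add: q_def field_simps)
    then have "4 * m + 3 = 2 * CARD('n)" by (simp only: of_nat_eq_iff)
    then show False by presburger
  qed
  have "\<forall>i. \<exists>C\<ge>0. \<forall>f K x r. sobolev_bounded m K f \<longrightarrow> K > 0 \<longrightarrow> 0 < r \<longrightarrow> r \<le> 1 \<longrightarrow>
    \<bar>average f (\<lambda>z. z $ i * b z) x r\<bar> \<le> C * K * (1 + r powr (real m - ?a))"
    using Suc.IH[OF bumps.coord[OF Suc.prems]] by blast
  from choice[OF this] obtain C1 where C1: "\<And>i. C1 i \<ge> 0" "\<And>i f K x r. sobolev_bounded m K f \<Longrightarrow> K > 0 \<Longrightarrow> 0 < r \<Longrightarrow> r \<le> 1 \<Longrightarrow>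
    \<bar>average f (\<lambda>z. z $ i * b z) x r\<bar> \<le> C1 i * K * (1 + r powr (real m - ?a))" by blast
  obtain C0 where C0: "C0 \<ge> 0"
    "\<And>f K x r. L2_bounded K f \<Longrightarrow> K > 0 \<Longrightarrow> r > 0 \<Longrightarrow> \<bar>average f b x r\<bar> \<le> C0 * K * r powr (- real CARD('n) / 2)"
    using average_L2_bound[OF Suc.prems] by blast
  define C2 where "C2 = (\<Sum>i\<in>UNIV. C1 i)"
  have C2: "C2 \<ge> 0" unfolding C2_def by (intro sum_nonneg C1)
  let ?C = "C0 + C2 * (1 + 1 / \<bar>q\<bar>)"
  show ?case
  proof (intro exI[of _ ?C] conjI allI impI)
    show "0 \<le> ?C" using C0(1) C2 by simp
    fix f :: "real^'n \<Rightarrow> real" and K x and r :: real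
    assume f: "sobolev_bounded (Suc m) K f" and "K > 0" and r: "0 < r" "r \<le> 1"
    then obtain g where g: "\<And>i. weak_pd i f (g i)" "\<And>i. sobolev_bounded m K (g i)" by (simp, metis)
    have f2: "L2_bounded K f" using f by simp
    let ?A = "average f b x"
    let ?H = "\<lambda>s. C2 * K * (s + s powr q / q)"
    have dA: "(?A has_real_derivative (\<Sum>i\<in>UNIV. average (g i) (\<lambda>z. z $ i * b z) x s)) (at s)" if "s > 0" for s
      by (rule DERIV_average[OF f2 g(1) Suc.prems that])
    have bA: "\<bar>\<Sum>i\<in>UNIV. average (g i) (\<lambda>z. z $ i * b z) x s\<bar> \<le> C2 * K * (1 + s powr (real m - ?a))"
      if "s > 0" "s \<le> 1" for s
    proof -
      have "\<bar>\<Sum>i\<in>UNIV. average (g i) (\<lambda>z. z $ i * b z) x s\<bar> \<le> (\<Sum>i\<in>UNIV. C1 i * K * (1 + s powr (real m - ?a)))"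
        by (rule order_trans[OF sum_abs]) (intro sum_mono C1(2) g \<open>K > 0\<close> that)
      then show ?thesis by (simp add: C2_def sum_distrib_right)
    qed
    have dH: "(?H has_real_derivative C2 * K * (1 + s powr (real m - ?a))) (at s)" if "s > 0" for s
    proof -
      have "real m - ?a = q - 1" by (simp add: q_def)
      then show ?thesis using that q by (auto intro!: derivative_eq_intros)
    qed
    have "?H r - ?A r \<le> ?H 1 - ?A 1"
    proof (rule DERIV_nonneg_imp_nondecreasing[OF r(2)])
      fix s assume "r \<le> s" "s \<le> 1"
      then show "\<exists>y. ((\<lambda>s. ?H s - ?A s) has_real_derivative y) (at s) \<and> 0 \<le> y"
        using DERIV_diff[OF dH dA, of s] bA[of s] r by (intro exI conjI) auto
    qed
    moreover have "?H r + ?A r \<le> ?H 1 + ?A 1"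
    proof (rule DERIV_nonneg_imp_nondecreasing[OF r(2)])
      fix s assume "r \<le> s" "s \<le> 1"
      then show "\<exists>y. ((\<lambda>s. ?H s + ?A s) has_real_derivative y) (at s) \<and> 0 \<le> y"
        using DERIV_add[OF dH dA, of s] bA[of s] r by (intro exI conjI) auto
    qed
    moreover have "?H 1 - ?H r \<le> C2 * K * (1 + 1 / \<bar>q\<bar> + r powr q / \<bar>q\<bar>)"
    proof -
      have "?H 1 - ?H r = C2 * K * (1 + 1 / q - r - r powr q / q)" by (simp add: algebra_simps)
      also have "\<dots> \<le> C2 * K * (1 + 1 / \<bar>q\<bar> + r powr q / \<bar>q\<bar>)"
      proof (intro mult_left_mono)
        have "1 / q \<le> 1 / \<bar>q\<bar>" using abs_ge_self[of "1 / q"] by simp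
        moreover have "- (r powr q / q) \<le> r powr q / \<bar>q\<bar>"
          using abs_ge_minus_self[of "r powr q / q"] by simp
        ultimately show "1 + 1 / q - r - r powr q / q \<le> 1 + 1 / \<bar>q\<bar> + r powr q / \<bar>q\<bar>"
          using r by linarith
      qed (use C2 \<open>K > 0\<close> in simp)
      finally show ?thesis .
    qed
    moreover have "\<bar>?A 1\<bar> \<le> C0 * K" using C0(2)[OF f2 \<open>K > 0\<close>, of 1 x] by simp
    ultimately have "\<bar>?A r\<bar> \<le> C0 * K + C2 * K * (1 + 1 / \<bar>q\<bar> + r powr q / \<bar>q\<bar>)" by linarith
    also have "\<dots> \<le> ?C * K * (1 + r powr q)"
    proof -
      have "0 \<le> C0 * K * r powr q + C2 * K * r powr q" using C0(1) C2 \<open>K > 0\<close> by simp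
      then show ?thesis by (simp add: algebra_simps add_divide_distrib)
    qed
    finally have "\<bar>?A r\<bar> \<le> ?C * K * (1 + r powr q)" .
    moreover have "real (Suc m) - ?a = q" by (simp add: q_def)
    ultimately show "\<bar>?A r\<bar> \<le> ?C * K * (1 + r powr (real (Suc m) - ?a))" by (simp only:)
  qed
qed

text \<open>The Sobolev embedding into bounded functions for \<open>m > n/2\<close>: the averages over balls of radius
\<open>r \<le> 1\<close> are bounded uniformly in \<open>r\<close>, and they bound a fixed multiple of \<open>|f x|\<close> as \<open>r\<close> tends to
\<open>0\<close>.\<close>

lemma sobolev_bounded_sup:
  assumes m: "2 * m > CARD('n::finite)"
  obtains C where "C \<ge> 0"
    "\<And>(f :: real^'n \<Rightarrow> real) K x. sobolev_bounded m K f \<Longrightarrow> K > 0 \<Longrightarrow> continuous_on UNIV f \<Longrightarrow> \<bar>f x\<bar> \<le> C * K"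
proof -
  let ?n = "CARD('n)" and ?a = "real CARD('n) / 2 + 1 / 4"
  let ?b = "\<lambda>z::real^'n. flat 0 (1 - z \<bullet> z)"
  have b: "?b \<in> bumps" by (rule bumps.base)
  obtain C where C: "C \<ge> 0" "\<And>f K x r. sobolev_bounded m K f \<Longrightarrow> K > 0 \<Longrightarrow> 0 < r \<Longrightarrow> r \<le> 1 \<Longrightarrow>
    \<bar>average f ?b x r\<bar> \<le> C * K * (1 + r powr (real m - ?a))"
    using average_sobolev_bound[OF b, of m] by blast
  define c where "c = exp (- 2) * unit_ball_vol (real ?n) / 2 ^ ?n"
  have c: "c > 0" by (simp add: c_def)
  have b_nonneg: "?b z \<ge> 0" for z by (simp add: flat_def)
  have b_lower: "?b z \<ge> exp (- 2)" if "norm z \<le> 1 / 2" for z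
  proof -
    have "z \<bullet> z \<le> (1 / 2)\<^sup>2" using that by (simp add: power2_norm_eq_inner[symmetric] power_mono)
    then have "1 - z \<bullet> z \<ge> 1 / 2" by (simp add: power2_eq_square)
    then have "1 / (1 - z \<bullet> z) \<le> 2" by (simp add: divide_simps)
    then have "exp (- 2) \<le> exp (- 1 / (1 - z \<bullet> z))" by simp
    with \<open>1 - z \<bullet> z \<ge> 1 / 2\<close> show ?thesis by (simp add: flat_def)
  qed
  have "\<bar>f x\<bar> \<le> 4 * C / c * K"
    if f: "sobolev_bounded m K f" and "K > 0" and cont: "continuous_on UNIV f" for f :: "real^'n \<Rightarrow> real" and K x
  proof (cases "f x = 0")
    case False
    let ?s = "sgn (f x)"
    have "isCont f x" using cont by (simp add: continuous_on_eq_continuous_at)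
    then obtain d where d: "d > 0" "\<And>y. norm (y - x) < d \<Longrightarrow> \<bar>f y - f x\<bar> < \<bar>f x\<bar> / 2"
      using False unfolding continuous_at_eps_delta dist_norm real_norm_def by (metis half_gt_zero zero_less_abs_iff)
    define r where "r = min d 1"
    have r: "r > 0" "r \<le> 1" "r \<le> d" using d by (auto simp: r_def)
    let ?k = "dilate ?b x r"
    have supp: "?k y = 0" if "norm y > norm x + r" for y
    proof -
      have "norm y \<le> norm (y - x) + norm x" using norm_triangle_ineq[of "y - x" x] by simp
      with that show ?thesis by (intro dilate_zero b r) auto
    qed
    have ck: "continuous_on UNIV ?k" by (rule continuous_dilate[OF b])
    have k_nonneg: "?k y \<ge> 0" for y
      unfolding dilate_def using r by (intro divide_nonneg_nonneg b_nonneg) simp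
    let ?I = "indicator (cball x (r / 2)) :: real^'n \<Rightarrow> real"
    have intI: "integrable lborel ?I" "(LINT y|lborel. ?I y) = unit_ball_vol (real ?n) * (r / 2) ^ ?n"
      using emeasure_lborel_cball_finite[of x "r/2"] content_cball[of "r/2" x] \<open>r > 0\<close> by auto
    have "c = (LINT y|lborel. exp (- 2) / r ^ ?n * ?I y)"
      using r intI by (simp add: c_def power_divide)
    also have "\<dots> \<le> (LINT y|lborel. ?k y)"
    proof (rule integral_mono)
      show "integrable lborel ?k" by (rule integrable_compact_support[OF ck supp])
      show "exp (- 2) / r ^ ?n * ?I y \<le> ?k y" for y
      proof (cases "y \<in> cball x (r / 2)")
        case True
        then have "norm ((1 / r) *\<^sub>R (y - x)) \<le> 1 / 2"
          using r by (simp add: dist_norm norm_minus_commute divide_simps)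
        from b_lower[OF this] True r show ?thesis by (simp add: dilate_def divide_right_mono)
      qed (use k_nonneg in simp)
    qed (use intI in auto)
    finally have c_le: "c \<le> (LINT y|lborel. ?k y)" .
    have "\<bar>f x\<bar> / 2 * c \<le> \<bar>f x\<bar> / 2 * (LINT y|lborel. ?k y)" using c_le by (intro mult_left_mono) auto
    also have "\<dots> = (LINT y|lborel. \<bar>f x\<bar> / 2 * ?k y)" by simp
    also have "\<dots> \<le> (LINT y|lborel. ?s * (f y * ?k y))"
    proof (rule integral_mono)
      show "integrable lborel (\<lambda>y. \<bar>f x\<bar> / 2 * ?k y)"
        by (rule integrable_compact_support[of _ "norm x + r"]) (use ck supp in \<open>auto intro!: continuous_intros\<close>)
      show "integrable lborel (\<lambda>y. ?s * (f y * ?k y))"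
        by (rule integrable_compact_support[of _ "norm x + r"]) (use ck supp cont in \<open>auto intro!: continuous_intros\<close>)
      show "\<bar>f x\<bar> / 2 * ?k y \<le> ?s * (f y * ?k y)" for y
      proof (cases "norm (y - x) < r")
        case True
        then have "\<bar>f y - f x\<bar> < \<bar>f x\<bar> / 2" using d(2)[of y] r by linarith
        then have "\<bar>f x\<bar> / 2 \<le> ?s * f y" by (auto simp: sgn_if abs_if split: if_splits)
        from mult_right_mono[OF this k_nonneg[of y]] show ?thesis by (simp add: mult.assoc)
      next
        case False
        then show ?thesis using dilate_zero[OF b r(1), of y x] by simp
      qed
    qed
    also have "\<dots> = ?s * average f ?b x r" by (simp add: average_def)
    also have "\<dots> \<le> \<bar>average f ?b x r\<bar>" by (auto simp: sgn_if)
    also have "\<dots> \<le> C * K * (1 + r powr (real m - ?a))" by (rule C(2)[OF f \<open>K > 0\<close> r(1,2)])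
    also have "\<dots> \<le> C * K * 2"
    proof -
      have "real m - ?a \<ge> 0" using m by (simp add: field_simps) linarith?
      then have "r powr (real m - ?a) \<le> 1" using r by (simp add: powr_le1)
      then show ?thesis using C(1) \<open>K > 0\<close> by (intro mult_left_mono) auto
    qed
    finally show ?thesis using c by (simp add: field_simps)
  qed (use C(1) c \<open>K > 0\<close> in simp)
  then show ?thesis using C(1) c by (intro that[of "4 * C / c"]) auto
qed

lemma sobolev_bounded_mono:
  assumes "sobolev_bounded m K f" "\<bar>K\<bar> \<le> K'"
  shows "sobolev_bounded m K' f"
proof -
  have "K\<^sup>2 \<le> K'\<^sup>2" using assms(2) by (metis abs_ge_zero power2_abs power_mono)
  with assms(1) show ?thesis
    by (induction m arbitrary: f) (force simp: L2_bounded_def)+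
qed

section \<open>Integrability of decaying functions\<close>

lemma nn_integral_powr_tail:
  fixes a e :: real
  assumes "e < -1" "a > 0"
  shows "(\<integral>\<^sup>+r. indicator {a..} r * ennreal (r powr e) \<partial>lborel) = ennreal (- (a powr (e + 1)) / (e + 1))"
proof -
  have "((\<lambda>r. if r \<in> {a..} then r powr e else 0) has_integral - (a powr (e + 1)) / (e + 1)) (UNIV::real set)"
    using has_integral_powr_to_inf[OF assms] by (subst has_integral_restrict_UNIV)
  moreover have "(\<lambda>r. indicator {a..} r *\<^sub>R r powr e) = (\<lambda>r::real. if r \<in> {a..} then r powr e else 0)" by auto
  ultimately have *: "((\<lambda>r. indicator {a..} r *\<^sub>R r powr e) has_integral - (a powr (e + 1)) / (e + 1)) (UNIV::real set)"
    by simp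
  have "(\<integral>\<^sup>+r. ennreal (indicator {a..} r *\<^sub>R r powr e) \<partial>lborel) = ennreal (- (a powr (e + 1)) / (e + 1))"
    by (rule nn_integral_has_integral_lborel[OF _ _ *]) auto
  moreover have "(\<integral>\<^sup>+r. ennreal (indicator {a..} r *\<^sub>R r powr e) \<partial>lborel)
      = (\<integral>\<^sup>+r. indicator {a..} r * ennreal (r powr e) \<partial>lborel)"
    by (intro nn_integral_cong) (auto simp: indicator_def)
  ultimately show ?thesis by simp
qed

text \<open>The function is the integral of a power of \<open>r\<close> over \<open>r \<ge> |x|\<close>; exchanging the integrals leaves
the volumes of balls in place of the integration over space.\<close>

lemma nn_integral_norm_powr_finite:
  assumes "e > 0"
  shows "(\<integral>\<^sup>+x. indicator {x. norm x \<ge> 1} (x::real^'n) * ennreal (norm x powr - (real CARD('n) + e)) \<partial>lborel) < \<infinity>"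
proof -
  let ?n = "real CARD('n)"
  let ?a = "?n + e"
  let ?V = "unit_ball_vol ?n"
  let ?S = "{x::real^'n. norm x \<ge> 1}"
  have [measurable]: "?S \<in> sets borel" by (intro borel_closed closed_Collect_le continuous_intros)
  have layer: "indicator ?S x * ennreal (norm x powr - ?a)
      \<le> (\<integral>\<^sup>+r. ennreal ?a * (indicator {1..} r * ennreal (r powr (- ?a - 1)) * indicator (cball 0 r) x) \<partial>lborel)" for x :: "real^'n"
  proof (cases "norm x \<ge> 1")
    case True
    have "(\<integral>\<^sup>+r. ennreal ?a * (indicator {1..} r * ennreal (r powr (- ?a - 1)) * indicator (cball 0 r) x) \<partial>lborel)
        = (\<integral>\<^sup>+r. ennreal ?a * (indicator {norm x..} r * ennreal (r powr (- ?a - 1))) \<partial>lborel)"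
      using True by (intro nn_integral_cong) (auto simp: indicator_def)
    also have "\<dots> = ennreal ?a * ennreal (- (norm x powr (- ?a - 1 + 1)) / (- ?a - 1 + 1))"
    proof -
      have "- ?a - 1 < - 1" "norm x > 0" using True assms by (auto simp: add_pos_pos)
      from nn_integral_powr_tail[OF this] show ?thesis by (subst nn_integral_cmult) auto
    qed
    also have "\<dots> = ennreal (norm x powr - ?a)"
    proof -
      have "- ?a - 1 + 1 = - ?a" by simp
      then have "- (norm x powr (- ?a - 1 + 1)) / (- ?a - 1 + 1) = norm x powr - ?a / ?a"
        by (simp only: minus_divide_divide)
      then show ?thesis using assms by (simp only:) (subst ennreal_mult[symmetric], auto)
    qed
    finally show ?thesis using True by simp
  qed simp
  let ?B = "\<integral>\<^sup>+x. (\<integral>\<^sup>+r. ennreal ?a * (indicator {1..} r * ennreal (r powr (- ?a - 1)) * indicator (cball 0 r) (x::real^'n)) \<partial>lborel) \<partial>lborel"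
  let ?C = "\<integral>\<^sup>+r. (\<integral>\<^sup>+x. ennreal ?a * (indicator {1..} r * ennreal (r powr (- ?a - 1)) * indicator (cball 0 r) (x::real^'n)) \<partial>lborel) \<partial>lborel"
  let ?D = "\<integral>\<^sup>+r. ennreal (?a * ?V) * (indicator {1..} r * ennreal (r powr (- e - 1))) \<partial>lborel"
  have 1: "(\<integral>\<^sup>+x. indicator ?S x * ennreal (norm x powr - ?a) \<partial>lborel)
      \<le> ?B"
    by (intro nn_integral_mono layer)
  have 2: "?B = ?C"
  proof (rule lborel_pair.Fubini'[symmetric])
    define S where "S = {p::(real^'n) \<times> real. norm (fst p) \<le> snd p}"
    have eq: "indicator (cball 0 r) x = (indicator S (x, r) :: ennreal)" for r and x :: "real^'n"
      by (simp add: indicator_def S_def)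
    have "closed S" unfolding S_def by (intro closed_Collect_le continuous_intros)
    then have "S \<in> sets (borel \<Otimes>\<^sub>M borel)" unfolding borel_prod by (rule borel_closed)
    then have [measurable]: "indicator S \<in> borel_measurable ((borel :: (real^'n) measure) \<Otimes>\<^sub>M (borel :: real measure))"
      by (rule borel_measurable_indicator)
    have "(\<lambda>p. ennreal ?a * (indicator {1..} (snd p) * ennreal (snd p powr (- ?a - 1)) * indicator S p))
        \<in> borel_measurable ((borel :: (real^'n) measure) \<Otimes>\<^sub>M (borel :: real measure))"
      by measurable
    then show "(\<lambda>(x, r). ennreal ?a * (indicator {1..} r * ennreal (r powr (- ?a - 1)) * indicator (cball 0 r) (x::real^'n)))
        \<in> borel_measurable (lborel \<Otimes>\<^sub>M lborel)"
      by (simp add: eq case_prod_beta' cong: measurable_cong_sets)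
  qed
  have 3: "?C = ?D"
  proof (rule nn_integral_cong)
    fix r :: real
    show "(\<integral>\<^sup>+x. ennreal ?a * (indicator {1..} r * ennreal (r powr (- ?a - 1)) * indicator (cball 0 r) (x::real^'n)) \<partial>lborel)
      = ennreal (?a * ?V) * (indicator {1..} r * ennreal (r powr (- e - 1)))"
    proof (cases "r \<ge> 1")
      case True
      have "(\<integral>\<^sup>+x. ennreal ?a * (indicator {1..} r * ennreal (r powr (- ?a - 1)) * indicator (cball 0 r) (x::real^'n)) \<partial>lborel)
        = ennreal ?a * (ennreal (r powr (- ?a - 1)) * emeasure lborel (cball (0::real^'n) r))"
      proof -
        have "(\<integral>\<^sup>+x. (ennreal ?a * ennreal (r powr (- ?a - 1))) * indicator (cball (0::real^'n) r) x \<partial>lborel)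
          = (ennreal ?a * ennreal (r powr (- ?a - 1))) * emeasure lborel (cball (0::real^'n) r)"
          by (rule nn_integral_cmult_indicator) (simp only: sets_lborel borel_closed closed_cball)
        then show ?thesis using True by (simp only: indicator_simps atLeast_iff mult_1 mult.assoc)
      qed
      also have "\<dots> = ennreal (?a * (r powr (- ?a - 1) * (?V * r ^ CARD('n))))"
        using True assms by (simp add: emeasure_cball ennreal_mult)
      also have "r powr (- ?a - 1) * (?V * r ^ CARD('n)) = ?V * r powr (- e - 1)"
        using True by (simp add: powr_realpow[symmetric] powr_add[symmetric])
      finally show ?thesis using True assms by (simp add: ennreal_mult mult.assoc)
    qed simp
  qed
  have 4: "?D = ennreal (?a * ?V) * ennreal (1 / e)"
    using assms by (subst nn_integral_cmult) (auto simp: nn_integral_powr_tail)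
  have "ennreal (?a * ?V) * ennreal (1 / e) < \<infinity>" by (simp add: ennreal_mult_less_top)
  then show ?thesis
    using ord_le_eq_trans[OF 1 trans[OF 2 trans[OF 3 4]]] by (rule le_less_trans[rotated])
qed

lemma integrable_of_decay:
  fixes f :: "real^'n \<Rightarrow> real"
  assumes f: "continuous_on UNIV f" and "e > 0"
    and O: "f \<in> O[at_infinity](\<lambda>x. norm x powr - (real CARD('n) + e))"
  shows "integrable lborel f"
proof -
  let ?g = "\<lambda>x::real^'n. norm x powr - (real CARD('n) + e)"
  let ?S = "\<lambda>R. {x::real^'n. norm x \<ge> R}"
  obtain C where C: "C > 0" "\<forall>\<^sub>F x in at_infinity. norm (f x) \<le> C * norm (?g x)"
    using landau_o.bigE[OF O] by blast
  then obtain R0 where R0: "\<And>x. norm x \<ge> R0 \<Longrightarrow> \<bar>f x\<bar> \<le> C * ?g x" by (auto simp: eventually_at_infinity)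
  define R where "R = max R0 1"
  have [measurable]: "?S 1 \<in> sets borel" by (intro borel_closed closed_Collect_le continuous_intros)
  have "integrable lborel (\<lambda>x. indicator (?S 1) x * ?g x)"
  proof (rule integrableI_nonneg)
    show "(\<integral>\<^sup>+x. ennreal (indicator (?S 1) x * ?g x) \<partial>lborel) < \<infinity>"
      using nn_integral_norm_powr_finite[OF \<open>e > 0\<close>, where 'n = 'n]
      by (simp add: ennreal_mult' ennreal_indicator)
  qed auto
  then have "integrable lborel (\<lambda>x. C * (indicator (?S 1) x * ?g x) + indicator (cball 0 R) x *\<^sub>R \<bar>f x\<bar>)"
    by (intro Bochner_Integration.integrable_add integrable_mult_right borel_integrable_compact)
      (auto intro!: continuous_intros continuous_on_subset[OF f])
  then show ?thesis
  proof (rule Bochner_Integration.integrable_bound)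
    show "f \<in> borel_measurable lborel" using borel_measurable_continuous_onI[OF f] by simp
    show "AE x in lborel. norm (f x) \<le> norm (C * (indicator (?S 1) x * ?g x) + indicator (cball 0 R) x *\<^sub>R \<bar>f x\<bar>)"
    proof (intro AE_I2)
      fix x
      show "norm (f x) \<le> norm (C * (indicator (?S 1) x * ?g x) + indicator (cball 0 R) x *\<^sub>R \<bar>f x\<bar>)"
        using R0[of x] C(1) by (cases "norm x \<le> R") (auto simp: R_def indicator_def)
    qed
  qed
qed

section \<open>An inequality along rays\<close>

lemma nn_integral_translate:
  fixes F :: "real^'n \<Rightarrow> ennreal"
  assumes [measurable]: "F \<in> borel_measurable borel"
  shows "(\<integral>\<^sup>+x. F (x + v) \<partial>lborel) = (\<integral>\<^sup>+x. F x \<partial>lborel)"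
proof -
  have "(\<integral>\<^sup>+x. F x \<partial>lborel) = (\<integral>\<^sup>+x. F x \<partial>distr lborel borel ((+) v))"
    by (simp add: lborel_distr_plus)
  also have "\<dots> = (\<integral>\<^sup>+x. F (v + x) \<partial>lborel)"
    by (rule nn_integral_distr) auto
  finally show ?thesis by (simp add: add.commute)
qed

lemma nn_integral_scale:
  fixes F :: "real^'n \<Rightarrow> ennreal"
  assumes [measurable]: "F \<in> borel_measurable borel" and "r > 0"
  shows "(\<integral>\<^sup>+z. F (x + r *\<^sub>R z) \<partial>lborel) = ennreal (1 / r ^ CARD('n)) * (\<integral>\<^sup>+x. F x \<partial>lborel)"
proof -
  have "(\<integral>\<^sup>+y. F y \<partial>lborel)
      = (\<integral>\<^sup>+y. F y \<partial>density (distr lborel borel (\<lambda>z. x + r *\<^sub>R z)) (\<lambda>_. ennreal (\<bar>r\<bar> ^ DIM(real^'n))))"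
    using lborel_affine[of r x] assms(2) by simp
  also have "\<dots> = (\<integral>\<^sup>+y. ennreal (r ^ CARD('n)) * F y \<partial>distr lborel borel (\<lambda>z. x + r *\<^sub>R z))"
    using assms(2) by (subst nn_integral_density) auto
  also have "\<dots> = ennreal (r ^ CARD('n)) * (\<integral>\<^sup>+z. F (x + r *\<^sub>R z) \<partial>lborel)"
    by (subst nn_integral_distr) (auto simp: nn_integral_cmult)
  finally have "ennreal (1 / r ^ CARD('n)) * (\<integral>\<^sup>+x. F x \<partial>lborel)
      = (ennreal (1 / r ^ CARD('n)) * ennreal (r ^ CARD('n))) * (\<integral>\<^sup>+z. F (x + r *\<^sub>R z) \<partial>lborel)"
    by (simp add: mult.assoc)
  also have "ennreal (1 / r ^ CARD('n)) * ennreal (r ^ CARD('n)) = 1"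
    using assms(2) by (subst ennreal_mult[symmetric]) auto
  finally show ?thesis by simp
qed

text \<open>The fundamental theorem of calculus from \<open>x\<close> to infinity in direction \<open>z\<close>.\<close>

lemma abs_le_ray_integral:
  fixes w :: "real^'n \<Rightarrow> real"
  assumes diff: "\<And>x. w differentiable (at x)" and cont: "continuous_on UNIV (grad w)"
    and lim: "(w \<longlongrightarrow> 0) at_infinity" and z: "z \<noteq> 0"
  shows "ennreal \<bar>w x\<bar> \<le> (\<integral>\<^sup>+r. indicator {0..} r * ennreal (norm z * norm (grad w (x + r *\<^sub>R z))) \<partial>lborel)"
    (is "_ \<le> ?I")
proof -
  let ?h = "\<lambda>r. norm z * norm (grad w (x + r *\<^sub>R z))"
  have ch: "continuous_on S ?h" for S
    by (intro continuous_intros continuous_on_compose2[OF cont]) auto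
  have cg: "continuous_on S (\<lambda>r. z \<bullet> grad w (x + r *\<^sub>R z))" for S
    by (intro continuous_intros continuous_on_compose2[OF cont]) auto
  have step: "ennreal \<bar>w x\<bar> \<le> ennreal \<bar>w (x + R *\<^sub>R z)\<bar> + ?I" if "R \<ge> 0" for R
  proof -
    have "((\<lambda>r. z \<bullet> grad w (x + r *\<^sub>R z)) has_integral (w (x + R *\<^sub>R z) - w (x + 0 *\<^sub>R z))) {0..R}"
    proof (rule fundamental_theorem_of_calculus[OF that])
      show "((\<lambda>r. w (x + r *\<^sub>R z)) has_vector_derivative z \<bullet> grad w (x + r *\<^sub>R z)) (at r within {0..R})" for r
        using pd_has_derivative_line[of w x r z, OF diff]
        by (simp only: has_real_derivative_iff_has_vector_derivative has_vector_derivative_at_within)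
    qed
    then have "w (x + R *\<^sub>R z) - w x = integral {0..R} (\<lambda>r. z \<bullet> grad w (x + r *\<^sub>R z))"
      by (simp add: integral_unique)
    moreover have "norm (integral {0..R} (\<lambda>r. z \<bullet> grad w (x + r *\<^sub>R z))) \<le> integral {0..R} ?h"
      by (intro integral_norm_bound_integral integrable_continuous_real ch cg)
        (use Cauchy_Schwarz_ineq2 in auto)
    ultimately have "\<bar>w x\<bar> \<le> \<bar>w (x + R *\<^sub>R z)\<bar> + integral {0..R} ?h" by simp
    moreover have "ennreal (integral {0..R} ?h) \<le> ?I"
    proof -
      have i: "integrable lborel (\<lambda>r. indicator {0..R} r *\<^sub>R ?h r)"
        by (rule borel_integrable_compact[OF _ ch]) simp
      then have "integral {0..R} ?h = (LINT r|lborel. indicator {0..R} r *\<^sub>R ?h r)"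
        using set_borel_integral_eq_integral(2)[of "{0..R}" ?h]
        unfolding set_integrable_def set_lebesgue_integral_def by simp
      also have "ennreal \<dots> = (\<integral>\<^sup>+r. ennreal (indicator {0..R} r *\<^sub>R ?h r) \<partial>lborel)"
        by (rule nn_integral_eq_integral[OF i, symmetric]) auto
      also have "\<dots> \<le> ?I" by (rule nn_integral_mono) (auto simp: indicator_def)
      finally show ?thesis .
    qed
    moreover have "integral {0..R} ?h \<ge> 0" by (intro integral_nonneg integrable_continuous_real ch) auto
    ultimately show ?thesis
      by (smt (verit, best) abs_ge_zero add_left_mono ennreal_leI ennreal_plus order_trans)
  qed
  have "filterlim (\<lambda>k. x + real k *\<^sub>R z) at_infinity sequentially"
  proof (rule filterlim_norm_at_top_imp_at_infinity)
    have "filterlim (\<lambda>k. norm z * real k) at_top sequentially"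
      using z by (intro filterlim_tendsto_pos_mult_at_top[OF tendsto_const _ filterlim_real_sequentially]) auto
    then have "filterlim (\<lambda>k. - norm x + norm z * real k) at_top sequentially"
      by (rule filterlim_tendsto_add_at_top[OF tendsto_const])
    then show "filterlim (\<lambda>k. norm (x + real k *\<^sub>R z)) at_top sequentially"
    proof (rule filterlim_at_top_mono, intro always_eventually allI)
      fix k show "- norm x + norm z * real k \<le> norm (x + real k *\<^sub>R z)"
        using norm_diff_ineq[of "real k *\<^sub>R z" x] by (simp add: add.commute mult.commute)
    qed
  qed
  then have "(\<lambda>k. w (x + real k *\<^sub>R z)) \<longlonglongrightarrow> 0" by (rule filterlim_compose[OF lim])
  then have "(\<lambda>k. ennreal \<bar>w (x + real k *\<^sub>R z)\<bar> + ?I) \<longlonglongrightarrow> ennreal \<bar>0\<bar> + ?I"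
    by (intro tendsto_intros)
  then show ?thesis
    by (intro LIMSEQ_le_const[where X = "\<lambda>k. ennreal \<bar>w (x + real k *\<^sub>R z)\<bar> + ?I"])
      (use step in auto)
qed

lemma ennreal_mult_le_weighted:
  assumes "q > 0" "a \<ge> 0" "b \<ge> 0"
  shows "ennreal (a * b) \<le> ennreal q * ennreal (a\<^sup>2) + ennreal (1 / (4 * q)) * ennreal (b\<^sup>2)"
proof -
  have "a * b \<le> b\<^sup>2 / (2 * (2 * q)) + (2 * q) / 2 * a\<^sup>2"
    using abs_mult_le_weighted_squares[of "2 * q" b a] assms by (simp add: mult.commute)
  then have "ennreal (a * b) \<le> ennreal (q * a\<^sup>2 + 1 / (4 * q) * b\<^sup>2)"
    by (intro ennreal_leI) simp
  also have "\<dots> = ennreal (q * a\<^sup>2) + ennreal (1 / (4 * q) * b\<^sup>2)"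
    using assms by (intro ennreal_plus) auto
  also have "\<dots> = ennreal q * ennreal (a\<^sup>2) + ennreal (1 / (4 * q)) * ennreal (b\<^sup>2)"
    using assms by (subst (1 2) ennreal_mult) auto
  finally show ?thesis .
qed

lemma nn_integral_ray_weight: "(\<integral>\<^sup>+r. indicator {1<..} r * ennreal (r powr (- (3 / 2))) \<partial>lborel) = 2"
proof -
  have "(\<integral>\<^sup>+r. indicator {1<..} r * ennreal (r powr (- (3 / 2))) \<partial>lborel)
      = (\<integral>\<^sup>+r. indicator {1..} r * ennreal (r powr (- (3 / 2))) \<partial>lborel)"
    by (intro nn_integral_cong_AE eventually_mono[OF AE_lborel_singleton[of 1]]) (auto simp: indicator_def)
  then show ?thesis using nn_integral_powr_tail[of "- (3 / 2)" 1] by simp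
qed

text \<open>A substitute for the Sobolev inequality \<open>\<parallel>w\<parallel> \<le> C \<parallel>\<nabla> w\<parallel>\<close> with exponents \<open>2n/(n-2)\<close> and \<open>2\<close>.
The bound along a ray is averaged over the directions \<open>z\<close> in the unit cube \<open>[1,2]\<^sup>n\<close>. For
\<open>r \<le> 1\<close>, translation invariance in \<open>x\<close> gives \<open>\<integral> \<rho>(x) |\<nabla> w(x + r z)| dx\<close> a bound by \<open>\<integral> \<rho>\<^sup>2\<close> and
\<open>\<integral> |\<nabla> w|\<^sup>2\<close>. For \<open>r > 1\<close>, the average over \<open>z\<close> of \<open>|\<nabla> w(x + r z)|\<^sup>2\<close> gains a factor \<open>r\<^sup>-\<^sup>n\<close>, which
leaves an integrable power of \<open>r\<close> precisely when \<open>n \<ge> 3\<close>. The parameter \<open>\<eta>\<close> replaces the use of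
square roots in the Cauchy--Schwarz inequality.\<close>

lemma nn_integral_density_mult_le:
  fixes w \<rho> :: "real^'n \<Rightarrow> real"
  assumes dim: "CARD('n) \<ge> 3"
    and diff: "\<And>x. w differentiable (at x)" and cont: "continuous_on UNIV (grad w)"
    and lim: "(w \<longlongrightarrow> 0) at_infinity"
    and \<rho>: "continuous_on UNIV \<rho>" "\<And>x. \<rho> x \<ge> 0" and \<eta>: "\<eta> > 0"
  shows "(\<integral>\<^sup>+x. ennreal (\<rho> x * \<bar>w x\<bar>) \<partial>lborel) \<le> ennreal (2 * sqrt (real CARD('n))) *
    (ennreal \<eta> * ((\<integral>\<^sup>+x. ennreal ((\<rho> x)\<^sup>2) \<partial>lborel) + 2 * (\<integral>\<^sup>+x. ennreal (\<rho> x) \<partial>lborel))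
     + ennreal (1 / (4 * \<eta>)) * (1 + 2 * (\<integral>\<^sup>+x. ennreal (\<rho> x) \<partial>lborel))
        * (\<integral>\<^sup>+x. ennreal ((norm (grad w x))\<^sup>2) \<partial>lborel))"
proof -
  let ?n = "CARD('n)"
  let ?c = "ennreal (2 * sqrt (real ?n))"
  define A where "A = (\<integral>\<^sup>+x. ennreal ((\<rho> x)\<^sup>2) \<partial>lborel)"
  define M where "M = (\<integral>\<^sup>+x. ennreal (\<rho> x) \<partial>lborel)"
  define B where "B = (\<integral>\<^sup>+x. ennreal ((norm (grad w x))\<^sup>2) \<partial>lborel)"
  let ?k = "ennreal (1 / (4 * \<eta>))"
  define G where "G x = norm (grad w x)" for x
  define Z :: "(real^'n) set" where "Z = cbox (\<chi> i. 1) (\<chi> i. 2)"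
  have B_G: "B = (\<integral>\<^sup>+x. ennreal ((G x)\<^sup>2) \<partial>lborel)" by (simp add: B_def G_def)
  have cG: "continuous_on UNIV G" unfolding G_def by (intro continuous_intros cont)
  have [measurable]: "G \<in> borel_measurable borel" "\<rho> \<in> borel_measurable borel" "w \<in> borel_measurable borel"
    using cG \<rho>(1) diff
    by (auto intro!: borel_measurable_continuous_onI continuous_at_imp_continuous_on differentiable_imp_continuous_within)
  have [measurable]: "Z \<in> sets borel" by (simp add: Z_def)
  have G0: "G x \<ge> 0" for x by (simp add: G_def)
  have emZ: "emeasure lborel Z = 1"
  proof -
    have "(\<chi> i. 1) \<in> Z" by (simp add: Z_def mem_box_cart)
    then have "Z \<noteq> {}" by blast
    then have "measure lborel Z = 1" unfolding Z_def by (subst content_cbox_cart) auto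
    moreover have "emeasure lborel Z = ennreal (measure lborel Z)"
      unfolding Z_def using emeasure_lborel_cbox_finite by (intro emeasure_eq_ennreal_measure) (simp add: less_top)
    ultimately show ?thesis by simp
  qed
  have Z: "z \<noteq> 0" "norm z \<le> 2 * sqrt (real ?n)" if "z \<in> Z" for z
  proof -
    have *: "1 \<le> z $ i" "z $ i \<le> 2" for i using that by (auto simp: Z_def mem_box_cart)
    then show "z \<noteq> 0" by force
    have "norm z = sqrt (\<Sum>i\<in>UNIV. (z $ i)\<^sup>2)" by (simp add: norm_vec_def L2_set_def)
    also have "\<dots> \<le> sqrt (\<Sum>i\<in>(UNIV :: 'n set). 2\<^sup>2)"
      by (intro real_sqrt_le_mono sum_mono power_mono) (use * in \<open>auto intro: order_trans[of 0 1]\<close>)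
    also have "\<dots> = 2 * sqrt (real ?n)" by (simp add: real_sqrt_mult)
    finally show "norm z \<le> 2 * sqrt (real ?n)" .
  qed
  define H where "H x r = (\<integral>\<^sup>+z. indicator Z z * ennreal (G (x + r *\<^sub>R z)) \<partial>lborel)" for x r
  have [measurable]: "case_prod H \<in> borel_measurable (borel \<Otimes>\<^sub>M borel)"
    unfolding H_def[abs_def] by measurable
  have w_le: "ennreal \<bar>w x\<bar> \<le> ?c * (\<integral>\<^sup>+r. indicator {0..} r * H x r \<partial>lborel)" for x
  proof -
    have "ennreal \<bar>w x\<bar> = (\<integral>\<^sup>+z. indicator Z z * ennreal \<bar>w x\<bar> \<partial>lborel)"
      using emZ by (simp add: nn_integral_multc)
    also have "\<dots> \<le> (\<integral>\<^sup>+z. ?c * (\<integral>\<^sup>+r. indicator Z z * indicator {0..} r * ennreal (G (x + r *\<^sub>R z)) \<partial>lborel) \<partial>lborel)"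
    proof (intro nn_integral_mono)
      fix z :: "real^'n"
      show "indicator Z z * ennreal \<bar>w x\<bar> \<le> ?c * (\<integral>\<^sup>+r. indicator Z z * indicator {0..} r * ennreal (G (x + r *\<^sub>R z)) \<partial>lborel)"
      proof (cases "z \<in> Z")
        case True
        have "ennreal \<bar>w x\<bar> \<le> (\<integral>\<^sup>+r. indicator {0..} r * ennreal (norm z * norm (grad w (x + r *\<^sub>R z))) \<partial>lborel)"
          by (rule abs_le_ray_integral[OF diff cont lim Z(1)[OF True]])
        also have "\<dots> \<le> (\<integral>\<^sup>+r. ?c * (indicator {0..} r * ennreal (G (x + r *\<^sub>R z))) \<partial>lborel)"
          using Z(2)[OF True]
          by (intro nn_integral_mono) (auto simp: indicator_def G_def ennreal_mult[symmetric] intro!: ennreal_leI mult_right_mono)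
        also have "\<dots> = ?c * (\<integral>\<^sup>+r. indicator {0..} r * ennreal (G (x + r *\<^sub>R z)) \<partial>lborel)"
          by (rule nn_integral_cmult) measurable
        finally show ?thesis using True by simp
      qed simp
    qed
    also have "\<dots> = ?c * (\<integral>\<^sup>+z. (\<integral>\<^sup>+r. indicator Z z * indicator {0..} r * ennreal (G (x + r *\<^sub>R z)) \<partial>lborel) \<partial>lborel)"
      by (rule nn_integral_cmult) measurable
    also have "(\<integral>\<^sup>+z. (\<integral>\<^sup>+r. indicator Z z * indicator {0..} r * ennreal (G (x + r *\<^sub>R z)) \<partial>lborel) \<partial>lborel)
        = (\<integral>\<^sup>+r. (\<integral>\<^sup>+z. indicator Z z * indicator {0..} r * ennreal (G (x + r *\<^sub>R z)) \<partial>lborel) \<partial>lborel)"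
      by (rule lborel_pair.Fubini'[symmetric]) measurable
    also have "\<dots> = (\<integral>\<^sup>+r. indicator {0..} r * H x r \<partial>lborel)"
      unfolding H_def by (intro nn_integral_cong) (auto simp: indicator_def)
    finally show ?thesis .
  qed
  define D where "D r = (\<integral>\<^sup>+x. ennreal (\<rho> x) * H x r \<partial>lborel)" for r
  have [measurable]: "D \<in> borel_measurable borel" unfolding D_def[abs_def] by measurable
  have "(\<integral>\<^sup>+x. ennreal (\<rho> x * \<bar>w x\<bar>) \<partial>lborel) \<le> (\<integral>\<^sup>+x. ?c * (\<integral>\<^sup>+r. ennreal (\<rho> x) * (indicator {0..} r * H x r) \<partial>lborel) \<partial>lborel)"
  proof (intro nn_integral_mono)
    fix x
    have "ennreal (\<rho> x * \<bar>w x\<bar>) = ennreal (\<rho> x) * ennreal \<bar>w x\<bar>" using \<rho>(2) by (intro ennreal_mult) auto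
    also have "\<dots> \<le> ennreal (\<rho> x) * (?c * (\<integral>\<^sup>+r. indicator {0..} r * H x r \<partial>lborel))"
      by (intro mult_left_mono w_le) auto
    also have "\<dots> = ?c * (\<integral>\<^sup>+r. ennreal (\<rho> x) * (indicator {0..} r * H x r) \<partial>lborel)"
      by (subst nn_integral_cmult) (auto simp: mult_ac)
    finally show "ennreal (\<rho> x * \<bar>w x\<bar>) \<le> \<dots>" .
  qed
  also have "\<dots> = ?c * (\<integral>\<^sup>+x. (\<integral>\<^sup>+r. ennreal (\<rho> x) * (indicator {0..} r * H x r) \<partial>lborel) \<partial>lborel)"
    by (rule nn_integral_cmult) measurable
  also have "(\<integral>\<^sup>+x. (\<integral>\<^sup>+r. ennreal (\<rho> x) * (indicator {0..} r * H x r) \<partial>lborel) \<partial>lborel)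
      = (\<integral>\<^sup>+r. (\<integral>\<^sup>+x. ennreal (\<rho> x) * (indicator {0..} r * H x r) \<partial>lborel) \<partial>lborel)"
    by (rule lborel_pair.Fubini'[symmetric]) measurable
  also have "\<dots> = (\<integral>\<^sup>+r. indicator {0..} r * D r \<partial>lborel)"
    unfolding D_def by (intro nn_integral_cong) (auto simp: indicator_def)
  also have "\<dots> \<le> (\<integral>\<^sup>+r. indicator {0..1} r * (ennreal \<eta> * A + ?k * B)
      + (indicator {1<..} r * ennreal (r powr (- (3 / 2)))) * (M * (ennreal \<eta> + ?k * B)) \<partial>lborel)"
  proof (intro nn_integral_mono)
    fix r :: real
    consider "r < 0" | "0 \<le> r" "r \<le> 1" | "r > 1" by linarith
    then show "indicator {0..} r * D r \<le> indicator {0..1} r * (ennreal \<eta> * A + ?k * B)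
      + (indicator {1<..} r * ennreal (r powr (- (3 / 2)))) * (M * (ennreal \<eta> + ?k * B))"
    proof cases
      case 2
      have "D r = (\<integral>\<^sup>+x. (\<integral>\<^sup>+z. ennreal (\<rho> x) * (indicator Z z * ennreal (G (x + r *\<^sub>R z))) \<partial>lborel) \<partial>lborel)"
        unfolding D_def H_def by (simp add: nn_integral_cmult)
      also have "\<dots> = (\<integral>\<^sup>+z. (\<integral>\<^sup>+x. ennreal (\<rho> x) * (indicator Z z * ennreal (G (x + r *\<^sub>R z))) \<partial>lborel) \<partial>lborel)"
        by (rule lborel_pair.Fubini'[symmetric]) measurable
      also have "\<dots> \<le> (\<integral>\<^sup>+z. indicator Z z * (ennreal \<eta> * A + ?k * B) \<partial>lborel)"
      proof (intro nn_integral_mono)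
        fix z :: "real^'n"
        have "(\<integral>\<^sup>+x. ennreal (\<rho> x) * ennreal (G (x + r *\<^sub>R z)) \<partial>lborel)
            \<le> (\<integral>\<^sup>+x. ennreal \<eta> * ennreal ((\<rho> x)\<^sup>2) + ?k * ennreal ((G (x + r *\<^sub>R z))\<^sup>2) \<partial>lborel)"
          using ennreal_mult_le_weighted[OF \<eta> \<rho>(2) G0] \<rho>(2) G0
          by (intro nn_integral_mono) (simp add: ennreal_mult)
        also have "\<dots> = ennreal \<eta> * A + ?k * (\<integral>\<^sup>+x. ennreal ((G (x + r *\<^sub>R z))\<^sup>2) \<partial>lborel)"
          unfolding A_def by (subst nn_integral_add) (auto simp: nn_integral_cmult)
        also have "(\<integral>\<^sup>+x. ennreal ((G (x + r *\<^sub>R z))\<^sup>2) \<partial>lborel) = B"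
          using nn_integral_translate[of "\<lambda>x. ennreal ((G x)\<^sup>2)" "r *\<^sub>R z"] by (simp add: B_G)
        finally show "(\<integral>\<^sup>+x. ennreal (\<rho> x) * (indicator Z z * ennreal (G (x + r *\<^sub>R z))) \<partial>lborel)
            \<le> indicator Z z * (ennreal \<eta> * A + ?k * B)" by (auto simp: indicator_def)
      qed
      also have "\<dots> = ennreal \<eta> * A + ?k * B" using emZ by (subst nn_integral_multc) auto
      finally show ?thesis using 2 by (simp add: indicator_def)
    next
      case 3
      let ?q = "\<eta> * r powr (- (3/2))"
      have q: "?q > 0" using \<eta> 3 by simp
      have HB: "H x r \<le> ennreal (r powr (- (3 / 2))) * (ennreal \<eta> + ?k * B)" for x
      proof -
        have "H x r \<le> (\<integral>\<^sup>+z. indicator Z z * ennreal ?q + ennreal (1 / (4 * ?q)) * ennreal ((G (x + r *\<^sub>R z))\<^sup>2) \<partial>lborel)"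
          unfolding H_def
          using ennreal_mult_le_weighted[OF q _ G0, of 1] by (intro nn_integral_mono) (auto simp: indicator_def)
        also have "\<dots> = ennreal ?q + ennreal (1 / (4 * ?q)) * (\<integral>\<^sup>+z. ennreal ((G (x + r *\<^sub>R z))\<^sup>2) \<partial>lborel)"
          using emZ by (subst nn_integral_add) (auto simp: nn_integral_cmult nn_integral_multc)
        also have "(\<integral>\<^sup>+z. ennreal ((G (x + r *\<^sub>R z))\<^sup>2) \<partial>lborel) = ennreal (1 / r ^ ?n) * B"
          using nn_integral_scale[of "\<lambda>x. ennreal ((G x)\<^sup>2)" r x] 3 by (simp add: B_G)
        also have "ennreal (1 / (4 * ?q)) * (ennreal (1 / r ^ ?n) * B) = ennreal (1 / (4 * ?q) * (1 / r ^ ?n)) * B"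
          using q 3 by (subst ennreal_mult) (auto simp: mult.assoc)
        also have "\<dots> \<le> ennreal (r powr (- (3 / 2)) * (1 / (4 * \<eta>))) * B"
        proof (intro mult_right_mono ennreal_leI)
          have "1 / (4 * ?q) * (1 / r ^ ?n) = (r powr (3 / 2) / r ^ ?n) * (1 / (4 * \<eta>))"
            by (simp add: powr_minus_divide)
          also have "r powr (3 / 2) / r ^ ?n = r powr (3 / 2 - real ?n)"
            using 3 by (simp add: powr_diff powr_realpow)
          also have "\<dots> \<le> r powr (- (3 / 2))" using 3 dim by (intro powr_mono) auto
          finally show "1 / (4 * ?q) * (1 / r ^ ?n) \<le> r powr (- (3 / 2)) * (1 / (4 * \<eta>))"
            using \<eta> by (simp add: divide_right_mono)
        qed simp
        also have "ennreal ?q + \<dots> = ennreal (r powr (- (3 / 2))) * (ennreal \<eta> + ?k * B)"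
        proof -
          have "ennreal ?q = ennreal (r powr (- (3 / 2))) * ennreal \<eta>"
            using \<eta> by (subst ennreal_mult[symmetric]) (auto simp: mult.commute)
          moreover have "ennreal (r powr (- (3 / 2)) * (1 / (4 * \<eta>))) = ennreal (r powr (- (3 / 2))) * ?k"
            using \<eta> by (intro ennreal_mult) auto
          ultimately show ?thesis by (simp only: distrib_left mult.assoc)
        qed
        finally show ?thesis by (simp add: add_left_mono)
      qed
      have "D r \<le> (\<integral>\<^sup>+x. ennreal (\<rho> x) * (ennreal (r powr (- (3 / 2))) * (ennreal \<eta> + ?k * B)) \<partial>lborel)"
        unfolding D_def by (intro nn_integral_mono mult_left_mono HB) auto
      also have "\<dots> = M * (ennreal (r powr (- (3 / 2))) * (ennreal \<eta> + ?k * B))"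
        unfolding M_def by (rule nn_integral_multc) measurable
      finally show ?thesis using 3 by (simp add: indicator_def mult_ac)
    qed simp
  qed
  also have "\<dots> = (ennreal \<eta> * A + ?k * B) + 2 * (M * (ennreal \<eta> + ?k * B))"
    by (subst nn_integral_add) (auto simp: nn_integral_multc nn_integral_ray_weight)
  also have "\<dots> = ennreal \<eta> * (A + 2 * M) + ?k * (1 + 2 * M) * B"
    by (simp add: algebra_simps)
  finally show ?thesis by (simp add: A_def M_def B_def mult_left_mono)
qed

section \<open>Cutoff functions\<close>

lemma DERIV_pos_part_power:
  "((\<lambda>t::real. (max 0 t) ^ Suc (Suc k)) has_real_derivative real (Suc (Suc k)) * (max 0 t) ^ Suc k) (at t)"
proof -
  consider "t > 0" | "t < 0" | "t = 0" by linarith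
  then show ?thesis
  proof cases
    case 1
    have "((\<lambda>t. t ^ Suc (Suc k)) has_real_derivative real (Suc (Suc k)) * (max 0 t) ^ Suc k) (at t)"
      using 1 DERIV_pow[of "Suc (Suc k)" t UNIV] by simp
    then show ?thesis
      by (rule has_field_derivative_transform_within_open[where S="{0<..}"]) (use 1 in auto)
  next
    case 2
    have "((\<lambda>t. 0) has_real_derivative real (Suc (Suc k)) * (max 0 t) ^ Suc k) (at t)"
      using 2 by simp
    then show ?thesis
      by (rule has_field_derivative_transform_within_open[where S="{..<0}"]) (use 2 in auto)
  next
    case 3
    have "(\<lambda>h::real. (max 0 h) ^ Suc (Suc k) / h) = (\<lambda>h. (max 0 h) ^ Suc k)"
      by (auto simp: fun_eq_iff max_def)
    moreover have "((\<lambda>h::real. (max 0 h) ^ Suc k) \<longlongrightarrow> (max 0 0) ^ Suc k) (at 0)" by (intro tendsto_intros)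
    ultimately show ?thesis using 3 by (simp add: DERIV_def)
  qed
qed

definition cutoff_base :: "real \<Rightarrow> real^'n \<Rightarrow> real" where
  "cutoff_base N x = max 0 (1 - (x \<bullet> x) / N\<^sup>2)"

text \<open>The third power makes the cutoff twice continuously differentiable, which is all that the
viscous term demands.\<close>

definition cutoff :: "real \<Rightarrow> real^'n \<Rightarrow> real" where
  "cutoff N x = cutoff_base N x ^ 3"

lemma cutoff_base_bounds: "0 \<le> cutoff_base N x" "cutoff_base N x \<le> 1"
  by (auto simp: cutoff_base_def)

lemma cutoff_bounds: "0 \<le> cutoff N x" "cutoff N x \<le> 1"
  using cutoff_base_bounds[of N x] by (auto simp: cutoff_def power_le_one)

lemma cutoff_base_zero:
  assumes "N > 0" "norm x \<ge> N" shows "cutoff_base N x = 0"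
proof -
  have "N\<^sup>2 \<le> x \<bullet> x" using assms by (simp add: power2_norm_eq_inner[symmetric] power_mono)
  then show ?thesis using assms by (simp add: cutoff_base_def)
qed

lemma cutoff_zero: "N > 0 \<Longrightarrow> norm x \<ge> N \<Longrightarrow> cutoff N x = 0"
  by (simp add: cutoff_def cutoff_base_zero)

lemma continuous_cutoff_base: "continuous_on S (cutoff_base N)"
  unfolding cutoff_base_def[abs_def] divide_inverse[of _ "N\<^sup>2"] by (intro continuous_intros)

lemma has_derivative_cutoff_base_power:
  "((\<lambda>x. cutoff_base N x ^ Suc (Suc k)) has_derivative
    (\<lambda>h. real (Suc (Suc k)) * cutoff_base N x ^ Suc k * (- (2 / N\<^sup>2) * (x \<bullet> h)))) (at x)"
proof -
  have "((\<lambda>x. 1 - (x \<bullet> x) / N\<^sup>2) has_derivative (\<lambda>h. - (2 / N\<^sup>2) * (x \<bullet> h))) (at x)"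
    unfolding divide_inverse[of _ "N\<^sup>2"] by (auto intro!: derivative_eq_intros simp: inner_commute)
  from DERIV_compose_FDERIV[OF DERIV_pos_part_power this, of k]
  show ?thesis by (simp add: cutoff_base_def mult.commute del: of_nat_Suc power_Suc)
qed

lemma pd_cutoff_base_power:
  "pd i (\<lambda>x. cutoff_base N x ^ Suc (Suc k)) x
    = - (2 * real (Suc (Suc k)) / N\<^sup>2) * (x $ i * cutoff_base N x ^ Suc k)"
  using pd_eq[OF has_derivative_cutoff_base_power, of i N k x] by (simp add: inner_axis del: of_nat_Suc power_Suc)

lemma cutoff_eq: "cutoff N = (\<lambda>x. cutoff_base N x ^ Suc (Suc 1))"
  by (simp add: cutoff_def[abs_def] eval_nat_numeral)

lemma cutoff_differentiable: "cutoff N differentiable (at x)"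
  unfolding cutoff_eq differentiable_def using has_derivative_cutoff_base_power by blast

lemma pd_cutoff: "pd i (cutoff N) = (\<lambda>x. - (6 / N\<^sup>2) * (x $ i * cutoff_base N x ^ Suc (Suc 0)))"
  unfolding cutoff_eq pd_cutoff_base_power[abs_def] by (simp add: numeral_eq_Suc)

lemma pd_cutoff_differentiable: "pd i (cutoff N) differentiable (at x)"
  unfolding pd_cutoff
proof -
  have "(\<lambda>x. cutoff_base N x ^ Suc (Suc 0)) differentiable (at x)"
    unfolding differentiable_def using has_derivative_cutoff_base_power by blast
  then show "(\<lambda>x. - (6 / N\<^sup>2) * (x $ i * cutoff_base N x ^ Suc (Suc 0))) differentiable (at x)"
    by (intro differentiable_mult differentiable_const differentiable_coord)
qed

lemma pd_pd_cutoff: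
  "pd j (pd i (cutoff N)) x = - (6 / N\<^sup>2) * (x $ i * (- (4 / N\<^sup>2) * (x $ j * cutoff_base N x))
      + (if j = i then 1 else 0) * (cutoff_base N x)\<^sup>2)"
proof -
  have d: "(\<lambda>x. cutoff_base N x ^ Suc (Suc 0)) differentiable (at x)"
    unfolding differentiable_def using has_derivative_cutoff_base_power by blast
  have "pd j (\<lambda>x. x $ i * cutoff_base N x ^ Suc (Suc 0)) x
     = x $ i * (- (4 / N\<^sup>2) * (x $ j * cutoff_base N x)) + (if j = i then 1 else 0) * (cutoff_base N x)\<^sup>2"
    using pd_mult[OF differentiable_coord d, of j i] pd_cutoff_base_power[of j N 0 x]
    by (simp add: pd_coord power2_eq_square)
  then show ?thesis unfolding pd_cutoff
    by (subst pd_cmult) (use d in \<open>auto intro!: derivative_intros differentiable_coord\<close>)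
qed

lemma abs_coord_cutoff_base_le:
  fixes x :: "real^'n"
  assumes "N > 0" shows "\<bar>x $ i * cutoff_base N x\<bar> \<le> N"
proof (cases "norm x \<ge> N")
  case False
  have "\<bar>x $ i\<bar> * \<bar>cutoff_base N x\<bar> \<le> N * 1"
    using False component_le_norm_cart[of x i] cutoff_base_bounds[of N x] by (intro mult_mono) auto
  then show ?thesis by (simp add: abs_mult)
qed (use assms cutoff_base_zero[OF assms, of x] in simp)

lemma abs_pd_cutoff_le:
  fixes x :: "real^'n"
  assumes "N > 0" shows "\<bar>pd i (cutoff N) x\<bar> \<le> 6 / N"
proof -
  have "\<bar>x $ i * cutoff_base N x\<bar> * cutoff_base N x \<le> N * 1"
    using abs_coord_cutoff_base_le[OF assms, of x i] cutoff_base_bounds[of N x] by (intro mult_mono) auto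
  then have "6 / N\<^sup>2 * (\<bar>x $ i * cutoff_base N x\<bar> * cutoff_base N x) \<le> 6 / N\<^sup>2 * (N * 1)"
    by (intro mult_left_mono) auto
  then show ?thesis
    using assms cutoff_base_bounds[of N x] by (simp add: pd_cutoff abs_mult mult.assoc power2_eq_square)
qed

lemma abs_pd_pd_cutoff_le:
  fixes x :: "real^'n"
  assumes "N > 0" shows "\<bar>pd j (pd i (cutoff N)) x\<bar> \<le> 30 / N\<^sup>2"
proof -
  let ?m = "cutoff_base N x"
  have 1: "\<bar>x $ i * (x $ j * ?m)\<bar> \<le> N * N"
  proof (cases "norm x \<ge> N")
    case False
    have "\<bar>x $ i\<bar> * \<bar>x $ j * ?m\<bar> \<le> N * N"
      using False component_le_norm_cart[of x i] abs_coord_cutoff_base_le[OF assms, of x j] by (intro mult_mono) auto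
    then show ?thesis by (simp add: abs_mult)
  qed (use assms cutoff_base_zero[OF assms, of x] in simp)
  have "pd j (pd i (cutoff N)) x = 24 / N ^ 4 * (x $ i * (x $ j * ?m)) - 6 / N\<^sup>2 * ((if j = i then 1 else 0) * ?m\<^sup>2)"
    by (simp add: pd_pd_cutoff algebra_simps power2_eq_square power4_eq_xxxx)
  also have "\<bar>\<dots>\<bar> \<le> 24 / N ^ 4 * \<bar>x $ i * (x $ j * ?m)\<bar> + 6 / N\<^sup>2 * \<bar>(if j = i then 1 else 0) * ?m\<^sup>2\<bar>"
    by (rule order_trans[OF abs_triangle_ineq4]) (simp add: abs_mult)
  also have "\<dots> \<le> 24 / N ^ 4 * (N * N) + 6 / N\<^sup>2 * 1"
    using 1 cutoff_base_bounds[of N x] by (intro add_mono mult_left_mono) (auto simp: power_le_one)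
  also have "\<dots> = 30 / N\<^sup>2" using assms by (simp add: power2_eq_square power4_eq_xxxx divide_simps)
  finally show ?thesis .
qed

lemma C_k_2_iff:
  "C_k 2 f \<longleftrightarrow> (\<forall>x. f differentiable (at x)) \<and> (\<forall>i x. pd i f differentiable (at x))
    \<and> (\<forall>i j. continuous_on UNIV (pd j (pd i f)))"
  by (auto simp: numeral_2_eq_2)

lemma C_k_cutoff: "C_k 2 (cutoff N)"
proof -
  have "continuous_on UNIV (pd j (pd i (cutoff N)))" for i j :: 'a
    unfolding pd_pd_cutoff[abs_def] by (intro continuous_intros continuous_cutoff_base)
  then show ?thesis by (auto simp: C_k_2_iff cutoff_differentiable pd_cutoff_differentiable)
qed

lemma cutoff_tendsto: "(\<lambda>j. cutoff (real (Suc j)) x) \<longlonglongrightarrow> 1"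
proof -
  have "(\<lambda>j. inverse (real (Suc j)) * inverse (real (Suc j))) \<longlonglongrightarrow> 0 * 0"
    by (intro tendsto_mult LIMSEQ_inverse_real_of_nat)
  then have "(\<lambda>j. (max 0 (1 - (x \<bullet> x) * (inverse (real (Suc j)) * inverse (real (Suc j))))) ^ 3)
      \<longlonglongrightarrow> (max 0 (1 - (x \<bullet> x) * (0 * 0))) ^ 3"
    by (intro tendsto_power tendsto_max tendsto_diff tendsto_mult_left tendsto_const)
  then show ?thesis
    by (simp add: cutoff_def cutoff_base_def divide_inverse power2_eq_square)
qed

lemma cutoff_mono:
  assumes "0 < M" "M \<le> N" shows "cutoff M x \<le> cutoff N x"
proof -
  have "(x \<bullet> x) / N\<^sup>2 \<le> (x \<bullet> x) / M\<^sup>2" using assms by (intro divide_left_mono power_mono) auto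
  then show ?thesis unfolding cutoff_def cutoff_base_def by (intro power_mono) auto
qed

text \<open>Fatou's lemma. It turns estimates of cutoff integrals with errors \<open>O(1/N)\<close> into bounds over the
whole space.\<close>

lemma nn_integral_le_of_cutoff:
  fixes f :: "real^'n \<Rightarrow> real"
  assumes f: "continuous_on UNIV f" "\<And>x. f x \<ge> 0"
    and le: "\<And>j. (LINT x|lborel. cutoff (real (Suc j)) x * f x) \<le> a j" and a: "a \<longlonglongrightarrow> b"
  shows "(\<integral>\<^sup>+x. ennreal (f x) \<partial>lborel) \<le> ennreal b"
proof -
  have cc: "continuous_on UNIV (cutoff N)" for N :: real
    unfolding cutoff_eq by (intro continuous_intros continuous_cutoff_base)
  have i: "integrable lborel (\<lambda>x. cutoff (real (Suc j)) x * f x)" for j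
    by (rule integrable_compact_support[of _ "real (Suc j)"])
      (auto intro!: continuous_intros cc f simp: cutoff_zero)
  have "(\<integral>\<^sup>+x. ennreal (f x) \<partial>lborel) = (\<integral>\<^sup>+x. liminf (\<lambda>j. ennreal (cutoff (real (Suc j)) x * f x)) \<partial>lborel)"
  proof (intro nn_integral_cong)
    fix x
    have "(\<lambda>j. ennreal (cutoff (real (Suc j)) x * f x)) \<longlonglongrightarrow> ennreal (1 * f x)"
      by (intro tendsto_intros cutoff_tendsto)
    then show "ennreal (f x) = liminf (\<lambda>j. ennreal (cutoff (real (Suc j)) x * f x))"
      using lim_imp_Liminf[OF sequentially_bot] by force
  qed
  also have "\<dots> \<le> liminf (\<lambda>j. \<integral>\<^sup>+x. ennreal (cutoff (real (Suc j)) x * f x) \<partial>lborel)"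
    by (intro nn_integral_liminf) (use i in auto)
  also have "\<dots> = liminf (\<lambda>j. ennreal (LINT x|lborel. cutoff (real (Suc j)) x * f x))"
    using i f(2) cutoff_bounds(1) by (subst nn_integral_eq_integral) (auto intro!: AE_I2 mult_nonneg_nonneg)
  also have "\<dots> \<le> liminf (\<lambda>j. ennreal (a j))"
    by (intro Liminf_mono always_eventually allI ennreal_leI le)
  also have "\<dots> = ennreal b" by (intro lim_imp_Liminf tendsto_intros a) simp
  finally show ?thesis .
qed

text \<open>Its gradient approximates the constant field \<open>e\<^sub>k\<close>. Unlike the cutoff of that field it is a
gradient, and so it does not see the viscous forces of an incompressible flow.\<close>

definition coord_cutoff :: "'n \<Rightarrow> real \<Rightarrow> real^'n \<Rightarrow> real" where
  "coord_cutoff k N x = x $ k * cutoff N x"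

lemma coord_cutoff_zero: "N > 0 \<Longrightarrow> norm x \<ge> N \<Longrightarrow> coord_cutoff k N x = 0"
  by (simp add: coord_cutoff_def cutoff_zero)

lemma pd_coord_cutoff:
  "pd i (coord_cutoff k N) = (\<lambda>x. x $ k * pd i (cutoff N) x + (if i = k then 1 else 0) * cutoff N x)"
  unfolding coord_cutoff_def[abs_def]
  by (auto simp: pd_mult differentiable_coord cutoff_differentiable pd_coord)

lemma pd_pd_coord_cutoff:
  "pd j (pd i (coord_cutoff k N)) x = x $ k * pd j (pd i (cutoff N)) x
    + (if j = k then 1 else 0) * pd i (cutoff N) x + (if i = k then 1 else 0) * pd j (cutoff N) x"
  unfolding pd_coord_cutoff
  by (subst pd_add) (auto simp: pd_mult pd_cmult differentiable_coord cutoff_differentiable pd_cutoff_differentiable pd_coord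
      intro!: derivative_intros)

lemma C_k_coord_cutoff:
  fixes k :: "'n::finite"
  shows "C_k 2 (coord_cutoff k N)"
proof -
  have "coord_cutoff k N differentiable (at x)" for x
    unfolding coord_cutoff_def[abs_def] by (intro derivative_intros differentiable_coord cutoff_differentiable)
  moreover have "pd i (coord_cutoff k N) differentiable (at x)" for i x
    unfolding pd_coord_cutoff
    by (intro derivative_intros differentiable_coord cutoff_differentiable pd_cutoff_differentiable)
  moreover have "continuous_on UNIV (pd j (pd i (coord_cutoff k N)))" for i j
  proof -
    have "continuous_on UNIV (pd j (pd i (cutoff N)))" for i j :: 'n
      using C_k_cutoff[of N, where 'a = 'n] by (simp add: C_k_2_iff)
    moreover have "continuous_on UNIV (pd i (cutoff N))" for i :: 'n
      using pd_cutoff_differentiable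
      by (auto intro!: continuous_at_imp_continuous_on differentiable_imp_continuous_within)
    ultimately show ?thesis unfolding pd_pd_coord_cutoff[abs_def] by (intro continuous_intros)
  qed
  ultimately show ?thesis by (simp add: C_k_2_iff)
qed

lemma abs_pd_coord_cutoff_le:
  fixes x :: "real^'n"
  assumes "N > 0" shows "\<bar>pd i (coord_cutoff k N) x\<bar> \<le> 7"
proof (cases "norm x > N")
  case True
  have "pd i (coord_cutoff k N) x = 0"
    by (rule pd_zero_outside[of N, OF _ True]) (simp add: coord_cutoff_zero assms)
  then show ?thesis by simp
next
  case False
  have "\<bar>x $ k\<bar> * \<bar>pd i (cutoff N) x\<bar> \<le> N * (6 / N)"
    using False component_le_norm_cart[of x k] abs_pd_cutoff_le[OF assms, of i x] by (intro mult_mono) auto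
  moreover have "\<bar>(if i = k then 1 else 0) * cutoff N x\<bar> \<le> 1" using cutoff_bounds[of N x] by auto
  ultimately show ?thesis using assms unfolding pd_coord_cutoff
    by (intro order_trans[OF abs_triangle_ineq]) (auto simp: abs_mult)
qed

lemma abs_pd_pd_coord_cutoff_le:
  fixes x :: "real^'n"
  assumes "N > 0" shows "\<bar>pd j (pd i (coord_cutoff k N)) x\<bar> \<le> 42 / N"
proof (cases "norm x > N")
  case True
  have "pd i (coord_cutoff k N) y = 0" if "norm y > N" for y
    by (rule pd_zero_outside[of N, OF _ that]) (simp add: coord_cutoff_zero assms)
  then have "pd j (pd i (coord_cutoff k N)) x = 0" by (rule pd_zero_outside[of N, OF _ True])
  then show ?thesis using assms by simp
next
  case False
  have "\<bar>x $ k\<bar> * \<bar>pd j (pd i (cutoff N)) x\<bar> \<le> N * (30 / N\<^sup>2)"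
    using False component_le_norm_cart[of x k] abs_pd_pd_cutoff_le[OF assms, of j i x] by (intro mult_mono) auto
  then have "\<bar>x $ k * pd j (pd i (cutoff N)) x\<bar> \<le> 30 / N" using assms by (simp add: abs_mult power2_eq_square)
  moreover have "\<bar>(if j = k then 1 else 0) * pd i (cutoff N) x\<bar> \<le> 6 / N" "\<bar>(if i = k then 1 else 0) * pd j (cutoff N) x\<bar> \<le> 6 / N"
    using abs_pd_cutoff_le[OF assms, of i x] abs_pd_cutoff_le[OF assms, of j x] assms by auto
  moreover have "30 / N + 6 / N + 6 / N = 42 / N" by (simp add: add_divide_distrib[symmetric])
  ultimately show ?thesis unfolding pd_pd_coord_cutoff by linarith
qed

lemma pd_coord_cutoff_tendsto:
  "(\<lambda>j. pd i (coord_cutoff k (real (Suc j))) x) \<longlonglongrightarrow> (if i = k then 1 else 0)"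
proof -
  have "(\<lambda>j. 6 / real (Suc j)) \<longlonglongrightarrow> 0"
    using tendsto_mult[OF tendsto_const[of 6] LIMSEQ_inverse_real_of_nat] by (simp add: divide_inverse)
  then have "(\<lambda>j. pd i (cutoff (real (Suc j))) x) \<longlonglongrightarrow> 0"
    by (rule Lim_null_comparison[rotated]) (auto intro!: always_eventually abs_pd_cutoff_le)
  then have "(\<lambda>j. x $ k * pd i (cutoff (real (Suc j))) x + (if i = k then 1 else 0) * cutoff (real (Suc j)) x)
     \<longlonglongrightarrow> x $ k * 0 + (if i = k then 1 else 0) * 1"
    by (intro tendsto_intros cutoff_tendsto)
  then show ?thesis by (simp add: pd_coord_cutoff)
qed

section \<open>Balance laws tested against cutoffs\<close>

lemma time_dom_infinity: "time_dom \<infinity> = {0..}"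
  by (auto simp: time_dom_def)

lemma at_within_halfline_ne_bot: "t \<ge> 0 \<Longrightarrow> at t within {0..} \<noteq> (bot :: real filter)"
proof -
  assume "t \<ge> 0"
  then have "at_right t \<le> at t within {0..}" by (intro at_le) auto
  then show ?thesis using trivial_limit_at_right_real[of t] by (metis bot.extremum_uniqueI)
qed

lemma has_vector_derivative_dt:
  assumes "C1_t \<infinity> f" "t \<ge> 0"
  shows "((\<lambda>s. f s x) has_vector_derivative dt f t x) (at t within {0..})"
  using assms by (simp add: C1_t_def time_dom_infinity dt_def vector_derivative_works)

lemma dt_eqI:
  assumes "t \<ge> 0" "((\<lambda>s. f s x) has_vector_derivative d) (at t within {0..})"
  shows "dt f t x = d"
  unfolding dt_def using assms by (intro vector_derivative_within at_within_halfline_ne_bot)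

lemma jointly_continuous_slice:
  assumes "jointly_continuous \<infinity> f" "t \<ge> 0"
  shows "continuous_on UNIV (f t)"
proof -
  have "continuous_on UNIV (\<lambda>x. (\<lambda>(s, x). f s x) (t, x))"
    by (rule continuous_on_compose2[where t = "{0..} \<times> UNIV" and f = "\<lambda>x. (t, x)"])
      (use assms in \<open>auto simp: jointly_continuous_def time_dom_infinity intro!: continuous_intros\<close>)
  then show ?thesis by simp
qed

lemma increment_le:
  fixes I I' :: "real \<Rightarrow> real"
  assumes ab: "0 \<le> a" "a \<le> b"
    and I: "\<And>s. a \<le> s \<Longrightarrow> s \<le> b \<Longrightarrow> (I has_vector_derivative I' s) (at s within {0..})"
    and le: "\<And>s. a \<le> s \<Longrightarrow> s \<le> b \<Longrightarrow> I' s \<le> B"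
  shows "I b - I a \<le> B * (b - a)"
proof (cases "a = b")
  case False
  have "\<exists>x\<in>{a<..<b}. I b - I a = (b - a) *\<^sub>R I' x"
    by (rule mvt_simple[where f' = "\<lambda>x h. h *\<^sub>R I' x"])
      (use ab False I in \<open>auto simp: has_vector_derivative_def intro!: has_derivative_subset[where s = "{0..}" and t = "{a..b}"]\<close>)
  then obtain x where "a < x" "x < b" "I b - I a = (b - a) * I' x" by auto
  with le[of x] ab show ?thesis by (simp add: mult.commute mult_right_mono)
qed simp

lemma abs_increment_le:
  fixes I I' :: "real \<Rightarrow> real"
  assumes ab: "0 \<le> a" "a \<le> b"
    and I: "\<And>s. a \<le> s \<Longrightarrow> s \<le> b \<Longrightarrow> (I has_vector_derivative I' s) (at s within {0..})"
    and le: "\<And>s. a \<le> s \<Longrightarrow> s \<le> b \<Longrightarrow> \<bar>I' s\<bar> \<le> B"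
  shows "\<bar>I b - I a\<bar> \<le> B * (b - a)"
proof -
  have "I b - I a \<le> B * (b - a)"
    by (rule increment_le[OF ab I]) (use le in \<open>auto intro: order_trans[OF abs_ge_self]\<close>)
  moreover have "(- I b) - (- I a) \<le> B * (b - a)"
    by (rule increment_le[OF ab has_vector_derivative_minus[OF I]]) (use le in \<open>auto intro: order_trans[OF abs_ge_minus_self]\<close>)
  ultimately show ?thesis by linarith
qed

lemma integrable_mult_L2:
  fixes f g :: "real^'n \<Rightarrow> real"
  assumes "L2_bounded K f" "L2_bounded K g"
  shows "integrable lborel (\<lambda>x. f x * g x)" and "(LINT x|lborel. \<bar>f x * g x\<bar>) \<le> K\<^sup>2"
proof -
  have fg: "integrable lborel (\<lambda>x. (f x)\<^sup>2)" "integrable lborel (\<lambda>x. (g x)\<^sup>2)"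
    "(LINT x|lborel. (f x)\<^sup>2) \<le> K\<^sup>2" "(LINT x|lborel. (g x)\<^sup>2) \<le> K\<^sup>2"
    and m[measurable]: "f \<in> borel_measurable borel" "g \<in> borel_measurable borel"
    using assms by (auto simp: L2_bounded_def)
  have le: "\<bar>f x * g x\<bar> \<le> (f x)\<^sup>2 / 2 + (g x)\<^sup>2 / 2" for x
    using abs_mult_le_weighted_squares[of 1 "f x" "g x"] by simp
  have i: "integrable lborel (\<lambda>x. (f x)\<^sup>2 / 2 + (g x)\<^sup>2 / 2)" using fg by auto
  show fgi: "integrable lborel (\<lambda>x. f x * g x)"
    by (rule Bochner_Integration.integrable_bound[OF i]) (use le in \<open>auto intro!: AE_I2 order_trans[OF le]\<close>)
  have "(LINT x|lborel. \<bar>f x * g x\<bar>) \<le> (LINT x|lborel. (f x)\<^sup>2 / 2 + (g x)\<^sup>2 / 2)"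
    using fgi i le by (intro integral_mono) auto
  also have "\<dots> = (LINT x|lborel. (f x)\<^sup>2) / 2 + (LINT x|lborel. (g x)\<^sup>2) / 2"
    using fg by (subst Bochner_Integration.integral_add) auto
  finally show "(LINT x|lborel. \<bar>f x * g x\<bar>) \<le> K\<^sup>2" using fg by simp
qed

lemma abs_LINT_le_L2:
  fixes f g h :: "real^'n \<Rightarrow> real"
  assumes "L2_bounded K f" "L2_bounded K g" "\<And>x. \<bar>h x\<bar> \<le> c * \<bar>f x * g x\<bar>" "c \<ge> 0"
  shows "\<bar>LINT x|lborel. h x\<bar> \<le> c * K\<^sup>2"
proof -
  have "\<bar>LINT x|lborel. h x\<bar> \<le> (LINT x|lborel. \<bar>h x\<bar>)" by (rule integral_abs_bound)
  also have "\<dots> \<le> (LINT x|lborel. c * \<bar>f x * g x\<bar>)"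
    using integrable_mult_L2(1)[OF assms(1,2)] assms(3,4) by (intro integral_mono') auto
  also have "\<dots> \<le> c * K\<^sup>2"
    using integrable_mult_L2(2)[OF assms(1,2)] assms(4) by (simp add: mult_left_mono)
  finally show ?thesis .
qed

lemma LINT_mult_sum_pd:
  fixes \<psi> :: "real^'n \<Rightarrow> real" and V :: "'n \<Rightarrow> real^'n \<Rightarrow> real"
  assumes \<psi>: "\<And>x. \<psi> differentiable (at x)" "\<And>i. continuous_on UNIV (pd i \<psi>)" "\<And>x. norm x > r \<Longrightarrow> \<psi> x = 0"
    and V: "\<And>i x. V i differentiable (at x)" "\<And>i. continuous_on UNIV (pd i (V i))"
  shows "(LINT x|lborel. \<psi> x * (\<Sum>i\<in>UNIV. pd i (V i) x)) = - (\<Sum>i\<in>UNIV. LINT x|lborel. pd i \<psi> x * V i x)"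
proof -
  have c: "continuous_on UNIV \<psi>"
    using \<psi>(1) by (meson continuous_at_imp_continuous_on differentiable_imp_continuous_within)
  have "(LINT x|lborel. \<psi> x * (\<Sum>i\<in>UNIV. pd i (V i) x)) = (\<Sum>i\<in>UNIV. LINT x|lborel. \<psi> x * pd i (V i) x)"
    unfolding sum_distrib_left
    by (rule Bochner_Integration.integral_sum, rule integrable_compact_support[of _ r])
      (use \<psi>(3) V(2) c in \<open>auto intro!: continuous_intros\<close>)
  also have "\<dots> = (\<Sum>i\<in>UNIV. - (LINT x|lborel. pd i \<psi> x * V i x))"
    by (intro sum.cong refl LINT_by_parts[of _ _ _ r] \<psi> V)
  finally show ?thesis by (simp add: sum_negf)
qed

lemma L2_bounded_of_sobolev: "sobolev_bounded m K f \<Longrightarrow> L2_bounded K f"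
  by (cases m) auto

lemma L2_bounded_mono: "L2_bounded K f \<Longrightarrow> \<bar>K\<bar> \<le> K' \<Longrightarrow> L2_bounded K' f"
  using sobolev_bounded_mono[of 0 K f K'] by simp

lemma C_k_2D:
  fixes f :: "real^'n \<Rightarrow> real"
  assumes "C_k 2 f"
  shows "f differentiable (at x)" "continuous_on UNIV f" "pd i f differentiable (at x)"
    "continuous_on UNIV (pd i f)" "continuous_on UNIV (pd j (pd i f))"
  using assms
  by (auto simp: C_k_2_iff intro!: continuous_at_imp_continuous_on differentiable_imp_continuous_within)

lemma abs_LINT_cutoff_divergence_le:
  fixes V f g :: "'n::finite \<Rightarrow> real^'n \<Rightarrow> real"
  assumes N: "N > 0" and B: "B \<ge> 0"
    and V: "\<And>i x. V i differentiable (at x)" "\<And>i. continuous_on UNIV (pd i (V i))"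
    and L2: "\<And>i. L2_bounded K (f i)" "\<And>i. L2_bounded K (g i)"
    and le: "\<And>i x. \<bar>V i x\<bar> \<le> B * \<bar>f i x * g i x\<bar>"
  shows "\<bar>LINT x|lborel. cutoff N x * (\<Sum>i\<in>UNIV. pd i (V i) x)\<bar> \<le> real CARD('n) * (6 * B * K\<^sup>2) / N"
proof -
  note [simp] = C_k_2D[OF C_k_cutoff]
  have "(LINT x|lborel. cutoff N x * (\<Sum>i\<in>UNIV. pd i (V i) x)) = - (\<Sum>i\<in>UNIV. LINT x|lborel. pd i (cutoff N) x * V i x)"
    by (rule LINT_mult_sum_pd[of _ N]) (use V N in \<open>auto simp: cutoff_zero\<close>)
  also have "\<bar>\<dots>\<bar> \<le> (\<Sum>i\<in>(UNIV::'n set). 6 / N * B * K\<^sup>2)"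
    unfolding abs_minus_cancel
  proof (rule order_trans[OF sum_abs], rule sum_mono, rule abs_LINT_le_L2[OF L2])
    fix i :: 'n and x :: "real^'n"
    have "\<bar>pd i (cutoff N) x * V i x\<bar> \<le> 6 / N * (B * \<bar>f i x * g i x\<bar>)"
      unfolding abs_mult[of "pd i (cutoff N) x"] using abs_pd_cutoff_le[OF N, of i x] le[of i x] N
      by (intro mult_mono) auto
    then show "\<bar>pd i (cutoff N) x * V i x\<bar> \<le> 6 / N * B * \<bar>f i x * g i x\<bar>" by (simp add: mult.assoc)
  qed (use B N in simp)
  finally show ?thesis by simp
qed

text \<open>The common form of the estimates for mass, its square and pressure: a density whose rate of
change is at most minus the divergence of a flux, where the flux is dominated by a product of
two functions bounded in \<open>L\<^sup>2\<close>.\<close>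

lemma cutoff_density_increment_le:
  fixes F Ft :: "real \<Rightarrow> real^'n \<Rightarrow> real" and V f g :: "'n \<Rightarrow> real \<Rightarrow> real^'n \<Rightarrow> real"
  assumes N: "N > 0" and B: "B \<ge> 0" and ab: "0 \<le> a" "a \<le> b"
    and F: "\<And>s x. s \<ge> 0 \<Longrightarrow> ((\<lambda>s. F s x) has_vector_derivative Ft s x) (at s within {0..})"
    and cF: "\<And>s. s \<ge> 0 \<Longrightarrow> continuous_on UNIV (F s)"
    and cFt: "continuous_on ({0..} \<times> UNIV) (\<lambda>z. Ft (fst z) (snd z))"
    and V: "\<And>s i x. s \<ge> 0 \<Longrightarrow> V i s differentiable (at x)" "\<And>s i. s \<ge> 0 \<Longrightarrow> continuous_on UNIV (pd i (V i s))"
    and balance: "\<And>s x. s \<ge> 0 \<Longrightarrow> Ft s x \<le> - (\<Sum>i\<in>UNIV. pd i (V i s) x)"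
    and L2: "\<And>s i. s \<ge> 0 \<Longrightarrow> s \<le> b \<Longrightarrow> L2_bounded K (f i s)" "\<And>s i. s \<ge> 0 \<Longrightarrow> s \<le> b \<Longrightarrow> L2_bounded K (g i s)"
    and le: "\<And>s i x. s \<ge> 0 \<Longrightarrow> s \<le> b \<Longrightarrow> \<bar>V i s x\<bar> \<le> B * \<bar>f i s x * g i s x\<bar>"
  shows "(LINT x|lborel. cutoff N x * F b x) \<le> (LINT x|lborel. cutoff N x * F a x)
    + real CARD('n) * (6 * B * K\<^sup>2) / N * (b - a)"
proof -
  note [simp] = C_k_2D[OF C_k_cutoff]
  have cFt': "continuous_on UNIV (Ft s)" if "s \<ge> 0" for s
  proof -
    have "continuous_on UNIV (\<lambda>x. Ft (fst (s, x)) (snd (s, x)))"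
      by (rule continuous_on_compose2[OF cFt]) (use that in \<open>auto intro!: continuous_intros\<close>)
    then show ?thesis by simp
  qed
  have "(LINT x|lborel. cutoff N x * F b x) - (LINT x|lborel. cutoff N x * F a x)
      \<le> real CARD('n) * (6 * B * K\<^sup>2) / N * (b - a)"
  proof (rule increment_le[OF ab])
    fix s assume "a \<le> s" "s \<le> b"
    with ab have s: "s \<ge> 0" by simp
    show "((\<lambda>s. LINT x|lborel. cutoff N x * F s x) has_vector_derivative (LINT x|lborel. cutoff N x * Ft s x)) (at s within {0..})"
      by (rule has_vector_derivative_LINT_cutoff[of F Ft, where r = N])
        (use F cF cFt N s in \<open>auto simp: cutoff_zero case_prod_beta'\<close>)
    have "(LINT x|lborel. cutoff N x * Ft s x) \<le> (LINT x|lborel. cutoff N x * - (\<Sum>i\<in>UNIV. pd i (V i s) x))"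
      using N s by (intro integral_mono mult_left_mono balance cutoff_bounds integrable_compact_support[of _ N])
        (auto simp: cutoff_zero intro!: continuous_intros cFt' V(2))
    also have "\<dots> = - (LINT x|lborel. cutoff N x * (\<Sum>i\<in>UNIV. pd i (V i s) x))" by simp
    also have "\<dots> \<le> real CARD('n) * (6 * B * K\<^sup>2) / N"
      by (rule order_trans[OF abs_ge_minus_self abs_LINT_cutoff_divergence_le[OF N B V[OF s] L2[OF s \<open>s \<le> b\<close>] le[OF s \<open>s \<le> b\<close>]]])
    finally show "(LINT x|lborel. cutoff N x * Ft s x) \<le> real CARD('n) * (6 * B * K\<^sup>2) / N" .
  qed
  then show ?thesis by simp
qed

lemma LINT_cutoff_le:
  fixes f :: "real^'n \<Rightarrow> real"
  assumes "integrable lborel f" "\<And>x. f x \<ge> 0" "N > 0"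
  shows "(LINT x|lborel. cutoff N x * f x) \<le> (LINT x|lborel. f x)"
  using assms cutoff_bounds[of N] by (intro integral_mono' mult_left_le_one_le) auto

lemma const_div_Suc_tendsto_0: "(\<lambda>j. C / real (Suc j)) \<longlonglongrightarrow> 0"
  using tendsto_mult[OF tendsto_const[of C] LIMSEQ_inverse_real_of_nat] by (simp add: divide_inverse)

lemma integrable_of_nn_integral_le:
  fixes f :: "real^'n \<Rightarrow> real"
  assumes "continuous_on UNIV f" "\<And>x. f x \<ge> 0" "(\<integral>\<^sup>+x. ennreal (f x) \<partial>lborel) \<le> ennreal b" "b \<ge> 0"
  shows "integrable lborel f" "(LINT x|lborel. f x) \<le> b"
proof -
  show i: "integrable lborel f"
    by (rule integrableI_nonneg)
      (use assms borel_measurable_continuous_onI[OF assms(1)] in \<open>auto simp: le_less_trans\<close>)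
  have "ennreal (LINT x|lborel. f x) \<le> ennreal b"
    using assms nn_integral_eq_integral[OF i] by simp
  then show "(LINT x|lborel. f x) \<le> b" using assms(4) by simp
qed

lemma norm_grad_square: "(norm (grad f x))\<^sup>2 = (\<Sum>j\<in>UNIV. (pd j f x)\<^sup>2)"
  unfolding power2_norm_eq_inner inner_vec_def grad_def by (simp add: power2_eq_square)

section \<open>Global incompressible solutions\<close>

text \<open>A solution on \<open>[0,\<infinity>)\<close>. The assumption \<open>bounded\<close> collects what is used of the Sobolev norms
staying finite.\<close>

locale global_solution =
  fixes \<mu> lam k R A \<gamma> c :: real
    and \<rho> p \<theta> S :: "real \<Rightarrow> real^'n \<Rightarrow> real"
    and u :: "real \<Rightarrow> real^'n \<Rightarrow> real^'n"
  assumes mu: "\<mu> > 0" and A: "A > 0" and c: "c > 0"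
    and mass: "mass_eq \<infinity> \<rho> u" and momentum: "momentum_eq \<mu> lam \<infinity> \<rho> u p"
    and state: "state_eqs R A c \<gamma> \<infinity> \<rho> p \<theta> S"
    and classical: "classical k \<infinity> \<rho> u p \<theta>"
    and decay: "decay k \<infinity> \<rho> u p \<theta>"
    and rho_nonneg: "\<And>t x. t \<ge> 0 \<Longrightarrow> \<rho> t x \<ge> 0"
    and entropy: "entropy_nondecreasing \<infinity> \<rho> u S"
    and incompressible: "\<And>t x. t \<ge> 0 \<Longrightarrow> divg (u t) x = 0"
    and bounded: "\<And>t. t \<ge> 0 \<Longrightarrow> \<exists>K>0. \<forall>s\<in>{0..t}. L2_bounded K (\<rho> s) \<and> L2_bounded K (p s)
        \<and> (\<forall>i. L2_bounded K (\<lambda>x. u s x $ i)) \<and> (\<forall>i x. \<bar>u s x $ i\<bar> \<le> K)"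
begin

abbreviation v :: "'n \<Rightarrow> real \<Rightarrow> real^'n \<Rightarrow> real" where "v i t x \<equiv> u t x $ i"

lemma regular_scalar:
  assumes "f = \<rho> \<or> f = p \<or> f = v i"
  shows "C1_t \<infinity> f" "C1_x \<infinity> f"
  using assms classical by (auto simp: classical_def C2_x_def)

lemma regular_velocity_pd: "C1_x \<infinity> (\<lambda>t. pd j (v i t))"
  using classical by (simp add: classical_def C2_x_def)

lemma differentiable_fields:
  assumes "t \<ge> 0"
  shows "\<rho> t differentiable (at x)" "p t differentiable (at x)" "v i t differentiable (at x)"
    "pd j (v i t) differentiable (at x)"
  using assms regular_scalar(2) regular_velocity_pd[of j i] unfolding C1_x_def time_dom_infinity by blast+

lemma jointly_continuous_fields:
  "jointly_continuous \<infinity> \<rho>" "jointly_continuous \<infinity> p" "jointly_continuous \<infinity> (v i)"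
  "jointly_continuous \<infinity> (\<lambda>t. pd j (\<rho> t))" "jointly_continuous \<infinity> (\<lambda>t. pd j (p t))"
  "jointly_continuous \<infinity> (\<lambda>t. pd j (v i t))" "jointly_continuous \<infinity> (\<lambda>t. pd l (pd j (v i t)))"
  "jointly_continuous \<infinity> (dt \<rho>)" "jointly_continuous \<infinity> (dt p)" "jointly_continuous \<infinity> (dt (v i))"
  using regular_scalar regular_velocity_pd[of j i] unfolding C1_x_def C1_t_def by blast+

lemmas continuous_fields = jointly_continuous_fields[THEN jointly_continuous_slice]

lemma jointly_fields:
  "continuous_on ({0..} \<times> UNIV) (\<lambda>z. \<rho> (fst z) (snd z))"
  "continuous_on ({0..} \<times> UNIV) (\<lambda>z. p (fst z) (snd z))"
  "continuous_on ({0..} \<times> UNIV) (\<lambda>z. v i (fst z) (snd z))"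
  "continuous_on ({0..} \<times> UNIV) (\<lambda>z. pd j (v i (fst z)) (snd z))"
  "continuous_on ({0..} \<times> UNIV) (\<lambda>z. dt \<rho> (fst z) (snd z))"
  "continuous_on ({0..} \<times> UNIV) (\<lambda>z. dt p (fst z) (snd z))"
  "continuous_on ({0..} \<times> UNIV) (\<lambda>z. dt (v i) (fst z) (snd z))"
  using jointly_continuous_fields unfolding jointly_continuous_def time_dom_infinity case_prod_beta' by blast+

lemma has_vector_derivative_fields:
  assumes "t \<ge> 0"
  shows "((\<lambda>s. \<rho> s x) has_vector_derivative dt \<rho> t x) (at t within {0..})"
    "((\<lambda>s. p s x) has_vector_derivative dt p t x) (at t within {0..})"
    "((\<lambda>s. v i s x) has_vector_derivative dt (v i) t x) (at t within {0..})"
  using has_vector_derivative_dt[OF _ assms] regular_scalar(1) by blast+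

lemma divergence_free: "t \<ge> 0 \<Longrightarrow> (\<Sum>i\<in>UNIV. pd i (v i t) x) = 0"
  using incompressible by (simp add: divg_def)

lemma mass_conservation:
  assumes "t \<ge> 0" shows "dt \<rho> t x = - (\<Sum>i\<in>UNIV. pd i (\<lambda>y. \<rho> t y * v i t y) x)"
proof -
  have "dt \<rho> t x + divg (\<lambda>y. \<rho> t y *\<^sub>R u t y) x = 0"
    using mass assms by (simp add: mass_eq_def time_dom_infinity)
  then show ?thesis by (simp add: divg_def add_eq_0_iff)
qed

lemma transport:
  assumes "t \<ge> 0" shows "dt \<rho> t x = - (\<Sum>i\<in>UNIV. v i t x * pd i (\<rho> t) x)"
proof -
  have "(\<Sum>i\<in>UNIV. pd i (\<lambda>y. \<rho> t y * v i t y) x)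
      = (\<Sum>i\<in>UNIV. \<rho> t x * pd i (v i t) x + pd i (\<rho> t) x * v i t x)"
    using differentiable_fields[OF assms] by (simp add: pd_mult)
  also have "\<dots> = \<rho> t x * (\<Sum>i\<in>UNIV. pd i (v i t) x) + (\<Sum>i\<in>UNIV. v i t x * pd i (\<rho> t) x)"
    by (simp add: sum.distrib sum_distrib_left mult.commute)
  finally show ?thesis using mass_conservation[OF assms, of x] divergence_free[OF assms] by simp
qed

lemma sum_pd_pd_zero:
  assumes "t \<ge> 0" shows "(\<Sum>i\<in>UNIV. pd i (pd j (v i t)) x) = 0"
proof -
  have "(\<Sum>i\<in>UNIV. pd i (pd j (v i t)) x) = (\<Sum>i\<in>UNIV. pd j (pd i (v i t)) x)"
    using differentiable_fields[OF assms] continuous_fields[OF assms]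
    by (intro sum.cong refl pd_symmetric) auto
  also have "\<dots> = pd j (\<lambda>x. \<Sum>i\<in>UNIV. pd i (v i t) x) x"
    using differentiable_fields[OF assms] by (subst pd_sum) auto
  also have "\<dots> = 0" using divergence_free[OF assms] by simp
  finally show ?thesis .
qed

text \<open>By symmetry of second derivatives, the transposed part of the stress contributes the gradient
of the divergence.\<close>

lemma div_stress:
  assumes "t \<ge> 0"
  shows "(\<Sum>j\<in>UNIV. pd j (stress \<mu> lam (u t) i j) x) = \<mu> * (\<Sum>j\<in>UNIV. pd j (pd j (v i t)) x)"
proof -
  have "pd j (stress \<mu> lam (u t) i j) x = \<mu> * pd j (pd i (v j t)) x + \<mu> * pd j (pd j (v i t)) x" for j
  proof -
    have "stress \<mu> lam (u t) i j = (\<lambda>x. \<mu> * pd i (v j t) x + \<mu> * pd j (v i t) x)"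
      using incompressible[OF assms] by (auto simp: stress_def fun_eq_iff distrib_left)
    then show ?thesis using differentiable_fields[OF assms]
      by (simp add: pd_add pd_cmult)
  qed
  then have "(\<Sum>j\<in>UNIV. pd j (stress \<mu> lam (u t) i j) x)
      = \<mu> * (\<Sum>j\<in>UNIV. pd j (pd i (v j t)) x) + \<mu> * (\<Sum>j\<in>UNIV. pd j (pd j (v i t)) x)"
    by (simp add: sum.distrib sum_distrib_left)
  then show ?thesis using sum_pd_pd_zero[OF assms] by simp
qed

lemma momentum_conservation:
  assumes "t \<ge> 0"
  shows "dt \<rho> t x * v i t x + \<rho> t x * dt (v i) t x
    = - (\<Sum>j\<in>UNIV. pd j (\<lambda>y. \<rho> t y * v i t y * v j t y) x) - pd i (p t) x
      + \<mu> * (\<Sum>j\<in>UNIV. pd j (pd j (v i t)) x)"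
proof -
  have "((\<lambda>s. \<rho> s x * v i s x) has_vector_derivative \<rho> t x * dt (v i) t x + dt \<rho> t x * v i t x) (at t within {0..})"
    using has_vector_derivative_fields[OF assms] by (intro has_vector_derivative_mult) auto
  then have "dt (\<lambda>s y. \<rho> s y * v i s y) t x = \<rho> t x * dt (v i) t x + dt \<rho> t x * v i t x"
    by (rule dt_eqI[OF assms])
  moreover have "dt (\<lambda>s y. \<rho> s y * v i s y) t x
      + (\<Sum>j\<in>UNIV. pd j (\<lambda>y. \<rho> t y * v i t y * v j t y) x) + pd i (p t) x
      = \<mu> * (\<Sum>j\<in>UNIV. pd j (pd j (v i t)) x)"
    using momentum assms div_stress[OF assms] by (simp add: momentum_eq_def time_dom_infinity)
  ultimately show ?thesis by linarith
qed

lemma momentum_transport: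
  assumes "t \<ge> 0"
  shows "\<rho> t x * dt (v i) t x = - (\<Sum>j\<in>UNIV. \<rho> t x * v j t x * pd j (v i t) x) - pd i (p t) x
      + \<mu> * (\<Sum>j\<in>UNIV. pd j (pd j (v i t)) x)"
proof -
  have "pd j (\<lambda>y. \<rho> t y * v i t y * v j t y) x
      = v i t x * pd j (\<lambda>y. \<rho> t y * v j t y) x + \<rho> t x * v j t x * pd j (v i t) x" for j
  proof -
    have "pd j (\<lambda>y. \<rho> t y * v i t y * v j t y) x = pd j (\<lambda>y. v i t y * (\<rho> t y * v j t y)) x"
      by (simp add: mult_ac)
    also have "\<dots> = v i t x * pd j (\<lambda>y. \<rho> t y * v j t y) x + pd j (v i t) x * (\<rho> t x * v j t x)"
      using differentiable_fields[OF assms] by (intro pd_mult) (auto intro!: derivative_intros)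
    finally show ?thesis by simp
  qed
  then have "(\<Sum>j\<in>UNIV. pd j (\<lambda>y. \<rho> t y * v i t y * v j t y) x)
      = v i t x * (- dt \<rho> t x) + (\<Sum>j\<in>UNIV. \<rho> t x * v j t x * pd j (v i t) x)"
    unfolding mass_conservation[OF assms] by (simp add: sum.distrib sum_distrib_left)
  with momentum_conservation[OF assms, of x i] show ?thesis by (simp add: algebra_simps)
qed

lemma pressure_eq_entropy: "t \<ge> 0 \<Longrightarrow> p t x = A * exp (S t x / c) * \<rho> t x powr \<gamma>"
  using state unfolding state_eqs_def time_dom_infinity by blast

lemma pressure_nonneg: "t \<ge> 0 \<Longrightarrow> p t x \<ge> 0"
  using pressure_eq_entropy[of t x] A by simp

text \<open>Where \<open>\<rho> > 0\<close>, the entropy is \<open>c\<close> times the logarithm of \<open>p / (A \<rho>\<^sup>\<gamma>)\<close>, and \<open>\<rho>\<close> is transported.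
Where \<open>\<rho> = 0\<close>, the pressure attains its minimum \<open>0\<close>, so its gradient vanishes and its time
derivative, which is a limit from the right, is nonnegative.\<close>

lemma pressure_transport_nonneg:
  assumes "t \<ge> 0"
  shows "dt p t x + (\<Sum>i\<in>UNIV. v i t x * pd i (p t) x) \<ge> 0"
proof (cases "\<rho> t x = 0")
  case True
  then have p0: "p t x = 0" using pressure_eq_entropy[OF assms] by simp
  have "pd i (p t) x = 0" for i
  proof -
    have "((\<lambda>h. p t (x + h *\<^sub>R axis i 1)) has_real_derivative pd i (p t) x) (at 0)"
      using pd_has_derivative_line[of "p t" x 0 "axis i 1"] differentiable_fields(2)[OF assms] by (simp add: axis_inner_grad)
    then show ?thesis
      by (rule DERIV_local_min[of _ _ _ 1]) (use pressure_nonneg[OF assms] p0 in auto)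
  qed
  moreover have "dt p t x \<ge> 0"
  proof -
    have "((\<lambda>s. p s x) has_vector_derivative dt p t x) (at t within {t..})"
      by (rule has_vector_derivative_within_subset[OF has_vector_derivative_fields(2)[OF assms]]) (use assms in auto)
    then have "((\<lambda>s. p s x) has_real_derivative dt p t x) (at t within {t..})"
      by (simp add: has_real_derivative_iff_has_vector_derivative)
    then have "((\<lambda>s. (p s x - p t x) / (s - t)) \<longlongrightarrow> dt p t x) (at t within {t..})"
      by (simp add: has_field_derivative_iff)
    moreover have "\<forall>\<^sub>F s in at t within {t..}. 0 \<le> (p s x - p t x) / (s - t)"
      using assms pressure_nonneg p0 by (auto simp: eventually_at intro!: exI[of _ 1] divide_nonneg_nonneg)
    moreover have "at t within {t..} \<noteq> bot"
      by (simp add: at_within_Ici_at_right)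
    ultimately show ?thesis by (rule tendsto_lowerbound)
  qed
  ultimately show ?thesis by simp
next
  case False
  then have pos: "\<rho> t x > 0" using rho_nonneg[OF assms, of x] by simp
  have S_eq: "S s y = c * (ln (p s y) - ln A - \<gamma> * ln (\<rho> s y))" and p_pos: "p s y > 0"
    if "s \<ge> 0" "\<rho> s y > 0" for s y
  proof -
    have "p s y = A * exp (S s y / c) * \<rho> s y powr \<gamma>"
      using that by (intro pressure_eq_entropy)
    then show "p s y > 0" "S s y = c * (ln (p s y) - ln A - \<gamma> * ln (\<rho> s y))"
      using A c that by (auto simp: ln_mult ln_powr)
  qed
  have "pd i (S t) x = c * (pd i (p t) x / p t x - \<gamma> * (pd i (\<rho> t) x / \<rho> t x))" for i
  proof -
    have "open {y. \<rho> t y > 0}" by (intro open_Collect_less continuous_fields[OF assms] continuous_intros)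
    then have "pd i (S t) x = pd i (\<lambda>y. c * (ln (p t y) - ln A - \<gamma> * ln (\<rho> t y))) x"
      by (rule pd_cong_open) (use pos S_eq[OF assms] in auto)
    also have "\<dots> = c * ((axis i 1 \<bullet> grad (p t) x) / p t x - \<gamma> * ((axis i 1 \<bullet> grad (\<rho> t) x) / \<rho> t x))"
      by (rule pd_eq) (use pos p_pos[OF assms pos] in \<open>auto intro!: derivative_eq_intros
          has_derivative_grad differentiable_fields[OF assms] simp: divide_inverse\<close>)
    finally show ?thesis by (simp add: axis_inner_grad)
  qed
  moreover have "dt S t x = c * (dt p t x / p t x - \<gamma> * (dt \<rho> t x / \<rho> t x))"
  proof (rule dt_eqI[OF assms])
    have "continuous (at t within {0..}) (\<lambda>s. \<rho> s x)"
      using has_vector_derivative_fields(1)[OF assms] by (rule has_vector_derivative_continuous)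
    then have "\<forall>\<^sub>F s in at t within {0..}. \<rho> s x > 0"
      using pos by (intro order_tendstoD(1)) (auto simp: continuous_within)
    then obtain d where d: "d > 0" "\<And>s. s \<in> {0..} \<Longrightarrow> dist s t < d \<Longrightarrow> s \<noteq> t \<Longrightarrow> \<rho> s x > 0"
      by (auto simp: eventually_at)
    have r: "((\<lambda>s. \<rho> s x) has_real_derivative dt \<rho> t x) (at t within {0..})"
      "((\<lambda>s. p s x) has_real_derivative dt p t x) (at t within {0..})"
      using has_vector_derivative_fields[OF assms] by (simp_all add: has_real_derivative_iff_has_vector_derivative)
    have "((\<lambda>s. c * (ln (p s x) - ln A - \<gamma> * ln (\<rho> s x))) has_real_derivative
        c * (dt p t x / p t x - \<gamma> * (dt \<rho> t x / \<rho> t x))) (at t within {0..})"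
      using pos p_pos[OF assms pos] by (auto intro!: derivative_eq_intros r simp: divide_inverse)
    then have "((\<lambda>s. c * (ln (p s x) - ln A - \<gamma> * ln (\<rho> s x))) has_vector_derivative
        c * (dt p t x / p t x - \<gamma> * (dt \<rho> t x / \<rho> t x))) (at t within {0..})"
      by (simp add: has_real_derivative_iff_has_vector_derivative)
    then show "((\<lambda>s. S s x) has_vector_derivative c * (dt p t x / p t x - \<gamma> * (dt \<rho> t x / \<rho> t x))) (at t within {0..})"
      by (rule has_vector_derivative_transform_within[OF _ d(1)])
        (use assms pos d S_eq in \<open>auto, metis\<close>)
  qed
  moreover have "dt S t x + (\<Sum>i\<in>UNIV. v i t x * pd i (S t) x) \<ge> 0"
    using entropy assms pos by (simp add: entropy_nondecreasing_def time_dom_infinity advect_def)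
  ultimately have "0 \<le> c * (dt p t x / p t x - \<gamma> * (dt \<rho> t x / \<rho> t x))
      + (\<Sum>i\<in>UNIV. v i t x * (c * (pd i (p t) x / p t x - \<gamma> * (pd i (\<rho> t) x / \<rho> t x))))" by simp
  also have "\<dots> = c / p t x * (dt p t x + (\<Sum>i\<in>UNIV. v i t x * pd i (p t) x))
      - c * \<gamma> / \<rho> t x * (dt \<rho> t x + (\<Sum>i\<in>UNIV. v i t x * pd i (\<rho> t) x))"
    by (simp add: algebra_simps sum.distrib sum_distrib_left sum_subtractf)
  also have "\<dots> = c / p t x * (dt p t x + (\<Sum>i\<in>UNIV. v i t x * pd i (p t) x))"
    using transport[OF assms, of x] by simp
  finally show ?thesis using c p_pos[OF assms pos] by (simp add: zero_le_mult_iff zero_le_divide_iff)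
qed

subsection \<open>Mass and pressure\<close>

lemma continuous_velocity: "t \<ge> 0 \<Longrightarrow> continuous_on UNIV (u t)"
  using continuous_on_vec_lambda[of UNIV "\<lambda>i. v i t"] continuous_fields(3) by simp

lemma jointly_continuous_velocity: "continuous_on ({0..} \<times> UNIV) (\<lambda>z. u (fst z) (snd z))"
  using continuous_on_vec_lambda[of _ "\<lambda>i z. v i (fst z) (snd z)"] jointly_fields(3) by simp

definition uniform_bounds :: "real \<Rightarrow> real \<Rightarrow> bool" where
  "uniform_bounds K t \<longleftrightarrow> K > 0 \<and> (\<forall>s\<in>{0..t}. L2_bounded K (\<rho> s) \<and> L2_bounded K (p s)
    \<and> (\<forall>i. L2_bounded K (v i s)) \<and> (\<forall>i x. \<bar>v i s x\<bar> \<le> K))"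

lemma uniform_boundsD:
  assumes "uniform_bounds K t"
  shows "K > 0" "\<And>s. 0 \<le> s \<Longrightarrow> s \<le> t \<Longrightarrow> L2_bounded K (\<rho> s)"
    "\<And>s. 0 \<le> s \<Longrightarrow> s \<le> t \<Longrightarrow> L2_bounded K (p s)"
    "\<And>s i. 0 \<le> s \<Longrightarrow> s \<le> t \<Longrightarrow> L2_bounded K (v i s)"
    "\<And>s i x. 0 \<le> s \<Longrightarrow> s \<le> t \<Longrightarrow> \<bar>v i s x\<bar> \<le> K"
  using assms by (auto simp: uniform_bounds_def)

lemma bounds: "t \<ge> 0 \<Longrightarrow> \<exists>K. uniform_bounds K t"
  using bounded[of t] unfolding uniform_bounds_def by blast

lemma integrable_initial_density: "integrable lborel (\<rho> 0)"
proof -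
  obtain e where e: "e > 0" "\<rho> 0 \<in> O[at_infinity](\<lambda>x. norm x powr - (real CARD('n) + 2 + e))"
  proof -
    have "(0::real) \<in> {0..}" by simp
    then show ?thesis using decay that unfolding decay_def Let_def time_dom_infinity by blast
  qed
  show ?thesis
    by (rule integrable_of_decay[of _ "2 + e"])
      (use e continuous_fields(1)[of 0] in \<open>auto simp: add.assoc\<close>)
qed

lemma integrable_pressure:
  assumes "t \<ge> 0" shows "integrable lborel (p t)"
proof -
  obtain e where e: "e > 0" "p t \<in> O[at_infinity](\<lambda>x. norm x powr - (real CARD('n) + e))"
  proof -
    have "t \<in> {0..}" using assms by simp
    then show ?thesis using decay that unfolding decay_def Let_def time_dom_infinity by blast
  qed
  show ?thesis by (rule integrable_of_decay[OF _ e]) (rule continuous_fields(2)[OF assms])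
qed

lemma velocity_tendsto_0:
  assumes t: "t \<ge> 0" and dim: "CARD('n) \<ge> 2" shows "(v i t \<longlongrightarrow> 0) at_infinity"
proof -
  have "(\<lambda>x. norm (u t x)) \<in> o[at_infinity](\<lambda>x. norm x powr - (real CARD('n) - 1))"
    using decay t by (auto simp: decay_def Let_def time_dom_infinity)
  then have "\<forall>\<^sub>F x in at_infinity. norm (norm (u t x)) \<le> 1 * norm (norm x powr - (real CARD('n) - 1))"
    by (rule landau_o.smallD) simp
  moreover have "\<forall>\<^sub>F x in at_infinity. norm (x::real^'n) \<ge> 1" by (auto simp: eventually_at_infinity)
  ultimately have "\<forall>\<^sub>F x in at_infinity. norm (v i t x) \<le> inverse (norm x)"
  proof eventually_elim
    case (elim x)
    have "norm (v i t x) \<le> norm (u t x)" using component_le_norm_cart[of "u t x" i] by simp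
    also have "\<dots> \<le> norm x powr - (real CARD('n) - 1)" using elim by simp
    also have "\<dots> \<le> norm x powr - 1" using elim dim by (intro powr_mono) auto
    also have "\<dots> = inverse (norm x)" using elim by (simp add: powr_minus)
    finally show ?case .
  qed
  moreover have "((\<lambda>x::real^'n. inverse (norm x)) \<longlongrightarrow> 0) at_infinity"
    by (rule tendsto_inverse_0_at_top[OF filterlim_norm_at_top])
  ultimately show ?thesis by (rule Lim_null_comparison)
qed

lemma density_bound:
  assumes "t \<ge> 0"
  shows "(\<integral>\<^sup>+x. ennreal (\<rho> t x) \<partial>lborel) \<le> ennreal (LINT x|lborel. \<rho> 0 x)"
proof -
  obtain K where "uniform_bounds K t" using bounds[OF assms] by blast
  note K = uniform_boundsD[OF this]
  let ?C = "real CARD('n) * (6 * 1 * K\<^sup>2) * (t - 0)"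
  show ?thesis
  proof (rule nn_integral_le_of_cutoff)
    fix j
    let ?N = "real (Suc j)"
    have "(LINT x|lborel. cutoff ?N x * \<rho> t x) \<le> (LINT x|lborel. cutoff ?N x * \<rho> 0 x)
        + real CARD('n) * (6 * 1 * K\<^sup>2) / ?N * (t - 0)"
    proof (rule cutoff_density_increment_le[where F = \<rho> and Ft = "dt \<rho>" and f = "\<lambda>i. \<rho>" and g = v
          and V = "\<lambda>i s y. \<rho> s y * v i s y"])
      show "continuous_on UNIV (pd i (\<lambda>y. \<rho> s y * v i s y))" if "s \<ge> 0" for i s
      proof -
        have "pd i (\<lambda>y. \<rho> s y * v i s y) = (\<lambda>x. \<rho> s x * pd i (v i s) x + pd i (\<rho> s) x * v i s x)"
          using differentiable_fields[OF that] by (auto simp: pd_mult)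
        then show ?thesis using continuous_fields[OF that] continuous_velocity[OF that] by (auto intro!: continuous_intros)
      qed
    qed (use assms K has_vector_derivative_fields continuous_fields jointly_fields differentiable_fields mass_conservation
        in \<open>auto intro!: derivative_intros\<close>)
    also have "(LINT x|lborel. cutoff ?N x * \<rho> 0 x) \<le> (LINT x|lborel. \<rho> 0 x)"
      using integrable_initial_density rho_nonneg[of 0] by (intro LINT_cutoff_le) auto
    finally show "(LINT x|lborel. cutoff ?N x * \<rho> t x) \<le> (LINT x|lborel. \<rho> 0 x) + ?C / ?N" by simp
  next
    show "(\<lambda>j. (LINT x|lborel. \<rho> 0 x) + ?C / real (Suc j)) \<longlonglongrightarrow> (LINT x|lborel. \<rho> 0 x)"
      using tendsto_add[OF tendsto_const const_div_Suc_tendsto_0] by fastforce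
  qed (use continuous_fields rho_nonneg assms in auto)
qed

lemma density_square_bound:
  assumes "t \<ge> 0"
  shows "(\<integral>\<^sup>+x. ennreal ((\<rho> t x)\<^sup>2) \<partial>lborel) \<le> ennreal (LINT x|lborel. (\<rho> 0 x)\<^sup>2)"
proof -
  obtain K where "uniform_bounds K t" using bounds[OF assms] by blast
  note K = uniform_boundsD[OF this]
  let ?C = "real CARD('n) * (6 * K * K\<^sup>2) * (t - 0)"
  show ?thesis
  proof (rule nn_integral_le_of_cutoff)
    fix j
    let ?N = "real (Suc j)"
    have pd: "pd i (\<lambda>y. (\<rho> s y)\<^sup>2 * v i s y) x = (\<rho> s x)\<^sup>2 * pd i (v i s) x + 2 * \<rho> s x * pd i (\<rho> s) x * v i s x"
      if "s \<ge> 0" for i s x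
      using differentiable_fields[OF that] unfolding power2_eq_square by (simp add: pd_mult)
    have "(LINT x|lborel. cutoff ?N x * (\<rho> t x)\<^sup>2) \<le> (LINT x|lborel. cutoff ?N x * (\<rho> 0 x)\<^sup>2)
        + real CARD('n) * (6 * K * K\<^sup>2) / ?N * (t - 0)"
    proof (rule cutoff_density_increment_le[where F = "\<lambda>s x. (\<rho> s x)\<^sup>2" and Ft = "\<lambda>s x. 2 * \<rho> s x * dt \<rho> s x"
          and f = "\<lambda>i. \<rho>" and g = "\<lambda>i. \<rho>" and V = "\<lambda>i s y. (\<rho> s y)\<^sup>2 * v i s y"])
      show "continuous_on UNIV (pd i (\<lambda>y. (\<rho> s y)\<^sup>2 * v i s y))" if "s \<ge> 0" for i s
        unfolding pd[OF that, abs_def] using continuous_fields[OF that] continuous_velocity[OF that] by (auto intro!: continuous_intros)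
      show "((\<lambda>s. (\<rho> s x)\<^sup>2) has_vector_derivative 2 * \<rho> s x * dt \<rho> s x) (at s within {0..})" if "s \<ge> 0" for s x
        using has_vector_derivative_mult[OF has_vector_derivative_fields(1)[OF that, of x] has_vector_derivative_fields(1)[OF that, of x]]
        by (simp add: power2_eq_square mult_ac)
      show "2 * \<rho> s x * dt \<rho> s x \<le> - (\<Sum>i\<in>UNIV. pd i (\<lambda>y. (\<rho> s y)\<^sup>2 * v i s y) x)" if s: "s \<ge> 0" for s x
      proof -
        have "(\<Sum>i\<in>UNIV. pd i (\<lambda>y. (\<rho> s y)\<^sup>2 * v i s y) x)
            = (\<rho> s x)\<^sup>2 * (\<Sum>i\<in>UNIV. pd i (v i s) x) + 2 * \<rho> s x * (\<Sum>i\<in>UNIV. v i s x * pd i (\<rho> s) x)"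
          unfolding pd[OF s] by (simp add: sum.distrib sum_distrib_left mult_ac)
        then show ?thesis using transport[OF s] divergence_free[OF s] by simp
      qed
      show "\<bar>(\<rho> s x)\<^sup>2 * v i s x\<bar> \<le> K * \<bar>\<rho> s x * \<rho> s x\<bar>" if "0 \<le> s" "s \<le> t" for s i x
        using mult_left_mono[OF K(5)[OF that, where i = i and x = x], of "\<bar>\<rho> s x * \<rho> s x\<bar>"] by (simp add: power2_eq_square abs_mult mult.commute)
    qed (use assms K continuous_fields jointly_fields differentiable_fields
        in \<open>auto intro!: derivative_intros continuous_intros\<close>)
    also have "(LINT x|lborel. cutoff ?N x * (\<rho> 0 x)\<^sup>2) \<le> (LINT x|lborel. (\<rho> 0 x)\<^sup>2)"
      using K(2)[of 0] assms by (intro LINT_cutoff_le) (auto simp: L2_bounded_def)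
    finally show "(LINT x|lborel. cutoff ?N x * (\<rho> t x)\<^sup>2) \<le> (LINT x|lborel. (\<rho> 0 x)\<^sup>2) + ?C / ?N" by simp
  next
    show "(\<lambda>j. (LINT x|lborel. (\<rho> 0 x)\<^sup>2) + ?C / real (Suc j)) \<longlonglongrightarrow> (LINT x|lborel. (\<rho> 0 x)\<^sup>2)"
      using tendsto_add[OF tendsto_const const_div_Suc_tendsto_0] by fastforce
  qed (use continuous_fields assms in \<open>auto intro!: continuous_intros\<close>)
qed

text \<open>The pressure grows along trajectories, so its integral is dominated by the one at a later time.
This supplies the uniformity in time that the decay at each fixed time lacks.\<close>

lemma pressure_bound:
  assumes "0 \<le> s" "s \<le> t"
  shows "(LINT x|lborel. p s x) \<le> (LINT x|lborel. p t x)"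
proof -
  have t: "t \<ge> 0" using assms by simp
  obtain K where "uniform_bounds K t" using bounds[OF t] by blast
  note K = uniform_boundsD[OF this]
  let ?C = "real CARD('n) * (6 * 1 * K\<^sup>2) * (t - s)"
  have "(\<integral>\<^sup>+x. ennreal (p s x) \<partial>lborel) \<le> ennreal (LINT x|lborel. p t x)"
  proof (rule nn_integral_le_of_cutoff)
    fix j
    let ?N = "real (Suc j)"
    have pd: "pd i (\<lambda>y. - (p s y * v i s y)) x = - (p s x * pd i (v i s) x + pd i (p s) x * v i s x)"
      if "s \<ge> 0" for i s x
    proof -
      have "pd i (\<lambda>y. (- 1) * (p s y * v i s y)) x = - 1 * pd i (\<lambda>y. p s y * v i s y) x"
        by (rule pd_cmult) (use differentiable_fields[OF that] in \<open>auto intro!: derivative_intros\<close>)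
      then show ?thesis using differentiable_fields[OF that] by (simp add: pd_mult)
    qed
    have "(LINT x|lborel. cutoff ?N x * - p t x) \<le> (LINT x|lborel. cutoff ?N x * - p s x)
        + real CARD('n) * (6 * 1 * K\<^sup>2) / ?N * (t - s)"
    proof (rule cutoff_density_increment_le[where F = "\<lambda>s x. - p s x" and Ft = "\<lambda>s x. - dt p s x" and f = "\<lambda>i. p" and g = v
          and V = "\<lambda>i s y. - (p s y * v i s y)"])
      show "continuous_on UNIV (pd i (\<lambda>y. - (p s y * v i s y)))" if "s \<ge> 0" for i s
        unfolding pd[OF that, abs_def] using continuous_fields[OF that] continuous_velocity[OF that] by (auto intro!: continuous_intros)
      show "- dt p s x \<le> - (\<Sum>i\<in>UNIV. pd i (\<lambda>y. - (p s y * v i s y)) x)" if s: "s \<ge> 0" for s x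
      proof -
        have "(\<Sum>i\<in>UNIV. pd i (\<lambda>y. - (p s y * v i s y)) x)
            = - (p s x * (\<Sum>i\<in>UNIV. pd i (v i s) x)) - (\<Sum>i\<in>UNIV. v i s x * pd i (p s) x)"
          unfolding pd[OF s] by (simp add: sum.distrib sum_distrib_left sum_subtractf sum_negf mult_ac)
        then show ?thesis using pressure_transport_nonneg[OF s, of x] divergence_free[OF s] by simp
      qed
    qed (use assms K has_vector_derivative_fields continuous_fields jointly_fields differentiable_fields
        in \<open>auto intro!: derivative_intros continuous_intros has_vector_derivative_minus\<close>)
    then have "(LINT x|lborel. cutoff ?N x * p s x) \<le> (LINT x|lborel. cutoff ?N x * p t x) + ?C / ?N" by simp
    also have "(LINT x|lborel. cutoff ?N x * p t x) \<le> (LINT x|lborel. p t x)"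
      using integrable_pressure[OF t] pressure_nonneg[OF t] by (intro LINT_cutoff_le) auto
    finally show "(LINT x|lborel. cutoff ?N x * p s x) \<le> (LINT x|lborel. p t x) + ?C / ?N" by simp
  next
    show "(\<lambda>j. (LINT x|lborel. p t x) + ?C / real (Suc j)) \<longlonglongrightarrow> (LINT x|lborel. p t x)"
      using tendsto_add[OF tendsto_const const_div_Suc_tendsto_0] by fastforce
  qed (use continuous_fields pressure_nonneg assms in auto)
  then show ?thesis
    by (intro integrable_of_nn_integral_le(2)) (use continuous_fields pressure_nonneg assms t in auto)
qed

subsection \<open>Momentum\<close>

text \<open>After integration by parts the viscous flux is the sum of the integrals of
\<open>\<partial>\<^sub>j\<partial>\<^sub>i\<chi> \<partial>\<^sub>jv\<^sub>i\<close>. Exchanging the derivatives of \<open>\<chi>\<close> and integrating by parts once more puts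
the divergence of \<open>u\<close> under the integral, so this sum is zero. The second derivatives of \<open>\<chi>\<close> in
the other terms are \<open>O(1/N)\<close>.\<close>

lemma momentum_flux_le:
  assumes N: "N > 0" and t: "t \<ge> 0" and K: "K > 0" "L2_bounded K (\<rho> t)"
    "\<And>i. L2_bounded K (v i t)" "\<And>i x. \<bar>v i t x\<bar> \<le> K"
  shows "\<bar>\<Sum>i\<in>UNIV. LINT x|lborel. pd i (coord_cutoff a N) x * (dt \<rho> t x * v i t x + \<rho> t x * dt (v i) t x)\<bar>
    \<le> (real CARD('n))\<^sup>2 * (42 * (K * K\<^sup>2 + (LINT x|lborel. p t x))) / N"
proof -
  let ?\<chi> = "coord_cutoff a N"
  note chi = C_k_2D[OF C_k_coord_cutoff[of a N]]
  note d = differentiable_fields[OF t] and cf = continuous_fields[OF t] continuous_velocity[OF t]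
  have supp1: "pd i ?\<chi> x = 0" if "norm x > N" for i x
    by (rule pd_zero_outside[OF _ that]) (simp add: coord_cutoff_zero N)
  have supp2: "pd j (pd i ?\<chi>) x = 0" if "norm x > N" for i j x
    by (rule pd_zero_outside[OF supp1 that])
  \<comment> \<open>The inviscid part of the momentum flux.\<close>
  define W where "W i j y = \<rho> t y * v i t y * v j t y + (if j = i then 1 else 0) * p t y" for i j y
  have dW: "W i j differentiable (at x)" for i j x
    unfolding W_def[abs_def] using d by (auto intro!: derivative_intros)
  have pd3: "pd l (\<lambda>y. \<rho> t y * v i t y * v j t y) x
      = \<rho> t x * v i t x * pd l (v j t) x + (\<rho> t x * pd l (v i t) x + pd l (\<rho> t) x * v i t x) * v j t x" for l i j x
    using d by (simp add: pd_mult)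
  have pdW: "pd l (W i j) x = pd l (\<lambda>y. \<rho> t y * v i t y * v j t y) x + (if j = i then 1 else 0) * pd l (p t) x" for l i j x
    unfolding W_def[abs_def] using d by (subst pd_add) (auto simp: pd_cmult intro!: derivative_intros)
  have cpdW: "continuous_on UNIV (pd l (W i j))" for l i j
    unfolding pdW[abs_def] pd3 using cf by (auto intro!: continuous_intros)
  have cW: "continuous_on UNIV (W i j)" for i j
    unfolding W_def[abs_def] using cf by (auto intro!: continuous_intros)
  let ?V = "\<lambda>i j y. W i j y + (- \<mu>) * pd j (v i t) y"
  have pdV: "pd j (?V i j) x = pd j (W i j) x + (- \<mu>) * pd j (pd j (v i t)) x" for i j x
  proof -
    have "pd j (?V i j) x = pd j (W i j) x + pd j (\<lambda>y. (- \<mu>) * pd j (v i t) y) x"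
      by (rule pd_add) (use dW d in \<open>auto intro!: derivative_intros\<close>)
    moreover have "pd j (\<lambda>y. (- \<mu>) * pd j (v i t) y) x = (- \<mu>) * pd j (pd j (v i t)) x"
      by (rule pd_cmult) (rule d)
    ultimately show ?thesis by simp
  qed
  have step: "(LINT x|lborel. pd i ?\<chi> x * (dt \<rho> t x * v i t x + \<rho> t x * dt (v i) t x))
      = (\<Sum>j\<in>UNIV. LINT x|lborel. pd j (pd i ?\<chi>) x * W i j x)
        - \<mu> * (\<Sum>j\<in>UNIV. LINT x|lborel. pd j (pd i ?\<chi>) x * pd j (v i t) x)" for i
  proof -
    have eq: "dt \<rho> t x * v i t x + \<rho> t x * dt (v i) t x = - (\<Sum>j\<in>UNIV. pd j (?V i j) x)" for x
    proof -
      have "(\<Sum>j\<in>UNIV. pd j (?V i j) x) = (\<Sum>j\<in>UNIV. pd j (\<lambda>y. \<rho> t y * v i t y * v j t y) x)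
          + (\<Sum>j\<in>UNIV. (if j = i then 1 else 0) * pd j (p t) x) - \<mu> * (\<Sum>j\<in>UNIV. pd j (pd j (v i t)) x)"
        unfolding pdV pdW by (simp add: sum.distrib sum_subtractf sum_distrib_left)
      also have "(\<Sum>j\<in>UNIV. (if j = i then 1 else 0) * pd j (p t) x) = pd i (p t) x"
        by (simp add: if_distrib[of "\<lambda>z. z * _"] cong: if_cong)
      finally show ?thesis using momentum_conservation[OF t, of x i] by simp
    qed
    have "(LINT x|lborel. pd i ?\<chi> x * (dt \<rho> t x * v i t x + \<rho> t x * dt (v i) t x))
        = - (LINT x|lborel. pd i ?\<chi> x * (\<Sum>j\<in>UNIV. pd j (?V i j) x))"
      unfolding eq by simp
    also have "\<dots> = (\<Sum>j\<in>UNIV. LINT x|lborel. pd j (pd i ?\<chi>) x * ?V i j x)"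
    proof (subst LINT_mult_sum_pd[of "pd i ?\<chi>" N "?V i"])
      show "?V i j differentiable (at x)" for j x using dW d by (auto intro!: derivative_intros)
      show "continuous_on UNIV (pd j (?V i j))" for j
        unfolding pdV[abs_def] using cpdW cf by (auto intro!: continuous_intros)
    qed (use chi supp1 in auto)
    also have "\<dots> = (\<Sum>j\<in>UNIV. (LINT x|lborel. pd j (pd i ?\<chi>) x * W i j x) - \<mu> * (LINT x|lborel. pd j (pd i ?\<chi>) x * pd j (v i t) x))"
    proof (rule sum.cong[OF refl])
      fix j
      have i1: "integrable lborel (\<lambda>x. pd j (pd i ?\<chi>) x * W i j x)"
        and i2: "integrable lborel (\<lambda>x. pd j (pd i ?\<chi>) x * pd j (v i t) x)"
        by (rule integrable_compact_support[of _ N], use chi cW cf supp2 in \<open>auto intro!: continuous_intros\<close>)+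
      have "(LINT x|lborel. pd j (pd i ?\<chi>) x * ?V i j x)
          = (LINT x|lborel. pd j (pd i ?\<chi>) x * W i j x - \<mu> * (pd j (pd i ?\<chi>) x * pd j (v i t) x))"
        by (simp add: algebra_simps)
      also have "\<dots> = (LINT x|lborel. pd j (pd i ?\<chi>) x * W i j x) - \<mu> * (LINT x|lborel. pd j (pd i ?\<chi>) x * pd j (v i t) x)"
        using i1 i2 by (subst Bochner_Integration.integral_diff) auto
      finally show "(LINT x|lborel. pd j (pd i ?\<chi>) x * ?V i j x) = \<dots>" .
    qed
    finally show ?thesis by (simp add: sum_subtractf sum_distrib_left)
  qed
  have visc: "(\<Sum>i\<in>UNIV. \<Sum>j\<in>UNIV. LINT x|lborel. pd j (pd i ?\<chi>) x * pd j (v i t) x) = 0"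
  proof -
    have "(\<Sum>i\<in>UNIV. \<Sum>j\<in>UNIV. LINT x|lborel. pd j (pd i ?\<chi>) x * pd j (v i t) x)
        = (\<Sum>j\<in>UNIV. \<Sum>i\<in>UNIV. LINT x|lborel. pd i (pd j ?\<chi>) x * pd j (v i t) x)"
      using pd_symmetric[of ?\<chi>] chi by (subst sum.swap) simp
    also have "\<dots> = (\<Sum>j\<in>UNIV. - (LINT x|lborel. pd j ?\<chi> x * (\<Sum>i\<in>UNIV. pd i (pd j (v i t)) x)))"
      by (intro sum.cong refl, subst LINT_mult_sum_pd[of _ N]) (use chi supp1 d cf in auto)
    also have "\<dots> = 0" using sum_pd_pd_zero[OF t] by simp
    finally show ?thesis .
  qed
  have p_int: "integrable lborel (p t)" by (rule integrable_pressure[OF t])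
  have bd: "\<bar>LINT x|lborel. pd j (pd i ?\<chi>) x * W i j x\<bar> \<le> 42 / N * (K * K\<^sup>2 + (LINT x|lborel. p t x))" for i j
  proof -
    have rv: "integrable lborel (\<lambda>x. \<rho> t x * v j t x)" "(LINT x|lborel. \<bar>\<rho> t x * v j t x\<bar>) \<le> K\<^sup>2"
      using integrable_mult_L2[OF K(2) K(3)] by auto
    have "\<bar>LINT x|lborel. pd j (pd i ?\<chi>) x * W i j x\<bar> \<le> (LINT x|lborel. \<bar>pd j (pd i ?\<chi>) x * W i j x\<bar>)"
      by (rule integral_abs_bound)
    also have "\<dots> \<le> (LINT x|lborel. 42 / N * (K * \<bar>\<rho> t x * v j t x\<bar> + p t x))"
    proof (rule integral_mono')
      show "integrable lborel (\<lambda>x. 42 / N * (K * \<bar>\<rho> t x * v j t x\<bar> + p t x))" using rv p_int by auto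
      fix x
      have "\<bar>\<rho> t x * v i t x * v j t x\<bar> \<le> K * \<bar>\<rho> t x * v j t x\<bar>"
        using mult_right_mono[OF K(4)[where i = i and x = x], of "\<bar>\<rho> t x * v j t x\<bar>"] by (simp add: abs_mult mult_ac)
      moreover have "\<bar>(if j = i then 1 else 0) * p t x\<bar> \<le> p t x" using pressure_nonneg[OF t, of x] by simp
      ultimately have "\<bar>W i j x\<bar> \<le> K * \<bar>\<rho> t x * v j t x\<bar> + p t x"
        unfolding W_def by (intro order_trans[OF abs_triangle_ineq add_mono])
      then show "\<bar>pd j (pd i ?\<chi>) x * W i j x\<bar> \<le> 42 / N * (K * \<bar>\<rho> t x * v j t x\<bar> + p t x)"
        unfolding abs_mult[of "pd j (pd i ?\<chi>) x"] using abs_pd_pd_coord_cutoff_le[OF N, of j i a x] N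
        by (intro mult_mono) auto
    qed (use N K pressure_nonneg[OF t] in auto)
    also have "\<dots> = 42 / N * (K * (LINT x|lborel. \<bar>\<rho> t x * v j t x\<bar>) + (LINT x|lborel. p t x))"
      using rv p_int by simp
    also have "\<dots> \<le> 42 / N * (K * K\<^sup>2 + (LINT x|lborel. p t x))"
      using rv N K by (intro mult_left_mono add_right_mono) auto
    finally show ?thesis .
  qed
  have "\<bar>\<Sum>i\<in>UNIV. LINT x|lborel. pd i ?\<chi> x * (dt \<rho> t x * v i t x + \<rho> t x * dt (v i) t x)\<bar>
      = \<bar>\<Sum>i\<in>UNIV. \<Sum>j\<in>UNIV. LINT x|lborel. pd j (pd i ?\<chi>) x * W i j x\<bar>"
    using visc by (simp add: step sum_subtractf sum_distrib_left[symmetric])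
  also have "\<dots> \<le> (\<Sum>i\<in>(UNIV::'n set). \<Sum>j\<in>(UNIV::'n set). 42 / N * (K * K\<^sup>2 + (LINT x|lborel. p t x)))"
    by (intro order_trans[OF sum_abs] sum_mono bd)
  also have "\<dots> = (real CARD('n))\<^sup>2 * (42 * (K * K\<^sup>2 + (LINT x|lborel. p t x))) / N"
    by (simp add: power2_eq_square)
  finally show ?thesis .
qed

lemma LINT_momentum_cutoff_tendsto:
  assumes t: "t \<ge> 0"
  shows "(\<lambda>j. \<Sum>i\<in>UNIV. LINT x|lborel. pd i (coord_cutoff a (real (Suc j))) x * (\<rho> t x * v i t x))
    \<longlonglongrightarrow> (LINT x|lborel. \<rho> t x * v a t x)"
proof -
  obtain K where "uniform_bounds K t" using bounds[OF t] by blast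
  note K = uniform_boundsD[OF this]
  have int: "integrable lborel (\<lambda>x. \<rho> t x * v i t x)" for i
    using K(2,4)[of t] t by (intro integrable_mult_L2) auto
  have "(\<lambda>j. LINT x|lborel. pd i (coord_cutoff a (real (Suc j))) x * (\<rho> t x * v i t x))
      \<longlonglongrightarrow> (LINT x|lborel. (if i = a then 1 else 0) * (\<rho> t x * v i t x))" for i
  proof (rule integral_dominated_convergence)
    show "integrable lborel (\<lambda>x. 7 * \<bar>\<rho> t x * v i t x\<bar>)" using int by auto
    show "(\<lambda>x. (if i = a then 1 else 0) * (\<rho> t x * v i t x)) \<in> borel_measurable lborel" using int[of i] by auto
    show "(\<lambda>x. pd i (coord_cutoff a (real (Suc j))) x * (\<rho> t x * v i t x)) \<in> borel_measurable lborel" for j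
    proof (rule borel_measurable_times)
      show "pd i (coord_cutoff a (real (Suc j))) \<in> borel_measurable lborel"
        using borel_measurable_continuous_onI[OF C_k_2D(4)[OF C_k_coord_cutoff]] by simp
      show "(\<lambda>x. \<rho> t x * v i t x) \<in> borel_measurable lborel" using int[of i] by auto
    qed
    show "AE x in lborel. (\<lambda>j. pd i (coord_cutoff a (real (Suc j))) x * (\<rho> t x * v i t x))
        \<longlonglongrightarrow> (if i = a then 1 else 0) * (\<rho> t x * v i t x)"
      by (intro AE_I2 tendsto_mult pd_coord_cutoff_tendsto tendsto_const)
    show "AE x in lborel. norm (pd i (coord_cutoff a (real (Suc j))) x * (\<rho> t x * v i t x)) \<le> 7 * \<bar>\<rho> t x * v i t x\<bar>" for j
      unfolding real_norm_def abs_mult[of "pd i _ _"]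
      by (intro AE_I2 mult_right_mono abs_pd_coord_cutoff_le) auto
  qed
  then have "(\<lambda>j. \<Sum>i\<in>UNIV. LINT x|lborel. pd i (coord_cutoff a (real (Suc j))) x * (\<rho> t x * v i t x))
      \<longlonglongrightarrow> (\<Sum>i\<in>UNIV. LINT x|lborel. (if i = a then 1 else 0) * (\<rho> t x * v i t x))"
    by (intro tendsto_sum)
  also have "(\<Sum>i\<in>UNIV. LINT x|lborel. (if i = a then 1 else 0) * (\<rho> t x * v i t x))
      = (\<Sum>i\<in>UNIV. if i = a then LINT x|lborel. \<rho> t x * v i t x else 0)"
    by (intro sum.cong) auto
  finally show ?thesis by simp
qed

text \<open>The momentum weighted by the gradient of the truncated coordinate changes by \<open>O(t/N)\<close> only.\<close>

lemma momentum_conserved: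
  assumes t: "t \<ge> 0"
  shows "(LINT x|lborel. \<rho> t x * v a t x) = (LINT x|lborel. \<rho> 0 x * v a 0 x)"
proof -
  obtain K where "uniform_bounds K t" using bounds[OF t] by blast
  note K = uniform_boundsD[OF this]
  let ?J = "\<lambda>N s. \<Sum>i\<in>UNIV. LINT x|lborel. pd i (coord_cutoff a N) x * (\<rho> s x * v i s x)"
  let ?C = "(real CARD('n))\<^sup>2 * (42 * (K * K\<^sup>2 + (LINT x|lborel. p t x)))"
  have "\<bar>?J (real (Suc j)) t - ?J (real (Suc j)) 0\<bar> \<le> ?C / real (Suc j) * (t - 0)" for j
  proof (rule abs_increment_le[where I' = "\<lambda>s. \<Sum>i\<in>UNIV. LINT x|lborel. pd i (coord_cutoff a (real (Suc j))) x
        * (dt \<rho> s x * v i s x + \<rho> s x * dt (v i) s x)"])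
    fix s assume s: "0 \<le> s" "s \<le> t"
    let ?N = "real (Suc j)"
    show "((\<lambda>s. ?J ?N s) has_vector_derivative (\<Sum>i\<in>UNIV. LINT x|lborel. pd i (coord_cutoff a ?N) x
        * (dt \<rho> s x * v i s x + \<rho> s x * dt (v i) s x))) (at s within {0..})"
    proof (rule has_vector_derivative_sum)
      fix i
      show "((\<lambda>s. LINT x|lborel. pd i (coord_cutoff a ?N) x * (\<rho> s x * v i s x)) has_vector_derivative
        (LINT x|lborel. pd i (coord_cutoff a ?N) x * (dt \<rho> s x * v i s x + \<rho> s x * dt (v i) s x))) (at s within {0..})"
      proof (rule has_vector_derivative_LINT_cutoff[where r = ?N])
        show "((\<lambda>s. \<rho> s x * v i s x) has_vector_derivative dt \<rho> s x * v i s x + \<rho> s x * dt (v i) s x) (at s within {0..})"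
          if "s \<ge> 0" for s x
          using has_vector_derivative_mult[OF has_vector_derivative_fields(1)[OF that, of x] has_vector_derivative_fields(3)[OF that, of x i]]
          by (simp add: add.commute)
        show "pd i (coord_cutoff a ?N) x = 0" if "norm x > ?N" for x
          by (rule pd_zero_outside[OF _ that]) (simp add: coord_cutoff_zero)
      qed (use s jointly_fields jointly_continuous_velocity continuous_fields continuous_velocity C_k_2D[OF C_k_coord_cutoff]
          in \<open>auto simp: case_prod_beta' intro!: continuous_intros\<close>)
    qed
    have "\<bar>\<Sum>i\<in>UNIV. LINT x|lborel. pd i (coord_cutoff a ?N) x * (dt \<rho> s x * v i s x + \<rho> s x * dt (v i) s x)\<bar>
        \<le> (real CARD('n))\<^sup>2 * (42 * (K * K\<^sup>2 + (LINT x|lborel. p s x))) / ?N"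
      by (rule momentum_flux_le) (use s K in auto)
    also have "\<dots> \<le> ?C / ?N"
      using pressure_bound[OF s] by (intro divide_right_mono mult_left_mono add_left_mono) auto
    finally show "\<bar>\<Sum>i\<in>UNIV. LINT x|lborel. pd i (coord_cutoff a ?N) x * (dt \<rho> s x * v i s x + \<rho> s x * dt (v i) s x)\<bar> \<le> ?C / ?N" .
  qed (use t in auto)
  then have "norm (?J (real (Suc j)) t - ?J (real (Suc j)) 0) \<le> (?C * t) / real (Suc j)" for j by simp
  then have "(\<lambda>j. ?J (real (Suc j)) t - ?J (real (Suc j)) 0) \<longlonglongrightarrow> 0"
    by (intro Lim_null_comparison[OF _ const_div_Suc_tendsto_0[of "?C * t"]] always_eventually) blast
  moreover have "(\<lambda>j. ?J (real (Suc j)) t - ?J (real (Suc j)) 0)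
      \<longlonglongrightarrow> (LINT x|lborel. \<rho> t x * v a t x) - (LINT x|lborel. \<rho> 0 x * v a 0 x)"
    using t by (intro tendsto_diff LINT_momentum_cutoff_tendsto) auto
  ultimately show ?thesis using LIMSEQ_unique by fastforce
qed

subsection \<open>Kinetic energy\<close>

definition kin :: "real \<Rightarrow> real^'n \<Rightarrow> real" where
  "kin t x = (\<Sum>i\<in>UNIV. (v i t x)\<^sup>2) / 2"

definition dissipation :: "real \<Rightarrow> real^'n \<Rightarrow> real" where
  "dissipation t x = (\<Sum>i\<in>UNIV. \<Sum>j\<in>UNIV. (pd j (v i t) x)\<^sup>2)"

lemma kin_differentiable: "t \<ge> 0 \<Longrightarrow> kin t differentiable (at x)"
  unfolding kin_def[abs_def] divide_inverse[of _ 2] power2_eq_square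
  by (rule differentiable_mult[OF differentiable_sum differentiable_const])
    (auto intro!: differentiable_mult differentiable_fields)

lemma pd_kin:
  assumes "t \<ge> 0" shows "pd j (kin t) x = (\<Sum>i\<in>UNIV. v i t x * pd j (v i t) x)"
proof -
  have sq: "(\<lambda>y. (v i t y)\<^sup>2) differentiable (at x)" for i
    unfolding power2_eq_square by (intro differentiable_mult differentiable_fields assms)
  have "kin t = (\<lambda>y. (1 / 2) * (\<Sum>i\<in>UNIV. (v i t y)\<^sup>2))" by (auto simp: kin_def fun_eq_iff)
  then have "pd j (kin t) x = (1 / 2) * pd j (\<lambda>y. \<Sum>i\<in>UNIV. (v i t y)\<^sup>2) x"
    using pd_cmult[of "\<lambda>y. \<Sum>i\<in>UNIV. (v i t y)\<^sup>2" x j "1/2"] sq by (simp add: differentiable_sum)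
  also have "pd j (\<lambda>y. \<Sum>i\<in>UNIV. (v i t y)\<^sup>2) x = (\<Sum>i\<in>UNIV. pd j (\<lambda>y. (v i t y)\<^sup>2) x)"
    by (rule pd_sum) (rule sq)
  also have "\<dots> = (\<Sum>i\<in>UNIV. 2 * (v i t x * pd j (v i t) x))"
    using differentiable_fields(3)[OF assms] unfolding power2_eq_square by (intro sum.cong refl) (simp add: pd_mult)
  finally show ?thesis by (simp add: sum_distrib_left)
qed

lemma continuous_kin: "t \<ge> 0 \<Longrightarrow> continuous_on UNIV (kin t)"
  unfolding kin_def[abs_def] divide_inverse[of _ 2]
  by (intro continuous_intros continuous_velocity)

lemma continuous_dissipation: "t \<ge> 0 \<Longrightarrow> continuous_on UNIV (dissipation t)"
  unfolding dissipation_def[abs_def] by (intro continuous_intros continuous_fields)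

text \<open>Since \<open>div u = 0\<close>, the work \<open>u \<cdot> \<nabla> p\<close> of the pressure is itself a divergence, and the
dissipation is the only source term.\<close>

lemma energy_balance:
  assumes t: "t \<ge> 0"
  shows "dt \<rho> t x * kin t x + \<rho> t x * (\<Sum>i\<in>UNIV. v i t x * dt (v i) t x)
    = - (\<Sum>j\<in>UNIV. pd j (\<lambda>y. (\<rho> t y * kin t y + p t y) * v j t y + (- \<mu>) * pd j (kin t) y) x) - \<mu> * dissipation t x"
proof -
  note d = differentiable_fields[OF t] kin_differentiable[OF t]
  have pdk: "pd j (kin t) = (\<lambda>y. \<Sum>i\<in>UNIV. v i t y * pd j (v i t) y)" for j using pd_kin[OF t] by auto
  have dpdk: "pd j (kin t) differentiable (at x)" for j x
    unfolding pdk using d by (auto intro!: derivative_intros)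
  have pdpdk: "pd j (pd j (kin t)) x = (\<Sum>i\<in>UNIV. v i t x * pd j (pd j (v i t)) x) + (\<Sum>i\<in>UNIV. (pd j (v i t) x)\<^sup>2)" for j
    unfolding pdk using d by (subst pd_sum) (auto simp: pd_mult power2_eq_square sum.distrib intro!: derivative_intros)
  have "pd j (\<lambda>y. (\<rho> t y * kin t y + p t y) * v j t y + (- \<mu>) * pd j (kin t) y) x
      = kin t x * pd j (\<lambda>y. \<rho> t y * v j t y) x + pd j (kin t) x * (\<rho> t x * v j t x)
        + (p t x * pd j (v j t) x + pd j (p t) x * v j t x) - \<mu> * pd j (pd j (kin t)) x" for j
  proof -
    have e0: "(\<lambda>y. (\<rho> t y * kin t y + p t y) * v j t y + (- \<mu>) * pd j (kin t) y)
        = (\<lambda>y. (kin t y * (\<rho> t y * v j t y) + p t y * v j t y) + (- \<mu>) * pd j (kin t) y)"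
      by (auto simp: algebra_simps)
    have e1: "pd j (\<lambda>y. (kin t y * (\<rho> t y * v j t y) + p t y * v j t y) + (- \<mu>) * pd j (kin t) y) x
        = pd j (\<lambda>y. kin t y * (\<rho> t y * v j t y) + p t y * v j t y) x + pd j (\<lambda>y. (- \<mu>) * pd j (kin t) y) x"
      by (rule pd_add) (use d dpdk in \<open>auto intro!: derivative_intros\<close>)
    have e2: "pd j (\<lambda>y. (- \<mu>) * pd j (kin t) y) x = (- \<mu>) * pd j (pd j (kin t)) x"
      by (rule pd_cmult) (rule dpdk)
    have e3: "pd j (\<lambda>y. kin t y * (\<rho> t y * v j t y) + p t y * v j t y) x
        = pd j (\<lambda>y. kin t y * (\<rho> t y * v j t y)) x + pd j (\<lambda>y. p t y * v j t y) x"
      by (rule pd_add) (use d in \<open>auto intro!: derivative_intros\<close>)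
    have e4: "pd j (\<lambda>y. kin t y * (\<rho> t y * v j t y)) x
        = kin t x * pd j (\<lambda>y. \<rho> t y * v j t y) x + pd j (kin t) x * (\<rho> t x * v j t x)"
      by (rule pd_mult) (use d in \<open>auto intro!: derivative_intros\<close>)
    have e5: "pd j (\<lambda>y. p t y * v j t y) x = p t x * pd j (v j t) x + pd j (p t) x * v j t x"
      by (rule pd_mult) (use d in auto)
    show ?thesis unfolding e0 e1 e2 e3 e4 e5 by simp
  qed
  then have "(\<Sum>j\<in>UNIV. pd j (\<lambda>y. (\<rho> t y * kin t y + p t y) * v j t y + (- \<mu>) * pd j (kin t) y) x)
      = kin t x * (\<Sum>j\<in>UNIV. pd j (\<lambda>y. \<rho> t y * v j t y) x) + (\<Sum>j\<in>UNIV. pd j (kin t) x * (\<rho> t x * v j t x))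
        + p t x * (\<Sum>j\<in>UNIV. pd j (v j t) x) + (\<Sum>j\<in>UNIV. pd j (p t) x * v j t x) - \<mu> * (\<Sum>j\<in>UNIV. pd j (pd j (kin t)) x)"
    by (simp add: sum.distrib sum_subtractf sum_distrib_left)
  also have "(\<Sum>j\<in>UNIV. pd j (\<lambda>y. \<rho> t y * v j t y) x) = - dt \<rho> t x" using mass_conservation[OF t] by simp
  also have "(\<Sum>j\<in>UNIV. pd j (v j t) x) = 0" by (rule divergence_free[OF t])
  also have "(\<Sum>j\<in>UNIV. pd j (kin t) x * (\<rho> t x * v j t x))
      = (\<Sum>i\<in>UNIV. v i t x * (\<Sum>j\<in>UNIV. \<rho> t x * v j t x * pd j (v i t) x))"
    unfolding pd_kin[OF t] sum_distrib_left sum_distrib_right by (subst sum.swap) (simp add: mult_ac)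
  also have "(\<Sum>j\<in>UNIV. pd j (pd j (kin t)) x)
      = (\<Sum>i\<in>UNIV. v i t x * (\<Sum>j\<in>UNIV. pd j (pd j (v i t)) x)) + dissipation t x"
    unfolding pdpdk dissipation_def sum.distrib sum_distrib_left
    by (subst (1 2) sum.swap) simp
  finally have sum: "(\<Sum>j\<in>UNIV. pd j (\<lambda>y. (\<rho> t y * kin t y + p t y) * v j t y + (- \<mu>) * pd j (kin t) y) x)
      = kin t x * (- dt \<rho> t x) + (\<Sum>i\<in>UNIV. v i t x * (\<Sum>j\<in>UNIV. \<rho> t x * v j t x * pd j (v i t) x))
        + p t x * 0 + (\<Sum>j\<in>UNIV. pd j (p t) x * v j t x)
        - \<mu> * ((\<Sum>i\<in>UNIV. v i t x * (\<Sum>j\<in>UNIV. pd j (pd j (v i t)) x)) + dissipation t x)" .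
  have gen: "(\<Sum>i\<in>UNIV. a i * (- X i - q i + \<mu> * Y i))
      = - (\<Sum>i\<in>UNIV. a i * X i) - (\<Sum>i\<in>UNIV. q i * a i) + \<mu> * (\<Sum>i\<in>UNIV. a i * Y i)"
    for a X q Y :: "'n \<Rightarrow> real"
    by (simp add: algebra_simps sum.distrib sum_subtractf sum_negf sum_distrib_left)
  have "\<rho> t x * (\<Sum>i\<in>UNIV. v i t x * dt (v i) t x) = (\<Sum>i\<in>UNIV. v i t x * (\<rho> t x * dt (v i) t x))"
    by (simp add: sum_distrib_left mult_ac)
  also have "\<dots> = - (\<Sum>i\<in>UNIV. v i t x * (\<Sum>j\<in>UNIV. \<rho> t x * v j t x * pd j (v i t) x))
      - (\<Sum>j\<in>UNIV. pd j (p t) x * v j t x) + \<mu> * (\<Sum>i\<in>UNIV. v i t x * (\<Sum>j\<in>UNIV. pd j (pd j (v i t)) x))"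
    unfolding momentum_transport[OF t]
    by (rule gen)
  finally show ?thesis unfolding sum by (simp add: algebra_simps)
qed

lemma kin_le:
  assumes "\<And>i. \<bar>v i t x\<bar> \<le> K" shows "\<bar>kin t x\<bar> \<le> real CARD('n) * K\<^sup>2 / 2"
proof -
  have "(\<Sum>i\<in>UNIV. (v i t x)\<^sup>2) \<le> (\<Sum>i\<in>(UNIV::'n set). K\<^sup>2)"
    by (intro sum_mono) (metis abs_ge_zero assms power2_abs power_mono)
  moreover have "(\<Sum>i\<in>UNIV. (v i t x)\<^sup>2) \<ge> 0" by (intro sum_nonneg) auto
  ultimately show ?thesis by (simp add: kin_def)
qed

lemma energy_flux_le:
  assumes N: "N \<ge> 1" and t: "t \<ge> 0" and K: "K > 0" "L2_bounded K (\<rho> t)" "L2_bounded K (p t)"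
    "\<And>i. L2_bounded K (v i t)" "\<And>i x. \<bar>v i t x\<bar> \<le> K"
  shows "(LINT x|lborel. cutoff N x * (dt \<rho> t x * kin t x + \<rho> t x * (\<Sum>i\<in>UNIV. v i t x * dt (v i) t x)))
    \<le> real CARD('n) * (3 * real CARD('n) * K\<^sup>2 * K\<^sup>2 + 6 * K\<^sup>2 + 15 * \<mu> * real CARD('n) * K\<^sup>2) / N
      - \<mu> * (LINT x|lborel. cutoff N x * dissipation t x)"
proof -
  let ?n = "real CARD('n)"
  let ?\<psi> = "cutoff N :: real^'n \<Rightarrow> real"
  have N0: "N > 0" using N by simp
  note psi = C_k_2D[OF C_k_cutoff[of N]]
  note d = differentiable_fields[OF t] kin_differentiable[OF t]
    and cf = continuous_fields[OF t] continuous_velocity[OF t] continuous_kin[OF t] continuous_dissipation[OF t]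
  have supp: "?\<psi> x = 0" if "norm x > N" for x using that N by (simp add: cutoff_zero)
  have supp1: "pd i ?\<psi> x = 0" if "norm x > N" for i x by (rule pd_zero_outside[OF supp that])
  have supp2: "pd j (pd i ?\<psi>) x = 0" if "norm x > N" for i j x by (rule pd_zero_outside[OF supp1 that])
  have pdk: "pd j (kin t) = (\<lambda>y. \<Sum>i\<in>UNIV. v i t y * pd j (v i t) y)" for j using pd_kin[OF t] by auto
  have dpdk: "pd j (kin t) differentiable (at x)" for j x
    unfolding pdk using d by (auto intro!: derivative_intros)
  have cpdk: "continuous_on UNIV (pd j (kin t))" for j
    unfolding pdk using cf by (auto intro!: continuous_intros)
  have cpdpdk: "continuous_on UNIV (pd j (pd j (kin t)))" for j
  proof -
    have "pd j (pd j (kin t)) = (\<lambda>x. \<Sum>i\<in>UNIV. v i t x * pd j (pd j (v i t)) x + pd j (v i t) x * pd j (v i t) x)"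
      unfolding pdk using d by (intro ext, subst pd_sum) (auto simp: pd_mult intro!: derivative_intros)
    then show ?thesis using cf by (auto intro!: continuous_intros)
  qed
  define W where "W j y = (\<rho> t y * kin t y + p t y) * v j t y" for j y
  let ?V = "\<lambda>j y. W j y + (- \<mu>) * pd j (kin t) y"
  have dW: "W j differentiable (at x)" for j x unfolding W_def[abs_def] using d by (auto intro!: derivative_intros)
  have cW: "continuous_on UNIV (W j)" for j unfolding W_def[abs_def] using cf by (auto intro!: continuous_intros)
  have cpdW: "continuous_on UNIV (pd j (W j))" for j
  proof -
    have "pd j (W j) = (\<lambda>x. (\<rho> t x * kin t x + p t x) * pd j (v j t) x
        + ((\<rho> t x * pd j (kin t) x + pd j (\<rho> t) x * kin t x) + pd j (p t) x) * v j t x)"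
      unfolding W_def[abs_def] using d by (auto simp: pd_mult pd_add intro!: derivative_intros)
    then show ?thesis using cf cpdk by (auto intro!: continuous_intros)
  qed
  have pdV: "pd j (?V j) x = pd j (W j) x + (- \<mu>) * pd j (pd j (kin t)) x" for j x
  proof -
    have "pd j (?V j) x = pd j (W j) x + pd j (\<lambda>y. (- \<mu>) * pd j (kin t) y) x"
      by (rule pd_add) (use dW dpdk in \<open>auto intro!: derivative_intros\<close>)
    moreover have "pd j (\<lambda>y. (- \<mu>) * pd j (kin t) y) x = (- \<mu>) * pd j (pd j (kin t)) x"
      by (rule pd_cmult) (rule dpdk)
    ultimately show ?thesis by simp
  qed
  have cpdV: "continuous_on UNIV (pd j (?V j))" for j
    unfolding pdV[abs_def] using cpdW cpdpdk by (auto intro!: continuous_intros)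
  have "(LINT x|lborel. ?\<psi> x * (dt \<rho> t x * kin t x + \<rho> t x * (\<Sum>i\<in>UNIV. v i t x * dt (v i) t x)))
      = (LINT x|lborel. - (?\<psi> x * (\<Sum>j\<in>UNIV. pd j (?V j) x)) - \<mu> * (?\<psi> x * dissipation t x))"
    unfolding energy_balance[OF t] W_def by (simp add: algebra_simps)
  also have "\<dots> = - (LINT x|lborel. ?\<psi> x * (\<Sum>j\<in>UNIV. pd j (?V j) x)) - \<mu> * (LINT x|lborel. ?\<psi> x * dissipation t x)"
  proof -
    have i1: "integrable lborel (\<lambda>x. ?\<psi> x * (\<Sum>j\<in>UNIV. pd j (?V j) x))"
      by (rule integrable_compact_support[of _ N]) (use psi supp cpdV in \<open>auto intro!: continuous_intros\<close>)
    have i2: "integrable lborel (\<lambda>x. ?\<psi> x * dissipation t x)"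
      by (rule integrable_compact_support[of _ N]) (use psi supp cf in \<open>auto intro!: continuous_intros\<close>)
    show ?thesis
      by (subst Bochner_Integration.integral_diff) (use i1 i2 in auto)
  qed
  also have "- (LINT x|lborel. ?\<psi> x * (\<Sum>j\<in>UNIV. pd j (?V j) x)) = (\<Sum>j\<in>UNIV. LINT x|lborel. pd j ?\<psi> x * ?V j x)"
    by (subst LINT_mult_sum_pd[of _ N]) (use psi supp dW dpdk cpdV in \<open>auto intro!: derivative_intros\<close>)
  finally have eq: "(LINT x|lborel. ?\<psi> x * (dt \<rho> t x * kin t x + \<rho> t x * (\<Sum>i\<in>UNIV. v i t x * dt (v i) t x)))
      = (\<Sum>j\<in>UNIV. LINT x|lborel. pd j ?\<psi> x * ?V j x) - \<mu> * (LINT x|lborel. ?\<psi> x * dissipation t x)" .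
  have "(\<Sum>j\<in>UNIV. LINT x|lborel. pd j ?\<psi> x * ?V j x) \<le> (\<Sum>j\<in>(UNIV::'n set). (3 * ?n * K\<^sup>2 * K\<^sup>2 + 6 * K\<^sup>2 + 15 * \<mu> * ?n * K\<^sup>2) / N)"
  proof (rule sum_mono)
    fix j
    have i1: "integrable lborel (\<lambda>x. pd j ?\<psi> x * (\<rho> t x * kin t x * v j t x))"
      and i2: "integrable lborel (\<lambda>x. pd j ?\<psi> x * (p t x * v j t x))"
      and i3: "integrable lborel (\<lambda>x. pd j ?\<psi> x * pd j (kin t) x)"
      by (rule integrable_compact_support[of _ N], use psi supp1 cf cpdk in \<open>auto intro!: continuous_intros\<close>)+
    have "(LINT x|lborel. pd j ?\<psi> x * ?V j x)
        = (LINT x|lborel. (pd j ?\<psi> x * (\<rho> t x * kin t x * v j t x) + pd j ?\<psi> x * (p t x * v j t x)) - \<mu> * (pd j ?\<psi> x * pd j (kin t) x))"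
      unfolding W_def by (simp add: algebra_simps)
    also have "\<dots> = (LINT x|lborel. pd j ?\<psi> x * (\<rho> t x * kin t x * v j t x)) + (LINT x|lborel. pd j ?\<psi> x * (p t x * v j t x))
        - \<mu> * (LINT x|lborel. pd j ?\<psi> x * pd j (kin t) x)"
      using i1 i2 i3 by (subst Bochner_Integration.integral_diff) auto
    also have "(LINT x|lborel. pd j ?\<psi> x * pd j (kin t) x) = - (LINT x|lborel. pd j (pd j ?\<psi>) x * kin t x)"
      by (rule LINT_by_parts[of _ _ _ N]) (use psi supp1 d cpdk in auto)
    also have "(LINT x|lborel. pd j (pd j ?\<psi>) x * kin t x) = (\<Sum>i\<in>UNIV. LINT x|lborel. pd j (pd j ?\<psi>) x * ((v i t x)\<^sup>2 / 2))"
      unfolding kin_def sum_divide_distrib sum_distrib_left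
      by (rule Bochner_Integration.integral_sum, rule integrable_compact_support[of _ N])
        (use psi supp2 cf in \<open>auto intro!: continuous_intros\<close>)
    finally have eq: "(LINT x|lborel. pd j ?\<psi> x * ?V j x)
        = (LINT x|lborel. pd j ?\<psi> x * (\<rho> t x * kin t x * v j t x)) + (LINT x|lborel. pd j ?\<psi> x * (p t x * v j t x))
          + \<mu> * (\<Sum>i\<in>UNIV. LINT x|lborel. pd j (pd j ?\<psi>) x * ((v i t x)\<^sup>2 / 2))" by simp
    have b1: "\<bar>LINT x|lborel. pd j ?\<psi> x * (\<rho> t x * kin t x * v j t x)\<bar> \<le> (6 / N * (?n * K\<^sup>2 / 2)) * K\<^sup>2"
    proof (rule abs_LINT_le_L2[OF K(2) K(4)])
      fix x
      have "\<bar>pd j ?\<psi> x\<bar> * \<bar>kin t x\<bar> \<le> 6 / N * (?n * K\<^sup>2 / 2)"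
        by (intro mult_mono abs_pd_cutoff_le kin_le K(5)) (use N in auto)
      from mult_right_mono[OF this, of "\<bar>\<rho> t x * v j t x\<bar>"]
      show "\<bar>pd j ?\<psi> x * (\<rho> t x * kin t x * v j t x)\<bar> \<le> 6 / N * (?n * K\<^sup>2 / 2) * \<bar>\<rho> t x * v j t x\<bar>"
        by (simp add: abs_mult mult_ac)
    qed (use N in auto)
    have b2: "\<bar>LINT x|lborel. pd j ?\<psi> x * (p t x * v j t x)\<bar> \<le> (6 / N) * K\<^sup>2"
    proof (rule abs_LINT_le_L2[OF K(3) K(4)])
      show "\<bar>pd j ?\<psi> x * (p t x * v j t x)\<bar> \<le> 6 / N * \<bar>p t x * v j t x\<bar>" for x
        unfolding abs_mult[of "pd j ?\<psi> x"] by (intro mult_right_mono abs_pd_cutoff_le N0) auto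
    qed (use N in auto)
    have b3: "\<bar>LINT x|lborel. pd j (pd j ?\<psi>) x * ((v i t x)\<^sup>2 / 2)\<bar> \<le> (15 / N) * K\<^sup>2" for i
    proof (rule abs_LINT_le_L2[OF K(4) K(4)])
      fix x
      have "30 / N\<^sup>2 \<le> 30 / N" using N by (intro divide_left_mono) (auto simp: power2_eq_square)
      then have "\<bar>pd j (pd j ?\<psi>) x\<bar> \<le> 30 / N" using abs_pd_pd_cutoff_le[OF N0, of j j x] by linarith
      from mult_right_mono[OF this, of "(v i t x)\<^sup>2 / 2"]
      show "\<bar>pd j (pd j ?\<psi>) x * ((v i t x)\<^sup>2 / 2)\<bar> \<le> 15 / N * \<bar>v i t x * v i t x\<bar>"
        by (simp add: abs_mult power2_eq_square)
    qed (use N in auto)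
    have "(\<Sum>i\<in>UNIV. LINT x|lborel. pd j (pd j ?\<psi>) x * ((v i t x)\<^sup>2 / 2)) \<le> (\<Sum>i\<in>(UNIV::'n set). (15 / N) * K\<^sup>2)"
      by (intro sum_mono order_trans[OF abs_ge_self b3])
    then have b4: "\<mu> * (\<Sum>i\<in>UNIV. LINT x|lborel. pd j (pd j ?\<psi>) x * ((v i t x)\<^sup>2 / 2)) \<le> \<mu> * (?n * (15 / N * K\<^sup>2))"
      using mu by (intro mult_left_mono) auto
    have "(LINT x|lborel. pd j ?\<psi> x * ?V j x) \<le> (6 / N * (?n * K\<^sup>2 / 2)) * K\<^sup>2 + (6 / N) * K\<^sup>2 + \<mu> * (?n * (15 / N * K\<^sup>2))"
      unfolding eq using b1 b2 b4 by linarith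
    also have "\<dots> = (3 * ?n * K\<^sup>2 * K\<^sup>2 + 6 * K\<^sup>2 + 15 * \<mu> * ?n * K\<^sup>2) / N"
      by (simp add: add_divide_distrib mult_ac)
    finally show "(LINT x|lborel. pd j ?\<psi> x * ?V j x) \<le> (3 * ?n * K\<^sup>2 * K\<^sup>2 + 6 * K\<^sup>2 + 15 * \<mu> * ?n * K\<^sup>2) / N" .
  qed
  also have "\<dots> = ?n * (3 * ?n * K\<^sup>2 * K\<^sup>2 + 6 * K\<^sup>2 + 15 * \<mu> * ?n * K\<^sup>2) / N" by simp
  finally show ?thesis unfolding eq by (rule diff_right_mono)
qed

lemma continuous_LINT_cutoff_gradient:
  assumes N: "N > 0"
  shows "continuous_on {0..} (\<lambda>s. LINT x|lborel. cutoff N x * (norm (grad (v i s) x))\<^sup>2)"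
proof -
  let ?C = "cbox (- (\<chi> i. N)) (\<chi> i. N) :: (real^'n) set"
  have "continuous_on {0..} (\<lambda>s. integral ?C (\<lambda>x. cutoff N x * (\<Sum>j\<in>UNIV. (pd j (v i s) x)\<^sup>2)))"
  proof (rule integral_continuous_on_param)
    have "continuous_on ({0..} \<times> ?C) (\<lambda>z. pd j (v i (fst z)) (snd z))" for j
      by (rule continuous_on_subset[OF jointly_fields(4)]) auto
    moreover have "continuous_on ({0..} \<times> ?C) (\<lambda>z. cutoff N (snd z))"
      by (intro continuous_on_compose2[OF C_k_2D(2)[OF C_k_cutoff]] continuous_intros) auto
    ultimately show "continuous_on ({0..} \<times> ?C) (\<lambda>(s, x). cutoff N x * (\<Sum>j\<in>UNIV. (pd j (v i s) x)\<^sup>2))"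
      unfolding case_prod_beta' by (intro continuous_intros)
  qed
  moreover have "integral ?C (\<lambda>x. cutoff N x * (\<Sum>j\<in>UNIV. (pd j (v i s) x)\<^sup>2))
      = (LINT x|lborel. cutoff N x * (norm (grad (v i s) x))\<^sup>2)" if "s \<in> {0..}" for s
    unfolding norm_grad_square
    by (rule LINT_eq_integral_cube[symmetric])
      (use that C_k_2D(2)[OF C_k_cutoff] continuous_fields N in \<open>auto intro!: continuous_intros simp: cutoff_zero\<close>)
  ultimately show ?thesis by (rule continuous_on_eq)
qed

lemma bounds_at:
  assumes "t \<ge> 0"
  obtains K where "K > 0" "L2_bounded K (\<rho> t)" "\<And>i. L2_bounded K (v i t)" "\<And>i x. \<bar>v i t x\<bar> \<le> K"
proof -
  obtain K where "uniform_bounds K t" using bounds[OF assms] by blast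
  note K = uniform_boundsD[OF this]
  show ?thesis by (rule that[OF K(1) K(2)[OF assms order_refl] K(4)[OF assms order_refl] K(5)[OF assms order_refl]])
qed

lemma continuous_grad: "t \<ge> 0 \<Longrightarrow> continuous_on UNIV (grad (v i t))"
  unfolding grad_def[abs_def] by (intro continuous_on_vec_lambda continuous_fields)

text \<open>The conserved momentum is at most \<open>\<integral> \<rho> |v\<^sub>i|\<close>, which is bounded in terms of the gradient and of
quantities that do not grow. The weight \<open>\<eta>\<close> is chosen such that the terms without the gradient
take up less than half of the momentum.\<close>

lemma gradient_lower_bound:
  assumes dim: "CARD('n) \<ge> 3" and P: "(LINT x|lborel. \<rho> 0 x * v i 0 x) \<noteq> 0"
  obtains b where "b > 0" "\<And>t. t \<ge> 0 \<Longrightarrow> ennreal b \<le> (\<integral>\<^sup>+x. ennreal ((norm (grad (v i t) x))\<^sup>2) \<partial>lborel)"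
proof -
  define P where "P = \<bar>LINT x|lborel. \<rho> 0 x * v i 0 x\<bar>"
  define L where "L = (LINT x|lborel. (\<rho> 0 x)\<^sup>2)"
  define M where "M = (LINT x|lborel. \<rho> 0 x)"
  define \<kappa> where "\<kappa> = 2 * sqrt (real CARD('n))"
  have P0: "P > 0" using P by (simp add: P_def)
  have L0: "L \<ge> 0" unfolding L_def by (intro integral_nonneg_AE) auto
  have M0: "M \<ge> 0" unfolding M_def using rho_nonneg[of 0] by (intro integral_nonneg_AE) auto
  have \<kappa>: "\<kappa> > 0" by (simp add: \<kappa>_def)
  \<comment> \<open>The summand \<open>1\<close> keeps the denominator positive.\<close>
  define \<eta> where "\<eta> = P / (2 * \<kappa> * (L + 2 * M + 1))"
  have \<eta>: "\<eta> > 0" using P0 L0 M0 \<kappa> by (simp add: \<eta>_def)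
  have small: "\<kappa> * (\<eta> * (L + 2 * M)) < P / 2"
  proof -
    have "\<kappa> * (\<eta> * (L + 2 * M)) < \<kappa> * (\<eta> * (L + 2 * M + 1))" using \<kappa> \<eta> by simp
    also have "\<dots> = P / 2" using \<kappa> L0 M0 by (simp add: \<eta>_def)
    finally show ?thesis .
  qed
  define c where "c = \<kappa> * (1 / (4 * \<eta>) * (1 + 2 * M))"
  have c: "c > 0" using \<kappa> \<eta> M0 by (simp add: c_def)
  have main: "ennreal (P / (2 * c)) \<le> (\<integral>\<^sup>+x. ennreal ((norm (grad (v i t) x))\<^sup>2) \<partial>lborel)" (is "_ \<le> ?B") if t: "t \<ge> 0" for t
  proof (rule ccontr)
    assume "\<not> ?thesis"
    then have less: "?B < ennreal (P / (2 * c))" by simp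
    then obtain B where B: "B \<ge> 0" "?B = ennreal B" by (cases ?B) auto
    with less have B_less: "B < P / (2 * c)" by (simp add: ennreal_less_iff)
    obtain K where K: "K > 0" "L2_bounded K (\<rho> t)" "\<And>i. L2_bounded K (v i t)" "\<And>i x. \<bar>v i t x\<bar> \<le> K"
      using bounds_at[OF t] by blast
    have int: "integrable lborel (\<lambda>x. \<rho> t x * v i t x)" by (rule integrable_mult_L2[OF K(2,3)])
    have "ennreal P = ennreal \<bar>LINT x|lborel. \<rho> t x * v i t x\<bar>"
      using momentum_conserved[OF t, of i] by (simp add: P_def)
    also have "\<dots> \<le> ennreal (LINT x|lborel. \<bar>\<rho> t x * v i t x\<bar>)" by (intro ennreal_leI integral_abs_bound)
    also have "\<dots> = (\<integral>\<^sup>+x. ennreal (\<rho> t x * \<bar>v i t x\<bar>) \<partial>lborel)"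
      using nn_integral_eq_integral[OF integrable_abs[OF int]] rho_nonneg[OF t] by (simp add: abs_mult)
    also have "\<dots> \<le> ennreal \<kappa> *
      (ennreal \<eta> * ((\<integral>\<^sup>+x. ennreal ((\<rho> t x)\<^sup>2) \<partial>lborel) + 2 * (\<integral>\<^sup>+x. ennreal (\<rho> t x) \<partial>lborel))
       + ennreal (1 / (4 * \<eta>)) * (1 + 2 * (\<integral>\<^sup>+x. ennreal (\<rho> t x) \<partial>lborel)) * ?B)"
      unfolding \<kappa>_def
      by (rule nn_integral_density_mult_le[OF dim differentiable_fields(3)[OF t] continuous_grad[OF t]
            velocity_tendsto_0[OF t] continuous_fields(1)[OF t] rho_nonneg[OF t] \<eta>]) (use dim in simp)
    also have "\<dots> \<le> ennreal \<kappa> * (ennreal \<eta> * (ennreal L + 2 * ennreal M) + ennreal (1 / (4 * \<eta>)) * (1 + 2 * ennreal M) * ?B)"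
      using density_bound[OF t] density_square_bound[OF t]
      by (intro mult_left_mono add_mono mult_right_mono) (auto simp: L_def M_def)
    also have "\<dots> = ennreal (\<kappa> * (\<eta> * (L + 2 * M) + 1 / (4 * \<eta>) * (1 + 2 * M) * B))"
    proof -
      have "2 * ennreal M = ennreal (2 * M)" using M0 by (simp add: ennreal_mult)
      moreover have "1 + ennreal (2 * M) = ennreal (1 + 2 * M)" using M0 by (simp add: ennreal_plus)
      moreover have "ennreal L + ennreal (2 * M) = ennreal (L + 2 * M)" using L0 M0 by (simp add: ennreal_plus)
      moreover have "ennreal \<eta> * ennreal (L + 2 * M) = ennreal (\<eta> * (L + 2 * M))"
        using \<eta> L0 M0 by (intro ennreal_mult[symmetric]) auto
      moreover have "ennreal (1 / (4 * \<eta>)) * ennreal (1 + 2 * M) * ennreal B = ennreal (1 / (4 * \<eta>) * (1 + 2 * M) * B)"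
      proof -
        have "ennreal (1 / (4 * \<eta>)) * ennreal (1 + 2 * M) = ennreal (1 / (4 * \<eta>) * (1 + 2 * M))"
          using \<eta> M0 by (intro ennreal_mult[symmetric]) auto
        moreover have "ennreal (1 / (4 * \<eta>) * (1 + 2 * M)) * ennreal B = ennreal (1 / (4 * \<eta>) * (1 + 2 * M) * B)"
          using \<eta> M0 B(1) by (intro ennreal_mult[symmetric]) auto
        ultimately show ?thesis by (simp only:)
      qed
      moreover have "ennreal (\<eta> * (L + 2 * M)) + ennreal (1 / (4 * \<eta>) * (1 + 2 * M) * B)
          = ennreal (\<eta> * (L + 2 * M) + 1 / (4 * \<eta>) * (1 + 2 * M) * B)"
        using \<eta> L0 M0 B(1) by (intro ennreal_plus[symmetric]) auto
      moreover have "ennreal \<kappa> * ennreal (\<eta> * (L + 2 * M) + 1 / (4 * \<eta>) * (1 + 2 * M) * B)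
          = ennreal (\<kappa> * (\<eta> * (L + 2 * M) + 1 / (4 * \<eta>) * (1 + 2 * M) * B))"
        using \<kappa> \<eta> L0 M0 B(1) by (intro ennreal_mult[symmetric]) auto
      ultimately show ?thesis using B(2) by (simp only:)
    qed
    finally have "P \<le> \<kappa> * (\<eta> * (L + 2 * M) + 1 / (4 * \<eta>) * (1 + 2 * M) * B)"
      using \<kappa> \<eta> L0 M0 B(1) by (subst (asm) ennreal_le_iff) auto
    also have "\<dots> = \<kappa> * (\<eta> * (L + 2 * M)) + c * B" by (simp add: c_def distrib_left mult.assoc)
    also have "c * B \<le> P / 2" using mult_left_mono[OF less_imp_le[OF B_less], of c] c by simp
    finally show False using small by linarith
  qed
  show ?thesis by (rule that[OF _ main]) (use P0 c in auto)
qed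

text \<open>The cutoff integrals are continuous in time and increase with the radius of the cutoff, so a
compactness argument as in Dini's theorem yields one radius that serves for all times in
\<open>[0,t]\<close>.\<close>

lemma uniform_gradient_lower_bound:
  assumes t: "t \<ge> 0" and b: "b > 0"
    and lower: "\<And>s. s \<ge> 0 \<Longrightarrow> ennreal b \<le> (\<integral>\<^sup>+x. ennreal ((norm (grad (v i s) x))\<^sup>2) \<partial>lborel)"
  obtains m where "\<And>j s. m \<le> j \<Longrightarrow> 0 \<le> s \<Longrightarrow> s \<le> t \<Longrightarrow>
    b / 2 \<le> (LINT x|lborel. cutoff (real (Suc j)) x * (norm (grad (v i s) x))\<^sup>2)"
proof -
  let ?d = "\<lambda>j s. LINT x|lborel. cutoff (real (Suc j)) x * (norm (grad (v i s) x))\<^sup>2"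
  have mono: "?d j s \<le> ?d j' s" if "j \<le> j'" "s \<ge> 0" for j j' s
  proof -
    have int: "integrable lborel (\<lambda>x. cutoff (real (Suc j)) x * (norm (grad (v i s) x))\<^sup>2)" for j
      by (rule integrable_compact_support[of _ "real (Suc j)"])
        (use C_k_2D(2)[OF C_k_cutoff] continuous_grad[OF \<open>s \<ge> 0\<close>] in \<open>auto intro!: continuous_intros simp: cutoff_zero\<close>)
    show ?thesis
      by (rule integral_mono[OF int int], rule mult_right_mono, rule cutoff_mono) (use that in auto)
  qed
  have "\<exists>m. \<forall>s\<in>{0..t}. b / 2 \<le> ?d m s"
  proof (rule ccontr)
    assume "\<nexists>m. \<forall>s\<in>{0..t}. b / 2 \<le> ?d m s"
    then have "\<forall>m. \<exists>s\<in>{0..t}. ?d m s < b / 2" by (meson not_le)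
    then obtain s where s: "\<And>m. s m \<in> {0..t}" "\<And>m. ?d m (s m) < b / 2" by metis
    obtain l r where l: "l \<in> {0..t}" and r: "strict_mono r" "(s \<circ> r) \<longlonglongrightarrow> l"
      using compact_Icc[of 0 t] s(1) unfolding compact_def by blast
    have "?d j l \<le> b / 2" for j
    proof (rule LIMSEQ_le_const2)
      show "(\<lambda>m. ?d j (s (r m))) \<longlonglongrightarrow> ?d j l"
        using r(2) l s(1)
        by (intro continuous_on_tendsto_compose[OF continuous_LINT_cutoff_gradient[of "real (Suc j)" i]])
          (auto simp: o_def intro!: always_eventually)
      show "\<exists>N. \<forall>n\<ge>N. ?d j (s (r n)) \<le> b / 2"
      proof (intro exI allI impI)
        fix n assume "n \<ge> j"
        then have "j \<le> r n" using seq_suble[OF r(1), of n] by linarith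
        then have "?d j (s (r n)) \<le> ?d (r n) (s (r n))" using s(1)[of "r n"] by (intro mono) auto
        then show "?d j (s (r n)) \<le> b / 2" using s(2)[of "r n"] by linarith
      qed
    qed
    then have "(\<integral>\<^sup>+x. ennreal ((norm (grad (v i l) x))\<^sup>2) \<partial>lborel) \<le> ennreal (b / 2)"
      by (intro nn_integral_le_of_cutoff[where a = "\<lambda>_. b / 2"])
        (use l continuous_grad[of l] in \<open>auto intro!: continuous_intros\<close>)
    with lower[of l] l have "ennreal b \<le> ennreal (b / 2)" by (auto intro: order_trans)
    then show False using b by (simp add: ennreal_le_iff)
  qed
  then obtain m where m: "\<forall>s\<in>{0..t}. b / 2 \<le> ?d m s" by blast
  show ?thesis
  proof (rule that[of m])
    fix j s assume "m \<le> j" "0 \<le> s" "s \<le> t"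
    then have "b / 2 \<le> ?d m s" using m by simp
    also have "?d m s \<le> ?d j s" by (rule mono) fact+
    finally show "b / 2 \<le> ?d j s" .
  qed
qed

text \<open>Otherwise the dissipation is bounded below by \<open>\<mu> b\<close> at all times, which exhausts the kinetic
energy in finite time. The time \<open>t\<close> is fixed before the radius of the cutoff, because the error
of the cutoff depends on the bounds on \<open>[0,t]\<close>.\<close>

lemma momentum_zero:
  assumes dim: "CARD('n) \<ge> 3"
  shows "(LINT x|lborel. \<rho> 0 x * v i 0 x) = 0"
proof (rule ccontr)
  assume "(LINT x|lborel. \<rho> 0 x * v i 0 x) \<noteq> 0"
  then obtain b where b: "b > 0" "\<And>t. t \<ge> 0 \<Longrightarrow> ennreal b \<le> (\<integral>\<^sup>+x. ennreal ((norm (grad (v i t) x))\<^sup>2) \<partial>lborel)"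
    using gradient_lower_bound[OF dim] by blast
  let ?n = "real CARD('n)"
  obtain K0 where K0: "K0 > 0" "L2_bounded K0 (\<rho> 0)" "\<And>i. L2_bounded K0 (v i 0)" "\<And>i x. \<bar>v i 0 x\<bar> \<le> K0"
    using bounds_at[of 0] by blast
  define e where "e N s = (LINT x|lborel. cutoff N x * (\<rho> s x * kin s x))" for N s
  have e_nonneg: "e N s \<ge> 0" if "s \<ge> 0" for N s
    unfolding e_def kin_def
    by (intro integral_nonneg_AE AE_I2 mult_nonneg_nonneg divide_nonneg_nonneg sum_nonneg cutoff_bounds rho_nonneg that) auto
  define e0 where "e0 = ?n * (K0 / 2 * K0\<^sup>2)"
  have e0: "e N 0 \<le> e0" if "N > 0" for N
  proof -
    have "e N 0 = (\<Sum>i\<in>UNIV. LINT x|lborel. cutoff N x * (\<rho> 0 x * ((v i 0 x)\<^sup>2 / 2)))"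
      unfolding e_def kin_def sum_divide_distrib sum_distrib_left
      by (rule Bochner_Integration.integral_sum, rule integrable_compact_support[of _ N])
        (use C_k_2D(2)[OF C_k_cutoff] continuous_fields[of 0] continuous_velocity[of 0] that
          in \<open>auto intro!: continuous_intros simp: cutoff_zero\<close>)
    also have "\<dots> \<le> (\<Sum>i\<in>(UNIV::'n set). K0 / 2 * K0\<^sup>2)"
    proof (intro sum_mono order_trans[OF abs_ge_self abs_LINT_le_L2[OF K0(2) K0(3)]])
      fix i x
      have "cutoff N x * \<bar>v i 0 x\<bar> \<le> 1 * K0" using cutoff_bounds[of N x] K0(4)[where i = i and x = x] by (intro mult_mono) auto
      from mult_right_mono[OF this, of "\<bar>\<rho> 0 x * v i 0 x\<bar> / 2"]
      show "\<bar>cutoff N x * (\<rho> 0 x * ((v i 0 x)\<^sup>2 / 2))\<bar> \<le> K0 / 2 * \<bar>\<rho> 0 x * v i 0 x\<bar>"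
        using cutoff_bounds[of N x] by (simp add: abs_mult power2_eq_square mult_ac)
    qed (use K0 in auto)
    finally show ?thesis by (simp add: e0_def)
  qed
  \<comment> \<open>By this time the dissipation exceeds the initial energy by more than the error \<open>1\<close> of the cutoff.\<close>
  define t where "t = (e0 + 2) / (\<mu> * (b / 2))"
  have "e0 \<ge> 0" using K0(1) by (simp add: e0_def)
  then have t: "t > 0" using mu b(1) by (simp add: t_def)
  obtain K where "uniform_bounds K t" using bounds[OF less_imp_le[OF t]] by blast
  note K = uniform_boundsD[OF this]
  define C where "C = ?n * (3 * ?n * K\<^sup>2 * K\<^sup>2 + 6 * K\<^sup>2 + 15 * \<mu> * ?n * K\<^sup>2)"
  obtain m where m: "\<And>j s. m \<le> j \<Longrightarrow> 0 \<le> s \<Longrightarrow> s \<le> t \<Longrightarrow>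
    b / 2 \<le> (LINT x|lborel. cutoff (real (Suc j)) x * (norm (grad (v i s) x))\<^sup>2)"
    using uniform_gradient_lower_bound[OF less_imp_le[OF t] b] by blast
  have "\<forall>\<^sub>F j in sequentially. C * t / real (Suc j) < 1"
    using const_div_Suc_tendsto_0[of "C * t"] by (rule order_tendstoD) simp
  then obtain j where j: "j \<ge> m" "C * t / real (Suc j) < 1"
    unfolding eventually_sequentially by (metis max.cobounded1 max.cobounded2)
  let ?N = "real (Suc j)"
  have "e ?N t - e ?N 0 \<le> (C / ?N - \<mu> * (b / 2)) * (t - 0)"
  proof (rule increment_le)
    fix s assume s: "0 \<le> s" "s \<le> t"
    let ?et = "\<lambda>s x. dt \<rho> s x * kin s x + \<rho> s x * (\<Sum>i\<in>UNIV. v i s x * dt (v i) s x)"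
    show "(e ?N has_vector_derivative (LINT x|lborel. cutoff ?N x * ?et s x)) (at s within {0..})"
      unfolding e_def[abs_def]
    proof (rule has_vector_derivative_LINT_cutoff[where r = ?N])
      show "((\<lambda>s. \<rho> s x * kin s x) has_vector_derivative ?et s x) (at s within {0..})" if s: "s \<ge> 0" for s x
      proof -
        have "((\<lambda>s. v i s x * v i s x) has_vector_derivative 2 * (v i s x * dt (v i) s x)) (at s within {0..})" for i
          using has_vector_derivative_mult[OF has_vector_derivative_fields(3)[OF s, of x i] has_vector_derivative_fields(3)[OF s, of x i]]
          by (simp add: mult.commute)
        then have "((\<lambda>s. \<Sum>i\<in>UNIV. v i s x * v i s x) has_vector_derivative (\<Sum>i\<in>UNIV. 2 * (v i s x * dt (v i) s x))) (at s within {0..})"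
          by (intro has_vector_derivative_sum)
        from has_vector_derivative_mult_right[OF this, of "1 / 2"]
        have "((\<lambda>s. kin s x) has_vector_derivative (\<Sum>i\<in>UNIV. v i s x * dt (v i) s x)) (at s within {0..})"
          by (simp add: kin_def power2_eq_square sum_distrib_left[symmetric])
        from has_vector_derivative_mult[OF has_vector_derivative_fields(1)[OF s, of x] this]
        show ?thesis by (simp add: add.commute)
      qed
      show "continuous_on ({0..} \<times> UNIV) (\<lambda>(s, x). ?et s x)"
        unfolding case_prod_beta' kin_def divide_inverse[of _ 2]
        by (intro continuous_intros jointly_fields jointly_continuous_velocity)
    qed (use s C_k_2D(2)[OF C_k_cutoff] continuous_fields continuous_kin in \<open>auto intro!: continuous_intros simp: cutoff_zero\<close>)
    have "(LINT x|lborel. cutoff ?N x * (norm (grad (v i s) x))\<^sup>2) \<le> (LINT x|lborel. cutoff ?N x * dissipation s x)"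
    proof (rule integral_mono)
      show "integrable lborel (\<lambda>x. cutoff ?N x * (norm (grad (v i s) x))\<^sup>2)"
        by (rule integrable_compact_support[of _ ?N])
          (use C_k_2D(2)[OF C_k_cutoff] continuous_grad[OF s(1)] in \<open>auto intro!: continuous_intros simp: cutoff_zero\<close>)
      show "integrable lborel (\<lambda>x. cutoff ?N x * dissipation s x)"
        by (rule integrable_compact_support[of _ ?N])
          (use C_k_2D(2)[OF C_k_cutoff] continuous_dissipation[OF s(1)] in \<open>auto intro!: continuous_intros simp: cutoff_zero\<close>)
      fix x
      have "(norm (grad (v i s) x))\<^sup>2 = (\<Sum>j\<in>UNIV. (pd j (v i s) x)\<^sup>2)"
        by (rule norm_grad_square)
      also have "\<dots> \<le> dissipation s x" unfolding dissipation_def by (rule member_le_sum) (auto intro: sum_nonneg)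
      finally show "cutoff ?N x * (norm (grad (v i s) x))\<^sup>2 \<le> cutoff ?N x * dissipation s x"
        by (intro mult_left_mono cutoff_bounds)
    qed
    then have "b / 2 \<le> (LINT x|lborel. cutoff ?N x * dissipation s x)" using m[OF j(1) s] by linarith
    then have "\<mu> * (b / 2) \<le> \<mu> * (LINT x|lborel. cutoff ?N x * dissipation s x)" using mu by (intro mult_left_mono) auto
    moreover have "(LINT x|lborel. cutoff ?N x * ?et s x) \<le> C / ?N - \<mu> * (LINT x|lborel. cutoff ?N x * dissipation s x)"
      unfolding C_def by (rule energy_flux_le) (use s K in auto)
    ultimately show "(LINT x|lborel. cutoff ?N x * ?et s x) \<le> C / ?N - \<mu> * (b / 2)" by linarith
  qed (use t in auto)
  also have "\<dots> = C * t / ?N - (e0 + 2)"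
  proof -
    have "\<mu> * (b / 2) * t = e0 + 2" using mu b(1) by (simp add: t_def)
    then show ?thesis by (simp only: left_diff_distrib diff_zero times_divide_eq_left)
  qed
  finally have "e ?N t - e ?N 0 \<le> C * t / ?N - (e0 + 2)" .
  moreover have "e ?N 0 \<le> e0" by (rule e0) simp
  ultimately have "e ?N t < 0" using j(2) by linarith
  then show False using e_nonneg[of t ?N] t by simp
qed

end

section \<open>Loss of smoothness\<close>

theorem mainTheorem4:
  fixes \<mu> lam k R A \<gamma> c :: real
    and m :: nat
    and T :: ereal
    and \<rho>0 p0 :: "real^'n \<Rightarrow> real"
    and u0 :: "real^'n \<Rightarrow> real^'n"
    and \<rho> p \<theta> S :: "real \<Rightarrow> real^'n \<Rightarrow> real"
    and u :: "real \<Rightarrow> real^'n \<Rightarrow> real^'n"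
  assumes "\<mu> > 0" and "lam + 2 / real CARD('n) * \<mu> > 0" and "k \<ge> 0" and "R > 0" and "A > 0"
    and "\<gamma> > 1" and "c = R / (\<gamma> - 1)"
    and dim: "CARD('n) \<ge> 3"
    and gamma: "\<gamma> \<ge> 2 * real CARD('n) / (real CARD('n) + 2)"
    and order: "m > CARD('n) div 2 + 2"
    and data_H: "sobolev m \<rho>0" "\<And>i. sobolev m (\<lambda>x. u0 x $ i)" "sobolev m p0"
    and lifespan: "T > 0"
    and initial: "\<rho> 0 = \<rho>0" "u 0 = u0" "p 0 = p0"
    and equations: "mass_eq T \<rho> u" "momentum_eq \<mu> lam T \<rho> u p" "pressure_eq \<mu> lam k R \<gamma> T u p \<theta>"
    and state: "state_eqs R A c \<gamma> T \<rho> p \<theta> S"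
    and prop_i: "classical k T \<rho> u p \<theta>"
    and prop_ii: "decay k T \<rho> u p \<theta>"
    and prop_iii: "\<And>t x. t \<in> time_dom T \<Longrightarrow> \<rho> t x \<ge> 0"
    and entropy: "entropy_nondecreasing T \<rho> u S"
    and momentum: "total_momentum \<rho> u 0 \<noteq> 0"
    and incompressible: "\<And>t x. t \<in> time_dom T \<Longrightarrow> divg (u t) x = 0"
  shows "loses_initial_smoothness m T \<rho> u p"
proof (rule ccontr)
  assume "\<not> loses_initial_smoothness m T \<rho> u p"
  then have le_T: "ereal \<tau> \<le> T" and keeps: "keeps_initial_smoothness m (ereal \<tau>) \<rho> u p" if "\<tau> > 0" for \<tau>
    using that by (auto simp: loses_initial_smoothness_def)
  have T: "T = \<infinity>"
  proof (rule ereal_top)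
    fix B
    have "ereal B \<le> ereal (max B 1)" by simp
    also have "\<dots> \<le> T" by (rule le_T) simp
    finally show "ereal B \<le> T" .
  qed
  have continuous_u: "continuous_on UNIV (\<lambda>x. u s x $ i)" if "s \<ge> 0" for s i
  proof (rule jointly_continuous_slice[OF _ that])
    show "jointly_continuous \<infinity> (\<lambda>t x. u t x $ i)"
      using prop_i unfolding T classical_def C2_x_def C1_x_def by blast
  qed
  interpret sol: global_solution \<mu> lam k R A \<gamma> c \<rho> p \<theta> S u
  proof
    show "c > 0" using \<open>R > 0\<close> \<open>\<gamma> > 1\<close> \<open>c = R / (\<gamma> - 1)\<close> by simp
    fix t :: real assume t: "t \<ge> 0"
    have "2 * m > CARD('n)" using order by presburger
    then obtain C where C: "C \<ge> 0"
      "\<And>(f :: real^'n \<Rightarrow> real) K x. sobolev_bounded m K f \<Longrightarrow> K > 0 \<Longrightarrow> continuous_on UNIV f \<Longrightarrow> \<bar>f x\<bar> \<le> C * K"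
      using sobolev_bounded_sup by blast
    have "t \<in> time_dom (ereal (t + 1))" using t by (simp add: time_dom_def)
    moreover have "keeps_initial_smoothness m (ereal (t + 1)) \<rho> u p" by (rule keeps) (use t in simp)
    ultimately obtain K where K: "\<And>s. s \<in> {0..t} \<Longrightarrow> sobolev_bounded m K (\<rho> s)"
      "\<And>s i. s \<in> {0..t} \<Longrightarrow> sobolev_bounded m K (\<lambda>x. u s x $ i)" "\<And>s. s \<in> {0..t} \<Longrightarrow> sobolev_bounded m K (p s)"
      unfolding keeps_initial_smoothness_def by blast
    define K' where "K' = max (\<bar>K\<bar> + 1) (C * (\<bar>K\<bar> + 1))"
    have K': "\<bar>K\<bar> \<le> K'" "K' > 0" by (auto simp: K'_def less_max_iff_disj)
    have "\<bar>u s x $ i\<bar> \<le> K'" if s: "s \<in> {0..t}" for s i x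
    proof -
      have "sobolev_bounded m (\<bar>K\<bar> + 1) (\<lambda>x. u s x $ i)" by (rule sobolev_bounded_mono[OF K(2)[OF s]]) simp
      from C(2)[OF this _ continuous_u] s have "\<bar>u s x $ i\<bar> \<le> C * (\<bar>K\<bar> + 1)" by auto
      then show ?thesis by (simp add: K'_def)
    qed
    moreover have "L2_bounded K' f" if "sobolev_bounded m K f" for f :: "real^'n \<Rightarrow> real"
      by (rule L2_bounded_mono[OF L2_bounded_of_sobolev[OF that] K'(1)])
    ultimately show "\<exists>K>0. \<forall>s\<in>{0..t}. L2_bounded K (\<rho> s) \<and> L2_bounded K (p s)
        \<and> (\<forall>i. L2_bounded K (\<lambda>x. u s x $ i)) \<and> (\<forall>i x. \<bar>u s x $ i\<bar> \<le> K)"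
      using K K'(2) by blast
  qed (use assms in \<open>simp_all add: T time_dom_infinity\<close>)
  have "integrable lborel (\<lambda>x. \<rho> 0 x *\<^sub>R u 0 x)"
    using momentum not_integrable_integral_eq unfolding total_momentum_def by blast
  from integral_bounded_linear[OF bounded_linear_vec_nth this]
  have "total_momentum \<rho> u 0 $ i = (LINT x|lborel. \<rho> 0 x * u 0 x $ i)" for i
    by (simp add: total_momentum_def)
  then have "total_momentum \<rho> u 0 = 0" using sol.momentum_zero[OF dim] by (simp add: vec_eq_iff)
  with momentum show False by simp
qed

end
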